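(* Let $\mathfrak{A}$ be a piecewise linear homogeneous (PLH) relational structure with finite relational signature that is preserved by $\max$. Then $\mathrm{CSP}(\mathfrak{A})$ is polynomial-time solvable.
   Context: Let $\mathfrak{L}$ be the structure with domain $\mathbb{Q}$, the strict order $<$, the constant $1$, and for every $c\in\mathbb{Q}$ the unary function $x\mapsto cx$. A relational structure $\mathfrak{A}$ with domain $\mathbb{Q}$ is PLH if every relation of $\mathfrak{A}$ is first-order definable over $\mathfrak{L}$. For a structure $\mathfrak{A}$ with finite relational signature $\tau$, $\mathrm{CSP}(\mathfrak{A})$ is the problem: given a finite conjunction of atomic $\tau$-formulas, decide whether it is satisfiable in $\mathfrak{A}$. $\mathfrak{A}$ is preserved by $\max$ if for every relation $R$ of $\mathfrak{A}$ and all tuples $x,y\in R$, the componentwise maximum of $x$ and $y$ is in $R$. *)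

theory Defs
  imports Complex_Main
begin

datatype lterm = LVar nat | LOne | LScale rat lterm

datatype lform =
    LLess lterm lterm
  | LEq lterm lterm
  | LNot lform
  | LAnd lform lform
  | LEx nat lform

primrec leval :: "lterm \<Rightarrow> (nat \<Rightarrow> rat) \<Rightarrow> rat" where
  "leval (LVar i) \<rho> = \<rho> i"
| "leval LOne \<rho> = 1"
| "leval (LScale c t) \<rho> = c * leval t \<rho>"

primrec lsat :: "lform \<Rightarrow> (nat \<Rightarrow> rat) \<Rightarrow> bool" where
  "lsat (LLess s t) \<rho> = (leval s \<rho> < leval t \<rho>)"
| "lsat (LEq s t) \<rho> = (leval s \<rho> = leval t \<rho>)"
| "lsat (LNot \<phi>) \<rho> = (\<not> lsat \<phi> \<rho>)"
| "lsat (LAnd \<phi> \<psi>) \<rho> = (lsat \<phi> \<rho> \<and> lsat \<psi> \<rho>)"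
| "lsat (LEx x \<phi>) \<rho> = (\<exists>q. lsat \<phi> (\<rho>(x := q)))"

definition L_definable :: "nat \<Rightarrow> rat list set \<Rightarrow> bool" where
  "L_definable k R \<longleftrightarrow> (\<exists>\<phi>. \<forall>xs \<rho>. length xs = k \<longrightarrow> (\<forall>i<k. \<rho> i = xs ! i) \<longrightarrow>
       (lsat \<phi> \<rho> \<longleftrightarrow> xs \<in> R))"

text \<open>A structure is a finite list of relations, the i-th being given as
  (arity, set of tuples); the signature consists of the indices 0..length-1.\<close>
type_synonym qstruct = "(nat \<times> rat list set) list"

definition wf_struct :: "qstruct \<Rightarrow> bool" where
  "wf_struct A \<longleftrightarrow> (\<forall>(k, R) \<in> set A. \<forall>xs \<in> R. length xs = k)"

definition PLH :: "qstruct \<Rightarrow> bool" where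
  "PLH A \<longleftrightarrow> wf_struct A \<and> (\<forall>(k, R) \<in> set A. L_definable k R)"

definition preserved_by_max :: "qstruct \<Rightarrow> bool" where
  "preserved_by_max A \<longleftrightarrow>
     (\<forall>(k, R) \<in> set A. \<forall>xs \<in> R. \<forall>ys \<in> R. map2 max xs ys \<in> R)"

datatype atom = Rel nat "nat list" | EqA nat nat

definition wf_atom :: "qstruct \<Rightarrow> atom \<Rightarrow> bool" where
  "wf_atom A a = (case a of Rel i vs \<Rightarrow> i < length A \<and> length vs = fst (A ! i)
                        | EqA u v \<Rightarrow> True)"

definition holds_atom :: "qstruct \<Rightarrow> (nat \<Rightarrow> rat) \<Rightarrow> atom \<Rightarrow> bool" where
  "holds_atom A \<rho> a = (case a of Rel i vs \<Rightarrow> i < length A \<and> map \<rho> vs \<in> snd (A ! i)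
                             | EqA u v \<Rightarrow> \<rho> u = \<rho> v)"

definition csp_sat :: "qstruct \<Rightarrow> atom list \<Rightarrow> bool" where
  "csp_sat A \<phi> \<longleftrightarrow> (\<exists>\<rho>. \<forall>a \<in> set \<phi>. holds_atom A \<rho> a)"

text \<open>Symbols: 1 = bit 0, 2 = bit 1, 3 = argument separator, 4 = end of atom,
  5 = equality marker. Numbers are written in binary, least significant bit first.\<close>
fun enc_nat :: "nat \<Rightarrow> nat list" where
  "enc_nat n = (if n = 0 then [] else (n mod 2 + 1) # enc_nat (n div 2))"

fun enc_atom :: "atom \<Rightarrow> nat list" where
  "enc_atom (Rel i vs) = enc_nat i @ concat (map (\<lambda>v. 3 # enc_nat v) vs) @ [4]"
| "enc_atom (EqA u v) = 5 # enc_nat u @ 3 # enc_nat v @ [4]"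

definition enc_inst :: "atom list \<Rightarrow> nat list" where
  "enc_inst \<phi> = concat (map enc_atom \<phi>)"

text \<open>A machine is (number of states Q, alphabet size S, transition function).
  States are 0..Q-1 with start state 0, accepting state 1, rejecting state 2
  (halting); tape symbols are 0..S-1 with blank 0; moves are -1, 0, 1.\<close>
type_synonym tm = "nat \<times> nat \<times> (nat \<Rightarrow> nat \<Rightarrow> nat \<times> nat \<times> int)"
type_synonym config = "nat \<times> (int \<Rightarrow> nat) \<times> int"

definition valid_tm :: "tm \<Rightarrow> bool" where
  "valid_tm M = (case M of (Q, S, \<delta>) \<Rightarrow> 3 \<le> Q \<and> 6 \<le> S \<and>
     (\<forall>q<Q. \<forall>s<S. case \<delta> q s of (q', s', m) \<Rightarrow> q' < Q \<and> s' < S \<and> m \<in> {-1, 0, 1}))"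

definition tm_step :: "tm \<Rightarrow> config \<Rightarrow> config" where
  "tm_step M c = (case M of (Q, S, \<delta>) \<Rightarrow> case c of (q, tp, h) \<Rightarrow>
     if q = 1 \<or> q = 2 then c
     else (case \<delta> q (tp h) of (q', s', m) \<Rightarrow> (q', tp(h := s'), h + m)))"

definition tm_init :: "nat list \<Rightarrow> config" where
  "tm_init w = (0, \<lambda>i. if 0 \<le> i \<and> i < int (length w) then w ! nat i else 0, 0)"

definition tm_run :: "tm \<Rightarrow> nat \<Rightarrow> nat list \<Rightarrow> config" where
  "tm_run M t w = (tm_step M ^^ t) (tm_init w)"

definition csp_in_P :: "qstruct \<Rightarrow> bool" where
  "csp_in_P A \<longleftrightarrow> (\<exists>M c d. valid_tm M \<and>
     (\<forall>\<phi>. (\<forall>a \<in> set \<phi>. wf_atom A a) \<longrightarrow>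
        (\<exists>t \<le> c * length (enc_inst \<phi>) ^ d + c.
           fst (tm_run M t (enc_inst \<phi>)) \<in> {1, 2} \<and>
           (fst (tm_run M t (enc_inst \<phi>)) = 1 \<longleftrightarrow> csp_sat A \<phi>))))"

end

theory Submission
  imports Defs
begin

text \<open>No quantifier elimination is needed: by an Ehrenfeucht-Fraisse argument, membership of a
  tuple in a definable relation depends only on the signs of x - c * y for finitely many
  rational numbers c, where x and y range over the entries of the tuple and the constant 1.

  The signs are realized on a small set of samples. On absolute values the conditions are
  difference constraints written multiplicatively, and the Bellman-Ford argument shows that any
  solution with N variables can be replaced by one whose values are 0 or, up to sign, products
  of at most N constants from a fixed finite set with powers of B and 1 + 1 / B, where B is a
  suitable number with O(N) digits. There are polynomially many such samples.

  Given the samples, start with the largest one for every variable and lower the value of a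
  variable to the next sample whenever some constraint has no tuple below the current values
  that attains the current value of that variable. Whether it has one is again a definable
  property of the current values, hence decided by finitely many comparisons. This never passes
  below a solution, and where it stops, closure under max turns the witnesses for the single
  coordinates into a witness for all of them, so the final values form a solution if there is
  one at all.

  To run this on a Turing machine, functions on tree-coded data are computed by programs with
  four stacks, which are the tracks of the tape. Such functions are closed under composition
  and under folds over lists as long as the intermediate results are polynomially bounded.\<close>

section \<open>Stack programs on a Turing machine\<close>

text \<open>A chain of strict inequalities can force arbitrarily many values, so the samples must
  depend on the number N of variables. Strictness is also the delicate point of the shortest-path
  argument: weights are diminished, yet no cycle may drop below 1. A fraction above 1 with numerator
  and denominator at most K^N is at least 1 + 1 / K^N, and the estimate (1 + 1 / B)^N \<le> 1 + 4^N
  / B then dictates B = (4 * K)^N. There are exponentially many sequences of N constants but only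
  polynomially many products, since a product is fixed by the multiplicities of its factors and the
  number of constants depends on the structure alone. The witnesses in the descent range over the
  whole relation and not only over samples. This is what reduces each test to one of finitely many
  procedures fixed with the structure. Folds need an a priori bound on their state, since repeated
  squaring would leave polynomial time. In the descent the bound comes for free: values are selected
  from the list of samples and never computed.\<close>

datatype cmd = Push nat nat | Pop nat | Branch nat "nat list" "cmd list" "cmd list"
  | Loop nat "nat list" "cmd list" | Halt bool

type_synonym store = "nat \<Rightarrow> nat list"

text \<open>An empty stack shows 0. As \<open>wfc\<close> allows only positive symbols to be pushed,
  \<open>Branch\<close> and \<open>Loop\<close> can test for emptiness.\<close>

definition peek :: "nat list \<Rightarrow> nat" where
  "peek xs = (case xs of [] \<Rightarrow> 0 | x # _ \<Rightarrow> x)"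

lemma peek_simps [simp]: "peek [] = 0" "peek (x # xs) = x"
  by (simp_all add: peek_def)

fun cstack :: "cmd \<Rightarrow> nat" where
  "cstack (Push r a) = r"
| "cstack (Pop r) = r"
| "cstack (Branch r A x y) = r"
| "cstack (Loop r A x) = r"
| "cstack (Halt b) = 0"

text \<open>The remaining program serves as control stack: entering a loop puts its body in front of
  the loop itself. \<open>Halt\<close> reproduces itself, so a halted configuration is
  stationary.\<close>

fun cnext :: "cmd \<Rightarrow> nat \<Rightarrow> cmd list \<Rightarrow> cmd list" where
  "cnext (Push r a) s k = k"
| "cnext (Pop r) s k = k"
| "cnext (Branch r A x y) s k = (if s \<in> set A then x @ k else y @ k)"
| "cnext (Loop r A x) s k = (if s \<in> set A then x @ Loop r A x # k else k)"
| "cnext (Halt b) s k = Halt b # k"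

fun cact :: "cmd \<Rightarrow> nat list \<Rightarrow> nat list" where
  "cact (Push r a) xs = a # xs"
| "cact (Pop r) xs = tl xs"
| "cact _ xs = xs"

fun cstep :: "cmd list \<times> store \<Rightarrow> cmd list \<times> store" where
  "cstep ([], \<sigma>) = ([], \<sigma>)"
| "cstep (c # k, \<sigma>) =
     (cnext c (peek (\<sigma> (cstack c))) k, \<sigma>(cstack c := cact c (\<sigma> (cstack c))))"

fun wfc :: "cmd \<Rightarrow> bool" where
  "wfc (Push r a) = (r < 4 \<and> 0 < a \<and> a < 6)"
| "wfc (Pop r) = (r < 4)"
| "wfc (Branch r A x y) = (r < 4 \<and> list_all wfc x \<and> list_all wfc y)"
| "wfc (Loop r A x) = (r < 4 \<and> list_all wfc x)"
| "wfc (Halt b) = True"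

text \<open>The control states of the machine are the continuations of the program that can be reached.\<close>
fun conts :: "cmd list \<Rightarrow> cmd list \<Rightarrow> cmd list set" where
  "conts [] k = {k}"
| "conts (Push r a # cs) k = insert (Push r a # cs @ k) (conts cs k)"
| "conts (Pop r # cs) k = insert (Pop r # cs @ k) (conts cs k)"
| "conts (Halt b # cs) k = insert (Halt b # cs @ k) (conts cs k)"
| "conts (Branch r A x y # cs) k = insert (Branch r A x y # cs @ k)
     (conts x (cs @ k) \<union> conts y (cs @ k) \<union> conts cs k)"
| "conts (Loop r A x # cs) k = insert (Loop r A x # cs @ k)
     (conts x (Loop r A x # cs @ k) \<union> conts cs k)"

lemma finite_conts: "finite (conts xs k)"
  by (induction xs k rule: conts.induct) auto

lemma conts_self: "xs @ k \<in> conts xs k"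
  by (induction xs k rule: conts.induct) auto

text \<open>The continuation \<open>k\<close> is excluded because there the fragment
  \<open>xs\<close> is finished and control leaves it. For \<open>k = []\<close>, the case of a
  whole program, nothing is excluded.\<close>

lemma conts_closed:
  "c # k' \<in> conts xs k \<Longrightarrow> c # k' \<noteq> k \<Longrightarrow> cnext c s k' \<in> conts xs k"
proof (induction xs k arbitrary: c k' rule: conts.induct)
  case (5 r A x y cs k)
  have self: "x @ cs @ k \<in> conts x (cs @ k)" "y @ cs @ k \<in> conts y (cs @ k)" "cs @ k \<in> conts cs k"
    by (rule conts_self)+
  have tail: "cnext c s k' \<in> conts cs k" if "c # k' \<in> conts cs k"
    using "5.IH"(3) that "5.prems"(2) .
  from "5.prems"(1) consider "c # k' = Branch r A x y # cs @ k" | "c # k' \<in> conts x (cs @ k)"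
    | "c # k' \<in> conts y (cs @ k)" | "c # k' \<in> conts cs k"
    unfolding conts.simps by blast
  then have "cnext c s k' \<in> conts x (cs @ k) \<union> conts y (cs @ k) \<union> conts cs k"
  proof cases
    case 1
    then have "c = Branch r A x y" "k' = cs @ k" by simp_all
    then show ?thesis using self by simp
  next
    case 2
    \<comment> \<open>If the body has just ended, control is at \<open>cs @ k\<close>, which already
      belongs to the states of the commands after the branch.\<close>
    show ?thesis using "5.IH"(1)[OF 2] tail self(3) by (cases "c # k' = cs @ k") simp_all
  next
    case 3
    show ?thesis using "5.IH"(2)[OF 3] tail self(3) by (cases "c # k' = cs @ k") simp_all
  next
    case 4
    then show ?thesis using tail by simp
  qed
  then show ?case unfolding conts.simps by blast
next
  case (6 r A x cs k)
  have self: "x @ Loop r A x # cs @ k \<in> conts x (Loop r A x # cs @ k)" "cs @ k \<in> conts cs k"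
    by (rule conts_self)+
  from "6.prems"(1) consider "c # k' = Loop r A x # cs @ k"
    | "c # k' \<in> conts x (Loop r A x # cs @ k)" "c # k' \<noteq> Loop r A x # cs @ k" | "c # k' \<in> conts cs k"
    unfolding conts.simps by blast
  then have "cnext c s k' \<in> conts x (Loop r A x # cs @ k) \<union> conts cs k"
  proof cases
    case 1
    then have "c = Loop r A x" "k' = cs @ k" by simp_all
    then show ?thesis using self by simp
  next
    case 2
    show ?thesis using "6.IH"(1)[OF 2] by simp
  next
    case 3
    show ?thesis using "6.IH"(2)[OF 3 "6.prems"(2)] by simp
  qed
  then show ?case unfolding conts.simps by blast
next
  case (2 r a cs k)
  from "2.prems"(1) consider "c # k' = Push r a # cs @ k" | "c # k' \<in> conts cs k"
    unfolding conts.simps by blast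
  then show ?case
  proof cases
    case 1
    then have "c = Push r a" "k' = cs @ k" by simp_all
    then show ?thesis using conts_self[of cs k] by simp
  next
    case 2
    show ?thesis using "2.IH"[OF 2 "2.prems"(2)] by simp
  qed
next
  case (3 r cs k)
  from "3.prems"(1) consider "c # k' = Pop r # cs @ k" | "c # k' \<in> conts cs k"
    unfolding conts.simps by blast
  then show ?case
  proof cases
    case 1
    then have "c = Pop r" "k' = cs @ k" by simp_all
    then show ?thesis using conts_self[of cs k] by simp
  next
    case 2
    show ?thesis using "3.IH"[OF 2 "3.prems"(2)] by simp
  qed
next
  case (4 b cs k)
  from "4.prems"(1) consider "c # k' = Halt b # cs @ k" | "c # k' \<in> conts cs k"
    unfolding conts.simps by blast
  then show ?case
  proof cases
    case 1
    then have "c = Halt b" "k' = cs @ k" by simp_all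
    then show ?thesis using conts_self[of cs k] by simp
  next
    case 2
    show ?thesis using "4.IH"[OF 2 "4.prems"(2)] by simp
  qed
next
  case (1 k)
  then show ?case unfolding conts.simps by blast
qed

lemma conts_wf:
  "list_all wfc xs \<Longrightarrow> list_all wfc k \<Longrightarrow> k' \<in> conts xs k \<Longrightarrow> list_all wfc k'"
proof (induction xs k arbitrary: k' rule: conts.induct)
  case (5 r A x y cs k)
  have "list_all wfc (cs @ k)" using "5.prems" by simp
  then show ?case using "5.prems" "5.IH"[of k'] unfolding conts.simps by fastforce
next
  case (6 r A x cs k)
  have "list_all wfc (Loop r A x # cs @ k)" using "6.prems" by simp
  then show ?case using "6.prems" "6.IH"[of k'] unfolding conts.simps by fastforce
qed fastforce+

definition dig :: "nat \<Rightarrow> nat \<Rightarrow> nat" where "dig r x = x div 6 ^ r mod 6"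

text \<open>A tape cell holds four tracks, one for each stack, as digits in base 6. An input symbol is a
  cell whose other tracks are empty, so the input is already the content of stack 0, with its
  last symbol on top. The marker is written to cell -1, below the bottom of all stacks.\<close>
definition cell :: "(nat \<Rightarrow> nat) \<Rightarrow> nat" where
  "cell f = f 0 + 6 * (f 1 + 6 * (f 2 + 6 * f 3))"

definition setdig :: "nat \<Rightarrow> nat \<Rightarrow> nat \<Rightarrow> nat" where
  "setdig r a x = cell ((\<lambda>i. dig i x)(r := a))"

text \<open>1296 = 6^4 is the least number that is not the content of a cell, so the marker is
  recognised by its value and the tape alphabet gets one symbol more.\<close>

abbreviation marker :: nat where "marker \<equiv> 1296"

lemma less4: "(r::nat) < 4 \<longleftrightarrow> r = 0 \<or> r = 1 \<or> r = 2 \<or> r = 3" by auto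

lemma dig_cell:
  assumes "r < 4" "\<And>i. f i < 6"
  shows "dig r (cell f) = f r"
proof -
  have "f 0 < 6" "f 1 < 6" "f 2 < 6" "f 3 < 6" by (rule assms(2))+
  moreover have "dig 1 x = x div 6 mod 6" "dig 2 x = x div 6 div 6 mod 6"
    "dig 3 x = x div 6 div 6 div 6 mod 6" "dig 0 x = x mod 6" for x
    by (simp_all add: dig_def div_mult2_eq[symmetric])
  moreover have "(a + 6 * n) mod 6 = a" "(a + 6 * n) div 6 = n" if "a < 6" for a n :: nat
    using that by simp_all
  ultimately show ?thesis using assms(1) unfolding cell_def less4
    by (auto simp del: distrib_left_numeral)
qed

lemma dig_less: "dig r x < 6" by (simp add: dig_def)

lemma cell_less:
  assumes "\<And>i. f i < 6" shows "cell f < marker"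
proof -
  have "f i \<le> 5" for i using assms[of i] by simp
  from this[of 0] this[of 1] this[of 2] this[of 3] show ?thesis unfolding cell_def by simp
qed

lemma cell_cong: "(\<And>r. r < 4 \<Longrightarrow> f r = g r) \<Longrightarrow> cell f = cell g"
  unfolding cell_def by simp

lemma setdig_cell:
  assumes "\<And>i. f i < 6"
  shows "setdig r a (cell f) = cell (f(r := a))"
  unfolding setdig_def using assms by (intro cell_cong) (auto simp: dig_cell)

lemma setdig_less: "a < 6 \<Longrightarrow> setdig r a x < marker"
  unfolding setdig_def by (rule cell_less) (auto simp: dig_less)

text \<open>Between two commands the head rests on the marker. \<open>Seek\<close> walks right to
  the first blank of the relevant track and steps back, \<open>Act\<close> works there on the top of
  the stack or, for an empty stack, on the marker, \<open>Put\<close> writes one cell further right,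
  and \<open>Back\<close> returns to the marker.\<close>

datatype mstate = Start | Mark | Acc | Rej | Seek "cmd list" | Act "cmd list"
  | Put nat nat "cmd list" | Back "cmd list"

text \<open>The last equation makes a program that runs out of commands without \<open>Halt\<close>
  reject.\<close>

fun delta :: "cmd list \<Rightarrow> mstate \<Rightarrow> nat \<Rightarrow> mstate \<times> nat \<times> int" where
  "delta P Start x = (Mark, x, -1)"
| "delta P Mark x = (Seek P, marker, 0)"
| "delta P (Seek (Halt b # k)) x = (if b then Acc else Rej, x, 0)"
| "delta P (Seek (c # k)) x =
     (if x = marker \<or> dig (cstack c) x \<noteq> 0 then (Seek (c # k), x, 1) else (Act (c # k), x, -1))"
| "delta P (Act (Push r a # k)) x = (Put r a k, x, 1)"
| "delta P (Act (Pop r # k)) x = (Back k, if x = marker then x else setdig r 0 x, 0)"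
| "delta P (Act (c # k)) x = (Back (cnext c (if x = marker then 0 else dig (cstack c) x) k), x, 0)"
| "delta P (Put r a k) x = (Back k, setdig r a x, 0)"
| "delta P (Back k) x = (if x = marker then (Seek k, x, 0) else (Back k, x, -1))"
| "delta P _ x = (Rej, x, 0)"

fun astep :: "cmd list \<Rightarrow> mstate \<times> (int \<Rightarrow> nat) \<times> int \<Rightarrow> mstate \<times> (int \<Rightarrow> nat) \<times> int" where
  "astep P (q, tp, h) = (if q = Acc \<or> q = Rej then (q, tp, h)
     else (case delta P q (tp h) of (q', s', m) \<Rightarrow> (q', tp(h := s'), h + m)))"

definition mstates :: "cmd list \<Rightarrow> mstate set" where
  "mstates P = {Start, Mark, Acc, Rej} \<union> Seek ` conts P [] \<union> Act ` conts P [] \<union> Back ` conts P []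
     \<union> (\<lambda>(r, a, k). Put r a k) ` ({..<4} \<times> {0<..<6} \<times> conts P [])"

lemma finite_mstates: "finite (mstates P)"
  unfolding mstates_def by (intro finite_UnI finite_imageI finite_cartesian_product) (auto simp: finite_conts)

lemma delta_closed:
  assumes P: "list_all wfc P" and q: "q \<in> mstates P" and x: "x \<le> marker"
    and d: "delta P q x = (q', x', m)"
  shows "q' \<in> mstates P \<and> x' \<le> marker \<and> m \<in> {-1, 0, 1}"
proof -
  have wf: "list_all wfc k" if "k \<in> conts P []" for k
    using conts_wf[OF P _ that] by simp
  have nx: "cnext c s k \<in> conts P []" if "c # k \<in> conts P []" for c s k
    using conts_closed[OF that] by simp
  have tl1: "k \<in> conts P []" if "Push r a # k \<in> conts P []" for k r a using nx[OF that] by simp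
  have tl2: "k \<in> conts P []" if "Pop r # k \<in> conts P []" for k r using nx[OF that] by simp
  have sd: "setdig r a x \<le> marker" if "a < 6" for r a using setdig_less[OF that, of r x] by simp
  have PP: "P \<in> conts P []" using conts_self[of P "[]"] by simp
  show ?thesis
  proof (cases q)
    case (Act k)
    show ?thesis
    proof (cases k)
      case (Cons c k')
      have k: "c # k' \<in> conts P []" using q Act Cons unfolding mstates_def by auto
      have "wfc c" using wf[OF k] by simp
      have B: "Back k \<in> mstates P" if "k \<in> conts P []" for k using that by (simp add: mstates_def)
      have "(m \<in> {-1, 0, 1} \<and> x' \<le> marker) \<and> ((\<exists>s. q' = Back (cnext c s k')) \<or> (\<exists>r a. c = Push r a \<and> q' = Put r a k'))"
        using d x sd[of 0] unfolding Act Cons by (cases c) (auto simp del: cnext.simps simp: cnext.simps(2) split: if_splits)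
      moreover have "Put r a k' \<in> mstates P" if "c = Push r a" for r a
        using \<open>wfc c\<close> tl1 k that unfolding mstates_def
        by (intro UnI2 image_eqI[of _ _ "(r, a, k')"]) auto
      ultimately show ?thesis using B[OF nx[OF k]] by blast
    qed (use d Act x in \<open>auto simp: mstates_def\<close>)
  next
    case (Seek k)
    show ?thesis
    proof (cases k)
      case (Cons c k')
      have k: "c # k' \<in> conts P []" using q Seek Cons unfolding mstates_def by auto
      then have "Seek (c # k') \<in> mstates P" "Act (c # k') \<in> mstates P" "Acc \<in> mstates P" "Rej \<in> mstates P"
        by (simp_all add: mstates_def)
      then show ?thesis using d x unfolding Seek Cons by (cases c) (auto split: if_splits)
    qed (use d Seek x in \<open>auto simp: mstates_def\<close>)
  qed (use d q x PP sd in \<open>auto simp: mstates_def split: if_splits\<close>)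
qed

section \<open>Stores as tapes, and the simulation of commands by sweeps of the head\<close>

definition sget :: "nat list \<Rightarrow> nat \<Rightarrow> nat" where
  "sget xs n = (if n < length xs then rev xs ! n else 0)"

text \<open>Stacks are lists with the top in front, while tracks grow to the right from cell 0;
  hence the reversal in \<open>sget\<close>, whose value 0 above the top is the blank digit.\<close>

definition tape_of :: "store \<Rightarrow> int \<Rightarrow> nat" where
  "tape_of \<sigma> i = (if i = -1 then marker else if i < -1 then 0 else cell (\<lambda>r. sget (\<sigma> r) (nat i)))"

definition wf_store :: "store \<Rightarrow> bool" where
  "wf_store \<sigma> \<longleftrightarrow> (\<forall>r. \<forall>a\<in>set (\<sigma> r). 0 < a \<and> a < 6)"

lemma sget_mem: "n < length xs \<Longrightarrow> sget xs n \<in> set xs"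
  unfolding sget_def by (simp add: rev_nth)

lemma sget_beyond: "\<not> n < length xs \<Longrightarrow> sget xs n = 0"
  unfolding sget_def by simp

lemma wf_store_sget: "wf_store \<sigma> \<Longrightarrow> sget (\<sigma> r) n < 6"
  using sget_mem[of n "\<sigma> r"] sget_beyond[of n "\<sigma> r"] unfolding wf_store_def by force

lemma sget_pos: "wf_store \<sigma> \<Longrightarrow> sget (\<sigma> r) n \<noteq> 0 \<longleftrightarrow> n < length (\<sigma> r)"
  using sget_mem[of n "\<sigma> r"] sget_beyond[of n "\<sigma> r"] unfolding wf_store_def by force

lemma sget_push: "sget (a # xs) n = (if n = length xs then a else sget xs n)"
  unfolding sget_def by (auto simp: nth_append)

lemma tape_push:
  assumes "wf_store \<sigma>" "r < 4"
  shows "(tape_of \<sigma>)(int (length (\<sigma> r)) := setdig r a (tape_of \<sigma> (int (length (\<sigma> r)))))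
    = tape_of (\<sigma>(r := a # \<sigma> r))"
proof
  fix i
  show "((tape_of \<sigma>)(int (length (\<sigma> r)) := setdig r a (tape_of \<sigma> (int (length (\<sigma> r)))))) i
    = tape_of (\<sigma>(r := a # \<sigma> r)) i"
    using assms by (auto simp: tape_of_def setdig_cell wf_store_sget sget_push intro!: cell_cong)
qed

lemma tape_pop:
  assumes "wf_store \<sigma>" "r < 4" "\<sigma> r = x # xs"
  shows "(tape_of \<sigma>)(int (length xs) := setdig r 0 (tape_of \<sigma> (int (length xs))))
    = tape_of (\<sigma>(r := xs))"
proof
  fix i
  have z: "sget xs (length xs) = 0" by (simp add: sget_def)
  show "((tape_of \<sigma>)(int (length xs) := setdig r 0 (tape_of \<sigma> (int (length xs))))) i
    = tape_of (\<sigma>(r := xs)) i"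
    using assms z by (auto simp: tape_of_def setdig_cell wf_store_sget sget_push intro!: cell_cong)
qed

lemma tape_nonneg:
  assumes "wf_store \<sigma>" "r < 4" "0 \<le> h"
  shows "tape_of \<sigma> h \<noteq> marker" "dig r (tape_of \<sigma> h) = sget (\<sigma> r) (nat h)"
proof -
  have "tape_of \<sigma> h = cell (\<lambda>r. sget (\<sigma> r) (nat h))" using assms by (simp add: tape_of_def)
  then show "tape_of \<sigma> h \<noteq> marker" "dig r (tape_of \<sigma> h) = sget (\<sigma> r) (nat h)"
    using assms cell_less[of "\<lambda>r. sget (\<sigma> r) (nat h)"] by (simp_all add: wf_store_sget dig_cell)
qed

text \<open>Tracks have no gaps: stack symbols are positive, so by \<open>sget_pos\<close> the first
  blank of a track sits exactly at the height of its stack.\<close>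

lemma go_seek:
  assumes wf: "wf_store \<sigma>" and r: "cstack c < 4" and c: "\<And>b. c \<noteq> Halt b"
    and h: "-1 \<le> h" "h \<le> int (length (\<sigma> (cstack c)))"
  shows "(astep P ^^ (nat (int (length (\<sigma> (cstack c))) - h) + 1)) (Seek (c # k), tape_of \<sigma>, h)
    = (Act (c # k), tape_of \<sigma>, int (length (\<sigma> (cstack c))) - 1)"
  using h
proof (induction "nat (int (length (\<sigma> (cstack c))) - h)" arbitrary: h)
  case 0
  then have e: "h = int (length (\<sigma> (cstack c)))" by simp
  have "0 \<le> h" using e by simp
  from tape_nonneg[OF wf r this] have "tape_of \<sigma> h \<noteq> marker" "dig (cstack c) (tape_of \<sigma> h) = 0"
    using e by (simp_all add: sget_def)
  then show ?case using c e by (cases c) auto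
next
  case (Suc n)
  have lt: "h < int (length (\<sigma> (cstack c)))" using Suc by linarith
  have "tape_of \<sigma> h = marker \<or> dig (cstack c) (tape_of \<sigma> h) \<noteq> 0"
  proof (cases "h = -1")
    case False
    then have "0 \<le> h" using Suc by linarith
    then show ?thesis using tape_nonneg[OF wf r \<open>0 \<le> h\<close>] lt sget_pos[OF wf, of "cstack c" "nat h"]
      by simp
  qed (simp add: tape_of_def)
  then have s1: "astep P (Seek (c # k), tape_of \<sigma>, h) = (Seek (c # k), tape_of \<sigma>, h + 1)"
    using c by (cases c) auto
  have n: "n = nat (int (length (\<sigma> (cstack c))) - (h + 1))" using Suc by linarith
  have "nat (int (length (\<sigma> (cstack c))) - h) + 1 = Suc (n + 1)" using Suc by simp
  then have "(astep P ^^ (nat (int (length (\<sigma> (cstack c))) - h) + 1)) (Seek (c # k), tape_of \<sigma>, h)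
    = (astep P ^^ (n + 1)) (Seek (c # k), tape_of \<sigma>, h + 1)"
    using s1 by (simp only: funpow_Suc_right o_apply)
  also have "\<dots> = (Act (c # k), tape_of \<sigma>, int (length (\<sigma> (cstack c))) - 1)"
    using Suc.hyps(1)[OF n] lt Suc.prems n by simp
  finally show ?case .
qed

lemma go_back:
  assumes wf: "wf_store \<sigma>" and h: "-1 \<le> h"
  shows "(astep P ^^ (nat (h + 2))) (Back k, tape_of \<sigma>, h) = (Seek k, tape_of \<sigma>, -1)"
  using h
proof (induction "nat (h + 1)" arbitrary: h)
  case 0
  then have h: "h = -1" using "0.prems" by simp
  have "tape_of \<sigma> (-1) = marker" by (simp add: tape_of_def)
  then show ?case unfolding h by (simp add: fun_upd_idem)
next
  case (Suc n)
  then have h: "0 \<le> h" by linarith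
  have s1: "astep P (Back k, tape_of \<sigma>, h) = (Back k, tape_of \<sigma>, h - 1)"
    using tape_nonneg(1)[OF wf _ h, of 0] by simp
  have e: "nat (h + 2) = Suc (nat (h - 1 + 2))" using h by linarith
  show ?case unfolding e funpow_Suc_right o_apply s1
    using Suc.hyps(1)[of "h - 1"] Suc.hyps(2) h by simp
qed

lemma wf_store_cstep:
  assumes "wf_store \<sigma>" "wfc c"
  shows "wf_store (snd (cstep (c # k, \<sigma>)))"
proof -
  have "set (tl xs) \<subseteq> set xs" for xs :: "nat list" by (cases xs) auto
  then show ?thesis using assms unfolding wf_store_def by (cases c) auto
qed

lemma funpow_trans: "(f ^^ n) x = y \<Longrightarrow> (f ^^ m) y = z \<Longrightarrow> (f ^^ (m + n)) x = z"
  by (simp add: funpow_add)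

text \<open>One sweep to the top and back: at most \<open>H + 2\<close> steps of
  \<open>Seek\<close>, two steps of work and \<open>H + 2\<close> steps of
  \<open>Back\<close>.\<close>

lemma simulate_step:
  assumes wf: "wf_store \<sigma>" and c: "wfc c" and nh: "\<And>b. c \<noteq> Halt b"
    and len: "\<And>r. length (\<sigma> r) \<le> H"
  shows "\<exists>t \<le> 2 * H + 7. (astep P ^^ t) (Seek (c # k), tape_of \<sigma>, -1)
    = (Seek (fst (cstep (c # k, \<sigma>))), tape_of (snd (cstep (c # k, \<sigma>))), -1)"
proof -
  define r where "r = cstack c"
  define l where "l = length (\<sigma> r)"
  have r: "r < 4" using c nh unfolding r_def by (cases c) auto
  define p where "p = (astep P ^^ (l + 2)) (Seek (c # k), tape_of \<sigma>, -1)"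
  have p: "p = (Act (c # k), tape_of \<sigma>, int l - 1)"
    using go_seek[OF wf, of c "-1" P k] r nh unfolding p_def l_def r_def
    by (simp add: nat_add_distrib)
  have lH: "l \<le> H" using len l_def by simp
  \<comment> \<open>For an empty stack the head stands on the marker, which is read as the 0 that
    \<open>peek\<close> reports.\<close>
  have pk: "(if tape_of \<sigma> (int l - 1) = marker then 0 else dig r (tape_of \<sigma> (int l - 1))) = peek (\<sigma> r)"
  proof (cases "\<sigma> r")
    case Nil
    then show ?thesis by (simp add: l_def tape_of_def)
  next
    case (Cons x xs)
    then have "0 \<le> int l - 1" "nat (int l - 1) = length xs" by (simp_all add: l_def)
    then show ?thesis using tape_nonneg[OF wf r, of "int l - 1"] Cons by (simp add: sget_push)
  qed
  let ?e = "cstep (c # k, \<sigma>)"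
  have wf': "wf_store (snd ?e)" by (rule wf_store_cstep[OF wf c])
  have "\<exists>t h. t \<le> 2 \<and> -1 \<le> h \<and> h \<le> int l \<and> (astep P ^^ t) p = (Back (fst ?e), tape_of (snd ?e), h)"
  proof (cases c)
    case (Push r' a)
    then have [simp]: "r' = r" by (simp add: r_def)
    have "(astep P ^^ 2) p = (Back (fst ?e), tape_of (snd ?e), int l)"
      using tape_push[OF wf r, of a] Push unfolding p by (simp add: numeral_2_eq_2 l_def)
    then show ?thesis by (intro exI[of _ 2] exI[of _ "int l"]) simp
  next
    case (Pop r')
    then have [simp]: "r' = r" by (simp add: r_def)
    have "(astep P ^^ 1) p = (Back (fst ?e), tape_of (snd ?e), int l - 1)"
    proof (cases "\<sigma> r")
      case Nil
      then have e: "\<sigma>(r := []) = \<sigma>" by (metis fun_upd_triv)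
      have "tape_of \<sigma> (int l - 1) = marker" using Nil by (simp add: l_def tape_of_def)
      then show ?thesis using Pop Nil e unfolding p by (simp add: fun_upd_idem)
    next
      case (Cons x xs)
      then have l: "int l - 1 = int (length xs)" by (simp add: l_def)
      have "tape_of \<sigma> (int l - 1) \<noteq> marker" using tape_nonneg(1)[OF wf r, of "int l - 1"] l by simp
      then show ?thesis using Pop Cons l tape_pop[OF wf r Cons] unfolding p by simp
    qed
    then show ?thesis using l_def by (intro exI[of _ 1] exI[of _ "int l - 1"]) simp
  next
    case (Branch r' A x y)
    then have [simp]: "r' = r" by (simp add: r_def)
    from Branch have "(astep P ^^ 1) p = (Back (fst ?e), tape_of (snd ?e), int l - 1)"
      using pk unfolding p by (simp split: if_splits)
    then show ?thesis by (intro exI[of _ 1] exI[of _ "int l - 1"]) simp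
  next
    case (Loop r' A x)
    then have [simp]: "r' = r" by (simp add: r_def)
    from Loop have "(astep P ^^ 1) p = (Back (fst ?e), tape_of (snd ?e), int l - 1)"
      using pk unfolding p by (simp split: if_splits)
    then show ?thesis by (intro exI[of _ 1] exI[of _ "int l - 1"]) simp
  qed (use nh in simp)
  then obtain t h where t: "t \<le> 2" "-1 \<le> h" "h \<le> int l"
    and s: "(astep P ^^ t) p = (Back (fst ?e), tape_of (snd ?e), h)" by blast
  have "(astep P ^^ (nat (h + 2) + (t + (l + 2)))) (Seek (c # k), tape_of \<sigma>, -1)
    = (Seek (fst ?e), tape_of (snd ?e), -1)"
    by (intro funpow_trans[OF funpow_trans[OF _ s] go_back[OF wf' t(2)]]) (simp add: p_def)
  moreover have "nat (h + 2) + (t + (l + 2)) \<le> 2 * H + 7" using t lH by linarith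
  ultimately show ?thesis by blast
qed

lemma cstep_wf:
  assumes "wf_store \<sigma>" "k \<in> conts P []" "list_all wfc P" "cstep (k, \<sigma>) = (k', \<sigma>')"
  shows "wf_store \<sigma>'" "k' \<in> conts P []"
proof -
  have "wf_store \<sigma>' \<and> k' \<in> conts P []"
  proof (cases k)
    case (Cons c k0)
    have "wfc c" using conts_wf[OF assms(3) _ assms(2)] Cons by simp
    then have "wf_store \<sigma>'" using wf_store_cstep[OF assms(1), of c k0] assms(4) Cons by simp
    moreover have "k' \<in> conts P []" using conts_closed[of c k0 P "[]"] assms Cons by auto
    ultimately show ?thesis by simp
  qed (use assms in simp)
  then show "wf_store \<sigma>'" "k' \<in> conts P []" by simp_all
qed

lemma length_cstep: "length (snd (cstep (k, \<sigma>)) r) \<le> Suc (length (\<sigma> r))"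
  by (cases k) (auto, (cases "hd k"; auto))

lemma length_csteps: "length (snd ((cstep ^^ n) (k, \<sigma>)) r) \<le> length (\<sigma> r) + n"
proof (induction n)
  case (Suc n)
  show ?case using length_cstep[of "fst ((cstep ^^ n) (k, \<sigma>))" "snd ((cstep ^^ n) (k, \<sigma>))" r] Suc
    by simp
qed simp

text \<open>Each command lengthens a stack by at most one symbol, so \<open>H + n\<close> bounds the
  heights, and thereby every sweep, during \<open>n\<close> commands.\<close>

lemma simulate_steps:
  assumes "wf_store \<sigma>" "list_all wfc P" "k \<in> conts P []"
    and len: "\<And>r. length (\<sigma> r) \<le> H"
    and "(cstep ^^ n) (k, \<sigma>) = (Halt b # k', \<sigma>')"
  shows "\<exists>t \<le> n * (2 * (H + n) + 7) + 1.
    fst ((astep P ^^ t) (Seek k, tape_of \<sigma>, -1)) = (if b then Acc else Rej)"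
  using assms
proof (induction n arbitrary: k \<sigma> H)
  case 0
  then show ?case by (intro exI[of _ 1]) auto
next
  case (Suc n)
  show ?case
  proof (cases "\<exists>b k'. k = Halt b # k'")
    \<comment> \<open>The program may have halted before the last of the \<open>n + 1\<close> steps;
      as \<open>Halt\<close> reproduces itself, the remaining ones change nothing.\<close>
    case True
    then obtain b0 k0 where k: "k = Halt b0 # k0" by blast
    have "cstep (k, \<sigma>) = (k, \<sigma>)" unfolding k by simp
    then have "(cstep ^^ m) (k, \<sigma>) = (k, \<sigma>)" for m by (induction m) auto
    then have "b0 = b" using Suc.prems(5) k by simp
    then show ?thesis using k by (intro exI[of _ 1]) auto
  next
    case nh: False
    obtain k1 \<sigma>1 where s: "cstep (k, \<sigma>) = (k1, \<sigma>1)" by fastforce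
    have n: "(cstep ^^ n) (k1, \<sigma>1) = (Halt b # k', \<sigma>')"
      using Suc.prems(5) s by (simp only: funpow_Suc_right o_apply)
    have "k \<noteq> []"
    proof
      assume k: "k = []"
      have "(cstep ^^ m) ([], \<sigma>) = ([], \<sigma>)" for m by (induction m) auto
      then show False using Suc.prems(5) k by simp
    qed
    then obtain c k0 where k: "k = c # k0" by (cases k) auto
    have c: "wfc c" using conts_wf[OF Suc.prems(2) _ Suc.prems(3)] k by simp
    obtain t1 where t1: "t1 \<le> 2 * H + 7"
      "(astep P ^^ t1) (Seek k, tape_of \<sigma>, -1) = (Seek k1, tape_of \<sigma>1, -1)"
      using simulate_step[OF Suc.prems(1) c _ Suc.prems(4), of P k0] nh k s by auto
    have len: "length (\<sigma>1 r) \<le> Suc H" for r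
      using length_cstep[of k \<sigma> r] s Suc.prems(4)[of r] by simp
    obtain t2 where t2: "t2 \<le> n * (2 * (Suc H + n) + 7) + 1"
      "fst ((astep P ^^ t2) (Seek k1, tape_of \<sigma>1, -1)) = (if b then Acc else Rej)"
      using Suc.IH[OF cstep_wf(1)[OF Suc.prems(1,3,2) s] Suc.prems(2)
        cstep_wf(2)[OF Suc.prems(1,3,2) s] len n] by blast
    have "fst ((astep P ^^ (t2 + t1)) (Seek k, tape_of \<sigma>, -1)) = (if b then Acc else Rej)"
      using t1(2) t2(2) by (simp add: funpow_add)
    moreover have "t2 + t1 \<le> Suc n * (2 * (H + Suc n) + 7) + 1" using t1(1) t2(1) by simp
    ultimately show ?thesis by blast
  qed
qed

definition init_store :: "nat list \<Rightarrow> store" where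
  "init_store w = (\<lambda>_. [])(0 := rev w)"

lemma tape_init:
  "((\<lambda>i. if 0 \<le> i \<and> i < int (length w) then w ! nat i else 0)(-1 := marker)) = tape_of (init_store w)"
  by (auto simp: tape_of_def init_store_def cell_def sget_def nat_less_iff)

text \<open>The numbering has to respect the prescribed initial and halting states.\<close>
lemma ex_numbering:
  assumes "finite X" "Start \<in> X" "Acc \<in> X" "Rej \<in> X"
  obtains num :: "mstate \<Rightarrow> nat" and Q where "bij_betw num X {..<Q}" "3 \<le> Q"
    "num Start = 0" "num Acc = 1" "num Rej = 2"
proof -
  define Y where "Y = X - {Start, Acc, Rej}"
  have "finite Y" using assms by (simp add: Y_def)
  then obtain h where h: "bij_betw h Y {0..<card Y}" using ex_bij_betw_finite_nat by blast
  define num where "num = (\<lambda>q. if q = Start then 0 else if q = Acc then 1 else if q = Rej then 2 else h q + 3)"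
  have "bij_betw (\<lambda>n::nat. n + 3) {0..<card Y} {3..<card Y + 3}"
    by (auto simp: bij_betw_def inj_on_def image_iff intro: bexI[of _ "_ - 3"])
  from bij_betw_trans[OF h this] have "bij_betw num Y {3..<card Y + 3}"
    by (rule bij_betw_cong[THEN iffD1, rotated]) (auto simp: num_def Y_def)
  moreover have "bij_betw num {Start, Acc, Rej} {0, 1, 2}"
    by (auto simp: bij_betw_def inj_on_def num_def)
  ultimately have "bij_betw num (Y \<union> {Start, Acc, Rej}) ({3..<card Y + 3} \<union> {0, 1, 2})"
    by (rule bij_betw_combine) auto
  moreover have "Y \<union> {Start, Acc, Rej} = X" using assms by (auto simp: Y_def)
  moreover have "{3..<card Y + 3} \<union> {0, 1, 2} = {..<card Y + 3}" by auto
  ultimately have "bij_betw num X {..<card Y + 3}" by simp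
  then show thesis by (rule that) (auto simp: num_def)
qed

text \<open>The time is roughly quadratic in the number of commands, as each costs a sweep over the
  tape used so far. The additive 3 consists of the steps out of \<open>Start\<close> and
  \<open>Mark\<close> and the one that halts.\<close>

theorem stack_program_tm:
  assumes P: "list_all wfc P"
  shows "\<exists>M. valid_tm M \<and> (\<forall>w n b k' \<sigma>'. set w \<subseteq> {0<..<6} \<longrightarrow>
    (cstep ^^ n) (P, init_store w) = (Halt b # k', \<sigma>') \<longrightarrow>
    (\<exists>t \<le> n * (2 * (length w + n) + 7) + 3. fst (tm_run M t w) = (if b then 1 else 2)))"
proof -
  obtain num :: "mstate \<Rightarrow> nat" and Q where num: "bij_betw num (mstates P) {..<Q}" "3 \<le> Q"
    "num Start = 0" "num Acc = 1" "num Rej = 2"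
    by (rule ex_numbering[OF finite_mstates[of P]]) (auto simp: mstates_def)
  define inum where "inum = the_inv_into (mstates P) num"
  have inj: "inj_on num (mstates P)" using num(1) by (simp add: bij_betw_def)
  have inum: "inum (num q) = q" if "q \<in> mstates P" for q
    unfolding inum_def using the_inv_into_f_f[OF inj that] .
  have inum': "inum n \<in> mstates P" if "n < Q" for n
    unfolding inum_def using the_inv_into_into[OF inj, of n "mstates P"] num(1) that
    by (auto simp: bij_betw_def)
  have numQ: "num q < Q" if "q \<in> mstates P" for q using num(1) that by (auto simp: bij_betw_def)
  define \<delta> where "\<delta> = (\<lambda>n x. case delta P (inum n) x of (q, x', m) \<Rightarrow> (num q, x', m))"
  define M :: tm where "M = (Q, marker + 1, \<delta>)"
  have valid: "valid_tm M"
  proof -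
    have "case \<delta> q s of (q', s', m) \<Rightarrow> q' < Q \<and> s' < marker + 1 \<and> m \<in> {-1, 0, 1}"
      if "q < Q" "s < marker + 1" for q s
      using delta_closed[OF P inum'[OF that(1)], of s] that numQ
      by (auto simp: \<delta>_def split: prod.splits)
    then show ?thesis unfolding M_def valid_tm_def using num(2) by auto
  qed
  have mem: "Start \<in> mstates P" "Acc \<in> mstates P" "Rej \<in> mstates P" by (auto simp: mstates_def)
  have step: "tm_step M (num q, tp, h) = (num (fst (astep P (q, tp, h))), snd (astep P (q, tp, h)))"
    if "q \<in> mstates P" for q tp h
  proof -
    have "num q = 1 \<longleftrightarrow> q = Acc" "num q = 2 \<longleftrightarrow> q = Rej"
      using inj_onD[OF inj, of q Acc] inj_onD[OF inj, of q Rej] that mem num by auto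
    then show ?thesis using inum[OF that] unfolding M_def tm_step_def \<delta>_def
      by (auto split: prod.splits)
  qed
  have closed: "fst (astep P (q, tp, h)) \<in> mstates P \<and> (\<forall>i. fst (snd (astep P (q, tp, h))) i \<le> marker)"
    if "q \<in> mstates P" "\<forall>i. tp i \<le> marker" for q tp h
    using delta_closed[OF P that(1), of "tp h"] that by (auto split: prod.splits)
  have steps: "(tm_step M ^^ t) (num q, tp, h)
      = (num (fst ((astep P ^^ t) (q, tp, h))), snd ((astep P ^^ t) (q, tp, h)))"
    if "q \<in> mstates P" "\<forall>i. tp i \<le> marker" for q tp h t
  proof -
    have "fst ((astep P ^^ t) (q, tp, h)) \<in> mstates P \<and> (\<forall>i. fst (snd ((astep P ^^ t) (q, tp, h))) i \<le> marker)
      \<and> ?thesis"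
    proof (induction t)
      case (Suc t)
      obtain q' tp' h' where e: "(astep P ^^ t) (q, tp, h) = (q', tp', h')" by (metis prod_cases3)
      show ?case using Suc closed[of q' tp' h'] step[of q' tp' h'] unfolding e
        by (simp add: e del: astep.simps)
    qed (use that in simp)
    then show ?thesis by blast
  qed
  have "\<exists>t \<le> n * (2 * (length w + n) + 7) + 3. fst (tm_run M t w) = (if b then 1 else 2)"
    if w: "set w \<subseteq> {0<..<6}" and run: "(cstep ^^ n) (P, init_store w) = (Halt b # k', \<sigma>')"
    for w n b k' \<sigma>'
  proof -
    let ?tp = "\<lambda>i. if 0 \<le> i \<and> i < int (length w) then w ! nat i else 0"
    have tp: "\<forall>i. ?tp i \<le> marker"
    proof
      fix i
      have "w ! nat i < 6" if "0 \<le> i" "i < int (length w)"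
      proof -
        have "nat i < length w" using that by linarith
        then show ?thesis using w nth_mem by fastforce
      qed
      then show "?tp i \<le> marker" by force
    qed
    have wf: "wf_store (init_store w)" using w by (auto simp: wf_store_def init_store_def)
    have PP: "P \<in> conts P []" using conts_self[of P "[]"] by simp
    have "length (init_store w r) \<le> length w" for r by (simp add: init_store_def)
    from simulate_steps[OF wf P PP this run] obtain t
      where t: "t \<le> n * (2 * (length w + n) + 7) + 1"
      "fst ((astep P ^^ t) (Seek P, tape_of (init_store w), -1)) = (if b then Acc else Rej)" by blast
    have "(astep P ^^ 2) (Start, ?tp, 0) = (Seek P, tape_of (init_store w), -1)"
      unfolding tape_init[symmetric] by (simp add: numeral_2_eq_2 fun_upd_idem)
    then have "(astep P ^^ (t + 2)) (Start, ?tp, 0)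
      = (astep P ^^ t) (Seek P, tape_of (init_store w), -1)" by (simp only: funpow_add o_apply)
    moreover have "tm_init w = (num Start, ?tp, 0)" by (simp add: tm_init_def num)
    ultimately have "fst (tm_run M (t + 2) w) = num (if b then Acc else Rej)"
      unfolding tm_run_def using steps[OF mem(1) tp, of "t + 2" 0] t(2) by simp
    then show ?thesis using t(1) num by (intro exI[of _ "t + 2"]) auto
  qed
  then show ?thesis using valid by blast
qed

section \<open>Programs on tree codes\<close>

text \<open>The number of steps is chosen before the continuation \<open>k\<close>, so that in
  \<open>exec_append\<close> the first program can be run in front of the second one at the same
  cost.\<close>

definition exec :: "cmd list \<Rightarrow> store \<Rightarrow> nat \<Rightarrow> store \<Rightarrow> bool" where
  "exec P \<sigma> N \<sigma>' \<longleftrightarrow> (\<exists>n\<le>N. \<forall>k. (cstep ^^ n) (P @ k, \<sigma>) = (k, \<sigma>'))"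

lemma exec_mono: "exec P \<sigma> N \<sigma>' \<Longrightarrow> N \<le> N' \<Longrightarrow> exec P \<sigma> N' \<sigma>'"
  unfolding exec_def by (meson le_trans)

lemma exec_Nil: "exec [] \<sigma> N \<sigma>"
  unfolding exec_def by (intro exI[of _ 0]) simp

lemma exec_append:
  assumes "exec P \<sigma> N \<sigma>1" "exec Q \<sigma>1 M \<sigma>'"
  shows "exec (P @ Q) \<sigma> (N + M) \<sigma>'"
proof -
  obtain n m where n: "n \<le> N" "\<forall>k. (cstep ^^ n) (P @ k, \<sigma>) = (k, \<sigma>1)"
    and m: "m \<le> M" "\<forall>k. (cstep ^^ m) (Q @ k, \<sigma>1) = (k, \<sigma>')"
    using assms unfolding exec_def by blast
  have "(cstep ^^ (m + n)) ((P @ Q) @ k, \<sigma>) = (k, \<sigma>')" for k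
    using n(2)[rule_format, of "Q @ k"] m(2) by (simp add: funpow_add)
  then show ?thesis unfolding exec_def using n(1) m(1) by (intro exI[of _ "m + n"]) simp
qed

lemma exec_step:
  assumes "\<And>k. cstep (c # k, \<sigma>) = (x @ k, \<sigma>1)" "exec (x @ P) \<sigma>1 N \<sigma>'"
  shows "exec (c # P) \<sigma> (Suc N) \<sigma>'"
proof -
  obtain n where n: "n \<le> N" "\<forall>k. (cstep ^^ n) ((x @ P) @ k, \<sigma>1) = (k, \<sigma>')"
    using assms(2) unfolding exec_def by blast
  have "(cstep ^^ Suc n) ((c # P) @ k, \<sigma>) = (k, \<sigma>')" for k
    using n(2)[rule_format, of k] assms(1)[of "P @ k"]
    by (simp only: funpow_Suc_right o_apply append_Cons append_assoc)
  then show ?thesis unfolding exec_def using n(1) by (intro exI[of _ "Suc n"]) blast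
qed

lemma exec_Push: "exec P (\<sigma>(r := a # \<sigma> r)) N \<sigma>' \<Longrightarrow> exec (Push r a # P) \<sigma> (Suc N) \<sigma>'"
  by (rule exec_step[of _ _ "[]"]) simp_all

lemma exec_Pop: "exec P (\<sigma>(r := tl (\<sigma> r))) N \<sigma>' \<Longrightarrow> exec (Pop r # P) \<sigma> (Suc N) \<sigma>'"
  by (rule exec_step[of _ _ "[]"]) simp_all

lemma exec_Branch1:
  "peek (\<sigma> r) \<in> set A \<Longrightarrow> exec (x @ P) \<sigma> N \<sigma>' \<Longrightarrow> exec (Branch r A x y # P) \<sigma> (Suc N) \<sigma>'"
  by (rule exec_step[of _ _ x \<sigma>]) simp_all

lemma exec_Branch2:
  "peek (\<sigma> r) \<notin> set A \<Longrightarrow> exec (y @ P) \<sigma> N \<sigma>' \<Longrightarrow> exec (Branch r A x y # P) \<sigma> (Suc N) \<sigma>'"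
  by (rule exec_step[of _ _ y \<sigma>]) simp_all

lemma exec_Loop1:
  "peek (\<sigma> r) \<in> set A \<Longrightarrow> exec (x @ Loop r A x # P) \<sigma> N \<sigma>' \<Longrightarrow> exec (Loop r A x # P) \<sigma> (Suc N) \<sigma>'"
  by (rule exec_step[of _ _ "x @ [Loop r A x]" \<sigma>]) simp_all

lemma exec_Loop2:
  "peek (\<sigma> r) \<notin> set A \<Longrightarrow> exec P \<sigma> N \<sigma>' \<Longrightarrow> exec (Loop r A x # P) \<sigma> (Suc N) \<sigma>'"
  by (rule exec_step[of _ _ "[]" \<sigma>]) simp_all

lemma exec_eq: "exec P \<sigma> N \<sigma>1 \<Longrightarrow> \<sigma>1 = \<sigma>' \<Longrightarrow> exec P \<sigma> N \<sigma>'" by simp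

lemma exec_length:
  assumes "exec P \<sigma> N \<sigma>'" shows "length (\<sigma>' r) \<le> length (\<sigma> r) + N"
proof -
  obtain n where "n \<le> N" "(cstep ^^ n) (P @ [], \<sigma>) = ([], \<sigma>')"
    using assms unfolding exec_def by blast
  then show ?thesis using length_csteps[of n "P @ []" \<sigma> r] by simp
qed

definition transfer :: "nat \<Rightarrow> nat \<Rightarrow> cmd list" where
  "transfer r s = [Loop r [1, 2] [Branch r [1] [Pop r, Push s 1] [Pop r, Push s 2]]]"

lemma exec_transfer:
  assumes "r \<noteq> s" "set xs \<subseteq> {1, 2}" "\<sigma> r = xs @ ys" "peek ys \<notin> {1, 2}"
  shows "exec (transfer r s) \<sigma> (4 * length xs + 1) (\<sigma>(r := ys, s := rev xs @ \<sigma> s))"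
  using assms(2,3)
proof (induction xs arbitrary: \<sigma>)
  case Nil
  have "exec (transfer r s) \<sigma> (Suc 0) \<sigma>"
    unfolding transfer_def using Nil assms(4) by (intro exec_Loop2 exec_Nil) auto
  then have "exec (transfer r s) \<sigma> (Suc 0) (\<sigma>(r := ys, s := rev [] @ \<sigma> s))"
    by (rule exec_eq) (use Nil in auto)
  then show ?case by (rule exec_mono) simp
next
  case (Cons x xs)
  define \<sigma>1 where "\<sigma>1 = \<sigma>(r := xs @ ys, s := x # \<sigma> s)"
  have IH: "exec (transfer r s) \<sigma>1 (4 * length xs + 1) (\<sigma>1(r := ys, s := rev xs @ \<sigma>1 s))"
    using Cons assms(1) by (intro Cons.IH) (auto simp: \<sigma>1_def)
  have e: "\<sigma>1(r := ys, s := rev xs @ \<sigma>1 s) = \<sigma>(r := ys, s := rev (x # xs) @ \<sigma> s)"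
    using assms(1) by (auto simp: \<sigma>1_def)
  have x: "x = 1 \<or> x = 2" using Cons.prems(1) by auto
  have s1: "\<sigma>(r := tl (\<sigma> r), s := x # (\<sigma>(r := tl (\<sigma> r))) s) = \<sigma>1"
    using Cons.prems(2) assms(1) by (auto simp: \<sigma>1_def)
  have "exec (transfer r s) \<sigma> (Suc (Suc (Suc (Suc (4 * length xs + 1))))) (\<sigma>1(r := ys, s := rev xs @ \<sigma>1 s))"
  proof (cases "x = 1")
    case True
    show ?thesis using IH s1 Cons.prems(2) True unfolding transfer_def
      by (intro exec_Loop1) (auto intro!: exec_Branch1 exec_Pop exec_Push)
  next
    case False
    with x have "x = 2" by simp
    then show ?thesis using IH s1 Cons.prems(2) unfolding transfer_def
      by (intro exec_Loop1) (auto intro!: exec_Branch2 exec_Pop exec_Push)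
  qed
  then show ?case unfolding e by (rule exec_mono) simp
qed

lemma exec_pushes: "exec (map (Push r) xs) \<sigma> (length xs) (\<sigma>(r := rev xs @ \<sigma> r))"
proof (induction xs arbitrary: \<sigma>)
  case Nil
  then show ?case by (simp add: exec_Nil)
next
  case (Cons x xs)
  have "exec (map (Push r) xs) (\<sigma>(r := x # \<sigma> r)) (length xs) (\<sigma>(r := rev (x # xs) @ \<sigma> r))"
    using Cons[of "\<sigma>(r := x # \<sigma> r)"] by (rule exec_eq) auto
  from exec_Push[OF this] show ?case unfolding list.map by (rule exec_mono) simp
qed

section \<open>Prefix codes of binary trees and programs that move them between stacks\<close>

datatype tree = Leaf | Node tree tree

text \<open>The preorder traversal, a prefix-free code. A datum on top of stack 0 thus delimits
  itself, and a pair is coded by putting 2 before two adjacent codes.\<close>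

primrec tcode :: "tree \<Rightarrow> nat list" where
  "tcode Leaf = [1]"
| "tcode (Node a b) = 2 # tcode a @ tcode b"

lemma set_tcode: "set (tcode t) \<subseteq> {1, 2}"
  by (induction t) auto

lemma tcode_symb: "x \<in> set (tcode t) \<Longrightarrow> x = 1 \<or> x = 2"
  using set_tcode[of t] by auto

lemma tcode_nonempty [simp]: "tcode t \<noteq> []" "0 < length (tcode t)"
  by (cases t; simp)+

text \<open>Stack 2 counts, in unary, the subtrees still to be read. A prefix code is not
  self-delimiting when read backwards, so a mark 3 is put below the copy on stack 1.\<close>
definition take_tree :: "cmd list" where
  "take_tree = [Push 1 3, Push 2 3, Push 2 1,
     Loop 2 [1] [Branch 0 [1] [Pop 0, Push 1 1, Pop 2] [Pop 0, Push 1 2, Push 2 1]], Pop 2]"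

text \<open>Generalised from a tree to a forest, whose number of trees is the counter on stack 2:
  reading 2 replaces the first tree by its two subtrees, reading 1 removes a leaf, and each round
  consumes one symbol.\<close>

lemma exec_take_loop:
  assumes "\<sigma> 0 = concat (map tcode ts) @ rest" "\<sigma> 2 = replicate (length ts) 1 @ 3 # ys"
  shows "exec [Loop 2 [1] [Branch 0 [1] [Pop 0, Push 1 1, Pop 2] [Pop 0, Push 1 2, Push 2 1]]] \<sigma>
    (5 * length (concat (map tcode ts)) + 1)
    (\<sigma>(0 := rest, 1 := rev (concat (map tcode ts)) @ \<sigma> 1, 2 := 3 # ys))"
  using assms
proof (induction "length (concat (map tcode ts))" arbitrary: ts \<sigma> rule: less_induct)
  case less
  let ?B = "[Branch 0 [1] [Pop 0, Push 1 1, Pop 2] [Pop 0, Push 1 2, Push 2 1]]"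
  show ?case
  proof (cases ts)
    case Nil
    have "exec [Loop 2 [1] ?B] \<sigma> (Suc 0) \<sigma>"
      using less Nil by (intro exec_Loop2 exec_Nil) auto
    moreover have "\<sigma>(0 := rest, 1 := \<sigma> 1, 2 := 3 # ys) = \<sigma>"
      using less Nil by (auto simp: fun_eq_iff)
    ultimately show ?thesis using Nil by simp
  next
    case (Cons t ts')
    show ?thesis
    proof (cases t)
      case Leaf
      define \<sigma>1 where "\<sigma>1 = \<sigma>(0 := concat (map tcode ts') @ rest, 1 := 1 # \<sigma> 1,
        2 := replicate (length ts') 1 @ 3 # ys)"
      have IH: "exec [Loop 2 [1] ?B] \<sigma>1 (5 * length (concat (map tcode ts')) + 1)
        (\<sigma>1(0 := rest, 1 := rev (concat (map tcode ts')) @ \<sigma>1 1, 2 := 3 # ys))"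
        by (rule less.hyps) (simp_all add: Cons Leaf \<sigma>1_def)
      have e: "\<sigma>1(0 := rest, 1 := rev (concat (map tcode ts')) @ \<sigma>1 1, 2 := 3 # ys)
        = \<sigma>(0 := rest, 1 := rev (concat (map tcode ts)) @ \<sigma> 1, 2 := 3 # ys)"
        by (auto simp: \<sigma>1_def Cons Leaf fun_eq_iff)
      have s: "\<sigma>(0 := tl (\<sigma> 0), 1 := 1 # \<sigma> 1, 2 := tl (\<sigma> 2)) = \<sigma>1"
        using less.prems by (auto simp: \<sigma>1_def Cons Leaf fun_eq_iff)
      have "exec [Loop 2 [1] ?B] \<sigma> (Suc (Suc (Suc (Suc (Suc (5 * length (concat (map tcode ts')) + 1))))))
        (\<sigma>1(0 := rest, 1 := rev (concat (map tcode ts')) @ \<sigma>1 1, 2 := 3 # ys))"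
        using IH s less.prems Cons Leaf
        by (intro exec_Loop1) (auto intro!: exec_Branch1 exec_Pop exec_Push)
      then show ?thesis unfolding e by (rule exec_mono) (simp add: Cons Leaf)
    next
      case (Node a b)
      define \<sigma>1 where "\<sigma>1 = \<sigma>(0 := concat (map tcode (a # b # ts')) @ rest, 1 := 2 # \<sigma> 1,
        2 := replicate (length (a # b # ts')) 1 @ 3 # ys)"
      have IH: "exec [Loop 2 [1] ?B] \<sigma>1 (5 * length (concat (map tcode (a # b # ts'))) + 1)
        (\<sigma>1(0 := rest, 1 := rev (concat (map tcode (a # b # ts'))) @ \<sigma>1 1, 2 := 3 # ys))"
        by (rule less.hyps) (simp_all add: Cons Node \<sigma>1_def)
      have e: "\<sigma>1(0 := rest, 1 := rev (concat (map tcode (a # b # ts'))) @ \<sigma>1 1, 2 := 3 # ys)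
        = \<sigma>(0 := rest, 1 := rev (concat (map tcode ts)) @ \<sigma> 1, 2 := 3 # ys)"
        by (auto simp: \<sigma>1_def Cons Node fun_eq_iff)
      have s: "\<sigma>(0 := tl (\<sigma> 0), 1 := 2 # \<sigma> 1, 2 := 1 # \<sigma> 2) = \<sigma>1"
        using less.prems by (auto simp: \<sigma>1_def Cons Node fun_eq_iff)
      have "exec [Loop 2 [1] ?B] \<sigma> (Suc (Suc (Suc (Suc (Suc (5 * length (concat (map tcode (a # b # ts'))) + 1))))))
        (\<sigma>1(0 := rest, 1 := rev (concat (map tcode (a # b # ts'))) @ \<sigma>1 1, 2 := 3 # ys))"
        using IH s less.prems Cons Node
        by (intro exec_Loop1) (auto intro!: exec_Branch2 exec_Pop exec_Push)
      then show ?thesis unfolding e by (rule exec_mono) (simp add: Cons Node)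
    qed
  qed
qed

lemma exec_take_tree:
  assumes "\<sigma> 0 = tcode t @ rest"
  shows "exec take_tree \<sigma> (5 * length (tcode t) + 5) (\<sigma>(0 := rest, 1 := rev (tcode t) @ 3 # \<sigma> 1))"
proof -
  define \<sigma>1 where "\<sigma>1 = \<sigma>(1 := 3 # \<sigma> 1, 2 := 1 # 3 # \<sigma> 2)"
  let ?L = "[Loop 2 [1] [Branch 0 [1] [Pop 0, Push 1 1, Pop 2] [Pop 0, Push 1 2, Push 2 1]]]"
  have 1: "exec [Push 1 3, Push 2 3, Push 2 1] \<sigma> 3 \<sigma>1"
    by (rule exec_mono[of _ _ "Suc (Suc (Suc 0))"], intro exec_Push) (simp_all add: \<sigma>1_def exec_Nil)
  have 2: "exec ?L \<sigma>1 (5 * length (tcode t) + 1) (\<sigma>1(0 := rest, 1 := rev (tcode t) @ 3 # \<sigma> 1, 2 := 3 # \<sigma> 2))"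
    using exec_take_loop[of \<sigma>1 "[t]" rest "\<sigma> 2"] assms by (simp add: \<sigma>1_def)
  have 3: "exec [Pop 2] (\<sigma>1(0 := rest, 1 := rev (tcode t) @ 3 # \<sigma> 1, 2 := 3 # \<sigma> 2)) (Suc 0)
    (\<sigma>(0 := rest, 1 := rev (tcode t) @ 3 # \<sigma> 1))"
    by (rule exec_Pop, rule exec_eq, rule exec_Nil) (auto simp: \<sigma>1_def fun_eq_iff)
  have "exec ([Push 1 3, Push 2 3, Push 2 1] @ ?L @ [Pop 2]) \<sigma> (3 + ((5 * length (tcode t) + 1) + Suc 0))
    (\<sigma>(0 := rest, 1 := rev (tcode t) @ 3 # \<sigma> 1))"
    by (intro exec_append[OF 1] exec_append[OF 2] 3)
  then show ?thesis unfolding take_tree_def append_Cons append_Nil by (rule exec_mono) simp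
qed

definition give_tree :: "cmd list" where "give_tree = transfer 1 0 @ [Pop 1]"

lemma exec_give_tree:
  assumes "\<sigma> 1 = rev (tcode t) @ 3 # ys"
  shows "exec give_tree \<sigma> (4 * length (tcode t) + 2) (\<sigma>(0 := tcode t @ \<sigma> 0, 1 := ys))"
proof -
  have "exec (transfer 1 0) \<sigma> (4 * length (rev (tcode t)) + 1)
    (\<sigma>(1 := 3 # ys, 0 := rev (rev (tcode t)) @ \<sigma> 0))"
    by (rule exec_transfer) (use assms set_tcode in auto)
  moreover have "exec [Pop 1] (\<sigma>(1 := 3 # ys, 0 := rev (rev (tcode t)) @ \<sigma> 0)) (Suc 0)
    (\<sigma>(0 := tcode t @ \<sigma> 0, 1 := ys))"
    by (rule exec_Pop, rule exec_eq, rule exec_Nil) (auto simp: fun_eq_iff)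
  ultimately have "exec give_tree \<sigma> ((4 * length (rev (tcode t)) + 1) + Suc 0) (\<sigma>(0 := tcode t @ \<sigma> 0, 1 := ys))"
    unfolding give_tree_def by (rule exec_append)
  then show ?thesis by simp
qed

definition drop_tree :: "cmd list" where "drop_tree = take_tree @ [Loop 1 [1, 2] [Pop 1], Pop 1]"

lemma exec_clear:
  assumes "set xs \<subseteq> {1, 2}" "\<sigma> r = xs @ ys" "peek ys \<notin> {1, 2}"
  shows "exec [Loop r [1, 2] [Pop r]] \<sigma> (2 * length xs + 1) (\<sigma>(r := ys))"
  using assms(1,2)
proof (induction xs arbitrary: \<sigma>)
  case Nil
  have "exec [Loop r [1, 2] [Pop r]] \<sigma> (Suc 0) \<sigma>"
    using Nil assms(3) by (intro exec_Loop2 exec_Nil) auto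
  then have "exec [Loop r [1, 2] [Pop r]] \<sigma> (Suc 0) (\<sigma>(r := ys))"
    by (rule exec_eq) (use Nil in auto)
  then show ?case by (rule exec_mono) simp
next
  case (Cons x xs)
  have "exec [Loop r [1, 2] [Pop r]] (\<sigma>(r := xs @ ys)) (2 * length xs + 1) ((\<sigma>(r := xs @ ys))(r := ys))"
    using Cons by (intro Cons.IH) auto
  then have "exec [Loop r [1, 2] [Pop r]] \<sigma> (Suc (Suc (2 * length xs + 1))) (\<sigma>(r := ys))"
    using Cons.prems by (intro exec_Loop1) (auto intro!: exec_Pop)
  then show ?case by (rule exec_mono) simp
qed

lemma exec_drop_tree:
  assumes "\<sigma> 0 = tcode t @ rest"
  shows "exec drop_tree \<sigma> (7 * length (tcode t) + 7) (\<sigma>(0 := rest))"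
proof -
  let ?s = "\<sigma>(0 := rest, 1 := rev (tcode t) @ 3 # \<sigma> 1)"
  have "exec [Loop 1 [1, 2] [Pop 1]] ?s (2 * length (rev (tcode t)) + 1) (?s(1 := 3 # \<sigma> 1))"
    by (rule exec_clear) (use set_tcode in auto)
  moreover have "exec [Pop 1] (?s(1 := 3 # \<sigma> 1)) (Suc 0) (\<sigma>(0 := rest))"
    by (rule exec_Pop, rule exec_eq, rule exec_Nil) (auto simp: fun_eq_iff)
  ultimately have "exec ([Loop 1 [1, 2] [Pop 1]] @ [Pop 1]) ?s ((2 * length (rev (tcode t)) + 1) + Suc 0) (\<sigma>(0 := rest))"
    by (rule exec_append)
  from exec_append[OF exec_take_tree[of \<sigma>, OF assms] this] show ?thesis
    unfolding drop_tree_def append_Cons append_Nil by (rule exec_mono) simp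
qed

text \<open>Each move reverses a code. From its reversal on stack 1 the code is restored on stacks 0
  and 3 at once; the copy on stack 3 then passes through stack 1 to stack 0, being reversed
  twice.\<close>

definition dup_tree :: "cmd list" where
  "dup_tree = take_tree @ [Push 3 3, Loop 1 [1, 2] [Branch 1 [1] [Pop 1, Push 0 1, Push 3 1] [Pop 1, Push 0 2, Push 3 2]]]
     @ transfer 3 1 @ [Pop 3] @ give_tree"

lemma exec_dup_loop:
  assumes "set xs \<subseteq> {1, 2}" "\<sigma> 1 = xs @ 3 # ys"
  shows "exec [Loop 1 [1, 2] [Branch 1 [1] [Pop 1, Push 0 1, Push 3 1] [Pop 1, Push 0 2, Push 3 2]]] \<sigma>
    (5 * length xs + 1) (\<sigma>(0 := rev xs @ \<sigma> 0, 1 := 3 # ys, 3 := rev xs @ \<sigma> 3))"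
  using assms
proof (induction xs arbitrary: \<sigma>)
  let ?B = "[Branch 1 [1] [Pop 1, Push 0 1, Push 3 1] [Pop 1, Push 0 2, Push 3 2]]"
  case Nil
  have "exec [Loop 1 [1, 2] ?B] \<sigma> (Suc 0) \<sigma>"
    using Nil by (intro exec_Loop2 exec_Nil) auto
  then have "exec [Loop 1 [1, 2] ?B] \<sigma> (Suc 0) (\<sigma>(0 := rev [] @ \<sigma> 0, 1 := 3 # ys, 3 := rev [] @ \<sigma> 3))"
    by (rule exec_eq) (use Nil in \<open>auto simp: fun_eq_iff\<close>)
  then show ?case by (rule exec_mono) simp
next
  let ?B = "[Branch 1 [1] [Pop 1, Push 0 1, Push 3 1] [Pop 1, Push 0 2, Push 3 2]]"
  case (Cons x xs)
  define \<sigma>1 where "\<sigma>1 = \<sigma>(1 := xs @ 3 # ys, 0 := x # \<sigma> 0, 3 := x # \<sigma> 3)"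
  have IH: "exec [Loop 1 [1, 2] ?B] \<sigma>1 (5 * length xs + 1)
    (\<sigma>1(0 := rev xs @ \<sigma>1 0, 1 := 3 # ys, 3 := rev xs @ \<sigma>1 3))"
    using Cons by (intro Cons.IH) (auto simp: \<sigma>1_def)
  have e: "\<sigma>1(0 := rev xs @ \<sigma>1 0, 1 := 3 # ys, 3 := rev xs @ \<sigma>1 3)
    = \<sigma>(0 := rev (x # xs) @ \<sigma> 0, 1 := 3 # ys, 3 := rev (x # xs) @ \<sigma> 3)"
    by (auto simp: \<sigma>1_def fun_eq_iff)
  have s: "\<sigma>(1 := tl (\<sigma> 1), 0 := x # \<sigma> 0, 3 := x # \<sigma> 3) = \<sigma>1"
    using Cons.prems by (auto simp: \<sigma>1_def)
  have x: "x = 1 \<or> x = 2" using Cons.prems(1) by auto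
  have "exec [Loop 1 [1, 2] ?B] \<sigma> (Suc (Suc (Suc (Suc (Suc (5 * length xs + 1))))))
    (\<sigma>1(0 := rev xs @ \<sigma>1 0, 1 := 3 # ys, 3 := rev xs @ \<sigma>1 3))"
  proof (cases "x = 1")
    case True
    then show ?thesis using IH s Cons.prems(2)
      by (intro exec_Loop1) (auto intro!: exec_Branch1 exec_Pop exec_Push)
  next
    case False
    with x have "x = 2" by simp
    then show ?thesis using IH s Cons.prems(2)
      by (intro exec_Loop1) (auto intro!: exec_Branch2 exec_Pop exec_Push)
  qed
  then show ?case unfolding e by (rule exec_mono) simp
qed

lemma exec_dup_tree:
  assumes "\<sigma> 0 = tcode t @ rest"
  shows "exec dup_tree \<sigma> (18 * length (tcode t) + 11) (\<sigma>(0 := tcode t @ \<sigma> 0))"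
proof -
  let ?n = "length (tcode t)"
  let ?L = "[Loop 1 [1, 2] [Branch 1 [1] [Pop 1, Push 0 1, Push 3 1] [Pop 1, Push 0 2, Push 3 2]]]"
  define s1 where "s1 = \<sigma>(0 := rest, 1 := rev (tcode t) @ 3 # \<sigma> 1)"
  define s2 where "s2 = s1(3 := 3 # \<sigma> 3)"
  define s3 where "s3 = \<sigma>(0 := tcode t @ rest, 1 := 3 # \<sigma> 1, 3 := tcode t @ 3 # \<sigma> 3)"
  define s4 where "s4 = \<sigma>(0 := tcode t @ rest, 1 := rev (tcode t) @ 3 # \<sigma> 1, 3 := 3 # \<sigma> 3)"
  define s5 where "s5 = \<sigma>(0 := tcode t @ rest, 1 := rev (tcode t) @ 3 # \<sigma> 1)"
  have 1: "exec take_tree \<sigma> (5 * ?n + 5) s1" unfolding s1_def by (rule exec_take_tree[of \<sigma>, OF assms])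
  have "exec ?L s2 (5 * length (rev (tcode t)) + 1)
    (s2(0 := rev (rev (tcode t)) @ s2 0, 1 := 3 # \<sigma> 1, 3 := rev (rev (tcode t)) @ s2 3))"
    by (rule exec_dup_loop) (use set_tcode in \<open>auto simp: s2_def s1_def\<close>)
  then have "exec ?L s2 (5 * ?n + 1) s3"
    unfolding length_rev by (rule exec_eq) (auto simp: s2_def s1_def s3_def fun_eq_iff)
  then have 2: "exec (Push 3 3 # ?L) s1 (Suc (5 * ?n + 1)) s3"
    by (intro exec_Push) (simp add: s2_def s1_def)
  have "exec (transfer 3 1) s3 (4 * ?n + 1) (s3(3 := 3 # \<sigma> 3, 1 := rev (tcode t) @ s3 1))"
    by (rule exec_transfer) (use set_tcode in \<open>auto simp: s3_def\<close>)
  then have 3: "exec (transfer 3 1) s3 (4 * ?n + 1) s4"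
    by (rule exec_eq) (auto simp: s3_def s4_def fun_eq_iff)
  have 4: "exec [Pop 3] s4 (Suc 0) s5"
    by (rule exec_Pop, rule exec_eq, rule exec_Nil) (auto simp: s4_def s5_def fun_eq_iff)
  have "exec give_tree s5 (4 * ?n + 2) (s5(0 := tcode t @ s5 0, 1 := \<sigma> 1))"
    by (rule exec_give_tree) (simp add: s5_def)
  then have 5: "exec give_tree s5 (4 * ?n + 2) (\<sigma>(0 := tcode t @ \<sigma> 0))"
    by (rule exec_eq) (auto simp: s5_def assms fun_eq_iff)
  have "exec (take_tree @ (Push 3 3 # ?L) @ transfer 3 1 @ [Pop 3] @ give_tree) \<sigma>
    ((5 * ?n + 5) + (Suc (5 * ?n + 1) + ((4 * ?n + 1) + (Suc 0 + (4 * ?n + 2))))) (\<sigma>(0 := tcode t @ \<sigma> 0))"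
    by (intro exec_append[OF 1] exec_append[OF 2] exec_append[OF 3] exec_append[OF 4] 5)
  then show ?thesis unfolding dup_tree_def append_Cons append_Nil
    by (rule exec_mono) simp
qed

lemma wf_tree_programs:
  "list_all wfc take_tree" "list_all wfc give_tree" "list_all wfc drop_tree" "list_all wfc dup_tree"
  "r < 4 \<Longrightarrow> s < 4 \<Longrightarrow> list_all wfc (transfer r s)"
  by (simp_all add: take_tree_def give_tree_def drop_tree_def dup_tree_def transfer_def)

section \<open>Polynomial-time functions\<close>

text \<open>The base \<open>s + 2\<close> lets a single exponent describe the bound: it is at least
  2, so raising the exponent absorbs constants and the factor 2 arising from sums.\<close>

definition poly_bdd :: "(nat \<Rightarrow> nat) \<Rightarrow> bool" where
  "poly_bdd g \<longleftrightarrow> (\<exists>d. \<forall>s. g s \<le> (s + 2) ^ d)"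

named_theorems poly_intros

lemma poly_bdd_const [poly_intros]: "poly_bdd (\<lambda>_. c)"
  unfolding poly_bdd_def
proof (intro exI allI)
  fix s :: nat
  have "c \<le> 2 ^ c" by (rule less_imp_le[OF less_exp])
  also have "\<dots> \<le> (s + 2) ^ c" by (rule power_mono) simp_all
  finally show "c \<le> (s + 2) ^ c" .
qed

lemma poly_bdd_id [poly_intros]: "poly_bdd (\<lambda>s. s)"
  unfolding poly_bdd_def by (intro exI[of _ 1]) simp

lemma poly_bdd_mult [poly_intros]:
  assumes "poly_bdd g" "poly_bdd h" shows "poly_bdd (\<lambda>s. g s * h s)"
proof -
  obtain d e where "\<And>s. g s \<le> (s + 2) ^ d" "\<And>s. h s \<le> (s + 2) ^ e"
    using assms unfolding poly_bdd_def by blast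
  then have "g s * h s \<le> (s + 2) ^ (d + e)" for s
    unfolding power_add by (intro mult_le_mono)
  then show ?thesis unfolding poly_bdd_def by blast
qed

lemma poly_bdd_add [poly_intros]:
  assumes "poly_bdd g" "poly_bdd h" shows "poly_bdd (\<lambda>s. g s + h s)"
proof -
  obtain d e where de: "\<And>s. g s \<le> (s + 2) ^ d" "\<And>s. h s \<le> (s + 2) ^ e"
    using assms unfolding poly_bdd_def by blast
  have "g s + h s \<le> (s + 2) ^ (d + e + 1)" for s
  proof -
    have "(s + 2) ^ d \<le> (s + 2) ^ (d + e)" "(s + 2) ^ e \<le> (s + 2) ^ (d + e)"
      by (auto intro!: power_increasing)
    then have "g s + h s \<le> 2 * (s + 2) ^ (d + e)" using de[of s] by linarith
    also have "\<dots> \<le> (s + 2) * (s + 2) ^ (d + e)" by (intro mult_le_mono1) simp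
    finally show ?thesis by simp
  qed
  then show ?thesis unfolding poly_bdd_def by blast
qed

lemma poly_bdd_Suc [poly_intros]: "poly_bdd g \<Longrightarrow> poly_bdd (\<lambda>s. Suc (g s))"
  using poly_bdd_add[OF _ poly_bdd_const[of 1], of g] by simp

lemma poly_bdd_power [poly_intros]: "poly_bdd g \<Longrightarrow> poly_bdd (\<lambda>s. g s ^ d)"
  by (induction d) (simp_all add: poly_bdd_const poly_bdd_mult)

lemma poly_bddE:
  assumes "poly_bdd g" obtains d where "\<And>s. g s \<le> (s + 2) ^ d"
  using assms unfolding poly_bdd_def by blast

class tree_code =
  fixes enc :: "'a \<Rightarrow> tree"

definition ecode :: "'a::tree_code \<Rightarrow> nat list" where "ecode x = tcode (enc x)"

definition esize :: "'a::tree_code \<Rightarrow> nat" where "esize x = length (ecode x)"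

lemma esize_pos [simp]: "0 < esize x" by (simp add: esize_def ecode_def)

text \<open>The program works on top of stack 0 and leaves everything below and the other stacks
  unchanged, so programs can be composed without renaming of stacks.\<close>
definition polytime :: "('a::tree_code \<Rightarrow> 'b::tree_code) \<Rightarrow> bool" where
  "polytime f \<longleftrightarrow> (\<exists>P d. list_all wfc P \<and> (\<forall>x \<sigma> rest. \<sigma> 0 = ecode x @ rest \<longrightarrow>
     exec P \<sigma> ((esize x + 2) ^ d) (\<sigma>(0 := ecode (f x) @ rest))))"

named_theorems polytime_intros

lemma polytimeI:
  assumes "list_all wfc P" "poly_bdd g"
    "\<And>x \<sigma> rest. \<sigma> 0 = ecode x @ rest \<Longrightarrow> exec P \<sigma> (g (esize x)) (\<sigma>(0 := ecode (f x) @ rest))"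
  shows "polytime f"
proof -
  obtain d where "\<And>s. g s \<le> (s + 2) ^ d" using assms(2) by (rule poly_bddE) blast
  then show ?thesis unfolding polytime_def using assms(1,3) exec_mono by blast
qed

lemma polytimeE:
  assumes "polytime f"
  obtains P d where "list_all wfc P"
    "\<And>x \<sigma> rest. \<sigma> 0 = ecode x @ rest \<Longrightarrow> exec P \<sigma> ((esize x + 2) ^ d) (\<sigma>(0 := ecode (f x) @ rest))"
  using assms unfolding polytime_def by blast

text \<open>A run of T steps adds at most T symbols to a stack, so the time bound is also a bound on
  the size of the result.\<close>

lemma polytime_size:
  assumes "polytime f"
  obtains d where "\<And>x. esize (f x) \<le> (esize x + 2) ^ d"
proof -
  obtain P d where "\<And>x \<sigma> rest. \<sigma> 0 = ecode x @ rest \<Longrightarrow>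
    exec P \<sigma> ((esize x + 2) ^ d) (\<sigma>(0 := ecode (f x) @ rest))"
    using assms by (rule polytimeE) blast
  then have "exec P ((\<lambda>_. [])(0 := ecode x)) ((esize x + 2) ^ d) ((\<lambda>_. [])(0 := ecode x, 0 := ecode (f x)))" for x
    by (metis (no_types) append_Nil2 fun_upd_same)
  from exec_length[OF this, of _ 0] have "esize (f x) \<le> esize x + (esize x + 2) ^ d" for x
    by (simp add: esize_def)
  moreover obtain e where "\<And>s::nat. s + (s + 2) ^ d \<le> (s + 2) ^ e"
    by (rule poly_bddE[of "\<lambda>s. s + (s + 2) ^ d"]) (intro poly_intros, blast)
  ultimately have "\<And>x. esize (f x) \<le> (esize x + 2) ^ e" by (meson le_trans)
  then show thesis by (rule that)
qed

lemma polytime_code_eq: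
  assumes "polytime g" "\<And>x. enc (f x) = enc (g x)" shows "polytime f"
  using assms unfolding polytime_def ecode_def by simp

lemma polytime_same_code: "(\<And>x. enc (f x) = enc x) \<Longrightarrow> polytime f"
  by (rule polytimeI[of "[]" "\<lambda>_. 0"])
     (auto simp: ecode_def poly_bdd_const intro!: exec_eq[OF exec_Nil])

lemma polytime_id [polytime_intros]: "polytime (\<lambda>x. x)"
  by (rule polytime_same_code) simp

lemma power_mono_le: "s \<le> t \<Longrightarrow> (s + 2) ^ d \<le> (t + 2) ^ (d::nat)" for s t :: nat
  by (rule power_mono) auto

lemma polytime_comp:
  fixes f :: "'a::tree_code \<Rightarrow> 'b::tree_code" and g :: "'b \<Rightarrow> 'c::tree_code"
  assumes "polytime f" "polytime g" shows "polytime (\<lambda>x. g (f x))"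
proof -
  obtain P d where P: "list_all wfc P" "\<And>x \<sigma> rest. \<sigma> 0 = ecode x @ rest \<Longrightarrow>
    exec P \<sigma> ((esize x + 2) ^ d) (\<sigma>(0 := ecode (f x) @ rest))" using assms(1) by (rule polytimeE) blast
  obtain Q e where Q: "list_all wfc Q" "\<And>x \<sigma> rest. \<sigma> 0 = ecode x @ rest \<Longrightarrow>
    exec Q \<sigma> ((esize x + 2) ^ e) (\<sigma>(0 := ecode (g x) @ rest))" using assms(2) by (rule polytimeE) blast
  obtain k where k: "\<And>x. esize (f x) \<le> (esize x + 2) ^ k" by (rule polytime_size[OF assms(1)]) blast
  show ?thesis
  proof (rule polytimeI[of "P @ Q" "\<lambda>s. (s + 2) ^ d + ((s + 2) ^ k + 2) ^ e"])
    fix x :: 'a and \<sigma> :: store and rest assume x: "\<sigma> 0 = ecode x @ rest"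
    have "exec Q (\<sigma>(0 := ecode (f x) @ rest)) ((esize (f x) + 2) ^ e)
      ((\<sigma>(0 := ecode (f x) @ rest))(0 := ecode (g (f x)) @ rest))" by (rule Q(2)) simp
    from exec_append[OF P(2)[of \<sigma>, OF x] exec_mono[OF this power_mono_le[OF k]]]
    show "exec (P @ Q) \<sigma> ((esize x + 2) ^ d + ((esize x + 2) ^ k + 2) ^ e) (\<sigma>(0 := ecode (g (f x)) @ rest))"
      by simp
  qed (use P Q in \<open>auto intro!: poly_intros\<close>)
qed

lemma polytime_const [polytime_intros]: "polytime (\<lambda>_. c)"
proof (rule polytimeI[of "drop_tree @ map (Push 0) (rev (ecode c))" "\<lambda>s. (7 * s + 7) + esize c"])
  fix x :: 'a and \<sigma> :: store and rest assume "\<sigma> 0 = ecode x @ rest"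
  then have "exec drop_tree \<sigma> (7 * esize x + 7) (\<sigma>(0 := rest))"
    unfolding esize_def ecode_def by (rule exec_drop_tree)
  moreover have "exec (map (Push 0) (rev (ecode c))) (\<sigma>(0 := rest)) (length (rev (ecode c)))
    ((\<sigma>(0 := rest))(0 := rev (rev (ecode c)) @ (\<sigma>(0 := rest)) 0))" by (rule exec_pushes)
  ultimately show "exec (drop_tree @ map (Push 0) (rev (ecode c))) \<sigma> ((7 * esize x + 7) + esize c)
    (\<sigma>(0 := ecode c @ rest))"
    using exec_append[of drop_tree \<sigma> "7 * esize x + 7" "\<sigma>(0 := rest)" "map (Push 0) (rev (ecode c))" "esize c"]
    by (simp add: esize_def)
next
  show "list_all wfc (drop_tree @ map (Push 0) (rev (ecode c)))"
    using wf_tree_programs(3) by (auto simp: list_all_iff ecode_def dest!: tcode_symb)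
qed (intro poly_intros)

section \<open>Pairs, truth values and case distinctions\<close>

instantiation prod :: (tree_code, tree_code) tree_code
begin
definition "enc p = Node (enc (fst p)) (enc (snd p))"
instance ..
end

lemma ecode_pair [simp]: "ecode (x, y) = 2 # ecode x @ ecode y"
  by (simp add: ecode_def enc_prod_def)

lemma esize_pair [simp]: "esize (x, y) = Suc (esize x + esize y)"
  by (simp add: esize_def)

text \<open>The argument is duplicated, and the first result is parked on stack 1 while the second
  program runs. This is safe because \<open>polytime\<close> requires all other contents of the
  store to be restored.\<close>

lemma polytime_pair [polytime_intros]:
  fixes f :: "'a::tree_code \<Rightarrow> 'b::tree_code" and g :: "'a \<Rightarrow> 'c::tree_code"
  assumes "polytime f" "polytime g" shows "polytime (\<lambda>x. (f x, g x))"
proof -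
  obtain P d where P: "list_all wfc P" "\<And>x \<sigma> rest. \<sigma> 0 = ecode x @ rest \<Longrightarrow>
    exec P \<sigma> ((esize x + 2) ^ d) (\<sigma>(0 := ecode (f x) @ rest))" using assms(1) by (rule polytimeE) blast
  obtain Q e where Q: "list_all wfc Q" "\<And>x \<sigma> rest. \<sigma> 0 = ecode x @ rest \<Longrightarrow>
    exec Q \<sigma> ((esize x + 2) ^ e) (\<sigma>(0 := ecode (g x) @ rest))" using assms(2) by (rule polytimeE) blast
  obtain k where k: "\<And>x. esize (f x) \<le> (esize x + 2) ^ k" by (rule polytime_size[OF assms(1)]) blast
  show ?thesis
  proof (rule polytimeI[of "dup_tree @ P @ take_tree @ Q @ give_tree @ [Push 0 2]"
      "\<lambda>s. (18 * s + 11) + ((s + 2) ^ d + ((5 * (s + 2) ^ k + 5) + ((s + 2) ^ e + ((4 * (s + 2) ^ k + 2) + Suc 0))))"])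
    fix x :: 'a and \<sigma> :: store and rest assume x: "\<sigma> 0 = ecode x @ rest"
    define s1 where "s1 = \<sigma>(0 := ecode x @ \<sigma> 0)"
    define s2 where "s2 = \<sigma>(0 := ecode (f x) @ \<sigma> 0)"
    define s3 where "s3 = \<sigma>(1 := rev (ecode (f x)) @ 3 # \<sigma> 1)"
    define s4 where "s4 = \<sigma>(0 := ecode (g x) @ rest, 1 := rev (ecode (f x)) @ 3 # \<sigma> 1)"
    define s5 where "s5 = \<sigma>(0 := ecode (f x) @ ecode (g x) @ rest)"
    have 1: "exec dup_tree \<sigma> (18 * esize x + 11) s1"
      using exec_dup_tree x unfolding s1_def ecode_def esize_def by blast
    have "exec P s1 ((esize x + 2) ^ d) (s1(0 := ecode (f x) @ \<sigma> 0))"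
      by (rule P(2)) (simp add: s1_def)
    then have 2: "exec P s1 ((esize x + 2) ^ d) s2" by (simp add: s1_def s2_def)
    have "exec take_tree s2 (5 * esize (f x) + 5) (s2(0 := \<sigma> 0, 1 := rev (ecode (f x)) @ 3 # s2 1))"
      unfolding ecode_def esize_def by (rule exec_take_tree) (simp add: s2_def ecode_def)
    then have "exec take_tree s2 (5 * esize (f x) + 5) s3"
      by (rule exec_eq) (auto simp: s2_def s3_def fun_eq_iff)
    then have 3: "exec take_tree s2 (5 * (esize x + 2) ^ k + 5) s3"
      by (rule exec_mono) (use k[of x] in simp)
    have "exec Q s3 ((esize x + 2) ^ e) (s3(0 := ecode (g x) @ rest))"
      by (rule Q(2)) (simp add: s3_def x)
    then have 4: "exec Q s3 ((esize x + 2) ^ e) s4"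
      by (rule exec_eq) (auto simp: s3_def s4_def fun_eq_iff)
    have "exec give_tree s4 (4 * esize (f x) + 2) (s4(0 := ecode (f x) @ s4 0, 1 := \<sigma> 1))"
      unfolding ecode_def esize_def by (rule exec_give_tree) (simp add: s4_def ecode_def)
    then have "exec give_tree s4 (4 * esize (f x) + 2) s5"
      by (rule exec_eq) (auto simp: s4_def s5_def fun_eq_iff)
    then have 5: "exec give_tree s4 (4 * (esize x + 2) ^ k + 2) s5"
      by (rule exec_mono) (use k[of x] in simp)
    have 6: "exec [Push 0 2] s5 (Suc 0) (\<sigma>(0 := ecode (f x, g x) @ rest))"
      by (rule exec_Push, rule exec_eq, rule exec_Nil) (simp add: s5_def)
    show "exec (dup_tree @ P @ take_tree @ Q @ give_tree @ [Push 0 2]) \<sigma>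
      ((18 * esize x + 11) + ((esize x + 2) ^ d + ((5 * (esize x + 2) ^ k + 5) +
        ((esize x + 2) ^ e + ((4 * (esize x + 2) ^ k + 2) + Suc 0)))))
      (\<sigma>(0 := ecode (f x, g x) @ rest))"
      by (intro exec_append[OF 1] exec_append[OF 2] exec_append[OF 3] exec_append[OF 4] exec_append[OF 5] 6)
  qed (use P Q in \<open>auto intro!: poly_intros simp: wf_tree_programs\<close>)
qed

definition fst_prog :: "cmd list" where "fst_prog = [Pop 0] @ take_tree @ drop_tree @ give_tree"
definition snd_prog :: "cmd list" where "snd_prog = [Pop 0] @ drop_tree"

lemma exec_fst_prog:
  assumes "\<sigma> 0 = tcode (Node a b) @ rest"
  shows "exec fst_prog \<sigma> (16 * length (tcode (Node a b)) + 15) (\<sigma>(0 := tcode a @ rest))"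
proof -
  define s1 where "s1 = \<sigma>(0 := tcode a @ tcode b @ rest)"
  define s2 where "s2 = \<sigma>(0 := tcode b @ rest, 1 := rev (tcode a) @ 3 # \<sigma> 1)"
  define s3 where "s3 = \<sigma>(0 := rest, 1 := rev (tcode a) @ 3 # \<sigma> 1)"
  have 1: "exec [Pop 0] \<sigma> (Suc 0) s1"
    by (rule exec_Pop, rule exec_eq, rule exec_Nil) (simp add: s1_def assms)
  have "exec take_tree s1 (5 * length (tcode a) + 5) (s1(0 := tcode b @ rest, 1 := rev (tcode a) @ 3 # s1 1))"
    by (rule exec_take_tree) (simp add: s1_def)
  then have 2: "exec take_tree s1 (5 * length (tcode a) + 5) s2"
    by (rule exec_eq) (auto simp: s1_def s2_def fun_eq_iff)
  have "exec drop_tree s2 (7 * length (tcode b) + 7) (s2(0 := rest))"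
    by (rule exec_drop_tree) (simp add: s2_def)
  then have 3: "exec drop_tree s2 (7 * length (tcode b) + 7) s3"
    by (rule exec_eq) (auto simp: s3_def s2_def fun_eq_iff)
  have "exec give_tree s3 (4 * length (tcode a) + 2) (s3(0 := tcode a @ s3 0, 1 := \<sigma> 1))"
    by (rule exec_give_tree) (simp add: s3_def)
  then have 4: "exec give_tree s3 (4 * length (tcode a) + 2) (\<sigma>(0 := tcode a @ rest))"
    by (rule exec_eq) (auto simp: s3_def fun_eq_iff)
  have "exec fst_prog \<sigma> (Suc 0 + ((5 * length (tcode a) + 5) + ((7 * length (tcode b) + 7) + (4 * length (tcode a) + 2))))
    (\<sigma>(0 := tcode a @ rest))"
    unfolding fst_prog_def by (intro exec_append[OF 1] exec_append[OF 2] exec_append[OF 3] 4)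
  then show ?thesis by (rule exec_mono) simp
qed

lemma exec_snd_prog:
  assumes "\<sigma> 0 = tcode (Node a b) @ rest"
  shows "exec snd_prog \<sigma> (16 * length (tcode (Node a b)) + 15) (\<sigma>(0 := tcode b @ rest))"
proof -
  define s1 where "s1 = \<sigma>(0 := tcode a @ tcode b @ rest)"
  have 1: "exec [Pop 0] \<sigma> (Suc 0) s1"
    by (rule exec_Pop, rule exec_eq, rule exec_Nil) (simp add: s1_def assms)
  have "exec drop_tree s1 (7 * length (tcode a) + 7) (s1(0 := tcode b @ rest))"
    by (rule exec_drop_tree) (simp add: s1_def)
  then have 2: "exec drop_tree s1 (7 * length (tcode a) + 7) (\<sigma>(0 := tcode b @ rest))"
    by (rule exec_eq) (auto simp: s1_def fun_eq_iff)
  show ?thesis unfolding snd_prog_def by (rule exec_mono[OF exec_append[OF 1 2]]) simp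
qed

lemma wf_fst_snd: "list_all wfc fst_prog" "list_all wfc snd_prog"
  by (simp_all add: fst_prog_def snd_prog_def wf_tree_programs)

lemma polytime_fst1: "polytime fst"
proof (rule polytimeI[of fst_prog "\<lambda>s. 16 * s + 15"])
  fix x :: "'a \<times> 'b" and \<sigma> :: store and rest assume "\<sigma> 0 = ecode x @ rest"
  then show "exec fst_prog \<sigma> (16 * esize x + 15) (\<sigma>(0 := ecode (fst x) @ rest))"
    unfolding ecode_def esize_def enc_prod_def by (rule exec_fst_prog)
qed (intro wf_fst_snd poly_intros)+

lemma polytime_snd1: "polytime snd"
proof (rule polytimeI[of snd_prog "\<lambda>s. 16 * s + 15"])
  fix x :: "'a \<times> 'b" and \<sigma> :: store and rest assume "\<sigma> 0 = ecode x @ rest"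
  then show "exec snd_prog \<sigma> (16 * esize x + 15) (\<sigma>(0 := ecode (snd x) @ rest))"
    unfolding ecode_def esize_def enc_prod_def by (rule exec_snd_prog)
qed (intro wf_fst_snd poly_intros)+

lemmas polytime_fst [polytime_intros] = polytime_comp[OF _ polytime_fst1]
  and polytime_snd [polytime_intros] = polytime_comp[OF _ polytime_snd1]

text \<open>Both truth values have codes of the same length, so that the size of a bit string
  depends on its length only.\<close>
instantiation bool :: tree_code
begin
definition "enc b = (if b then Node Leaf (Node Leaf Leaf) else Node (Node Leaf Leaf) Leaf)"
instance ..
end

lemma ecode_bool: "ecode True = [2, 1, 2, 1, 1]" "ecode False = [2, 2, 1, 1, 1]"
  by (simp_all add: ecode_def enc_bool_def)

lemma esize_bool [simp]: "esize (b::bool) = 5"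
  by (cases b) (simp_all add: esize_def ecode_bool)

lemma polytime_if [polytime_intros]:
  fixes f :: "'a::tree_code \<Rightarrow> 'b::tree_code"
  assumes "polytime b" "polytime f" "polytime g"
  shows "polytime (\<lambda>x. if b x then f x else g x)"
proof -
  obtain P d where P: "list_all wfc P" "\<And>x \<sigma> rest. \<sigma> 0 = ecode x @ rest \<Longrightarrow>
    exec P \<sigma> ((esize x + 2) ^ d) (\<sigma>(0 := ecode (f x) @ rest))" using assms(2) by (rule polytimeE) blast
  obtain Q e where Q: "list_all wfc Q" "\<And>x \<sigma> rest. \<sigma> 0 = ecode x @ rest \<Longrightarrow>
    exec Q \<sigma> ((esize x + 2) ^ e) (\<sigma>(0 := ecode (g x) @ rest))" using assms(3) by (rule polytimeE) blast
  \<comment> \<open>The two pops before the branch remove the 2 of the pair and the first of the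
    five symbols of the truth value. The codes of the truth values differ in their second symbol; it
    and the three symbols after it remain to be removed.\<close>
  let ?P5 = "[Pop 0, Pop 0, Pop 0, Pop 0]"
  have "polytime (\<lambda>p. if fst p then f (snd p) else g (snd p))"
  proof (rule polytimeI[of "[Pop 0, Pop 0, Branch 0 [1] (?P5 @ P) (?P5 @ Q)]"
      "\<lambda>s. Suc (Suc (Suc (Suc (Suc (Suc (Suc ((s + 2) ^ d + (s + 2) ^ e)))))))"])
    fix p :: "bool \<times> 'a" and \<sigma> :: store and rest assume p: "\<sigma> 0 = ecode p @ rest"
    obtain c x where [simp]: "p = (c, x)" by (cases p)
    have m: "(esize x + 2) ^ k \<le> (esize p + 2) ^ k" for k by (rule power_mono_le) simp
    have m': "(esize x + 2) ^ d \<le> (esize p + 2) ^ d + (esize p + 2) ^ e"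
      "(esize x + 2) ^ e \<le> (esize p + 2) ^ d + (esize p + 2) ^ e"
      using m[of d] m[of e] by linarith+
    have "exec P (\<sigma>(0 := ecode x @ rest)) ((esize p + 2) ^ d + (esize p + 2) ^ e)
       ((\<sigma>(0 := ecode x @ rest))(0 := ecode (f x) @ rest))"
      by (rule exec_mono[OF P(2) m'(1)]) simp
    moreover have "exec Q (\<sigma>(0 := ecode x @ rest)) ((esize p + 2) ^ d + (esize p + 2) ^ e)
       ((\<sigma>(0 := ecode x @ rest))(0 := ecode (g x) @ rest))"
      by (rule exec_mono[OF Q(2) m'(2)]) simp
    ultimately show "exec [Pop 0, Pop 0, Branch 0 [1] (?P5 @ P) (?P5 @ Q)] \<sigma>
      (Suc (Suc (Suc (Suc (Suc (Suc (Suc ((esize p + 2) ^ d + (esize p + 2) ^ e))))))))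
      (\<sigma>(0 := ecode (if fst p then f (snd p) else g (snd p)) @ rest))"
    proof (cases c)
      case True
      with \<open>exec P _ _ _\<close> show ?thesis using p unfolding append_Cons append_Nil
        by (intro exec_Pop exec_Branch1) (auto simp: ecode_bool intro!: exec_Pop)
    next
      case False
      with \<open>exec Q _ _ _\<close> show ?thesis using p unfolding append_Cons append_Nil
        by (intro exec_Pop exec_Branch2) (auto simp: ecode_bool intro!: exec_Pop)
    qed
  qed (use P Q in \<open>auto intro!: poly_intros\<close>)
  from polytime_comp[OF polytime_pair[OF assms(1) polytime_id] this] show ?thesis
    unfolding fst_conv snd_conv .
qed

lemma polytime_not [polytime_intros]: "polytime b \<Longrightarrow> polytime (\<lambda>x. \<not> b x)"
  by (rule polytime_code_eq[OF polytime_if[OF _ polytime_const[of False] polytime_const[of True], of b]]) auto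

lemma polytime_conj [polytime_intros]: "polytime b \<Longrightarrow> polytime c \<Longrightarrow> polytime (\<lambda>x. b x \<and> c x)"
  by (rule polytime_code_eq[OF polytime_if[OF _ _ polytime_const[of False], of b c]]) auto

lemma polytime_disj [polytime_intros]: "polytime b \<Longrightarrow> polytime c \<Longrightarrow> polytime (\<lambda>x. b x \<or> c x)"
  by (rule polytime_code_eq[OF polytime_if[OF _ polytime_const[of True], of b c]]) auto

section \<open>Lists and folds with polynomially bounded states\<close>

instantiation list :: (tree_code) tree_code
begin
primrec enc_list where
  "enc_list [] = Leaf"
| "enc_list (x # xs) = Node (enc x) (enc_list xs)"
instance ..
end

lemma ecode_list [simp]: "ecode ([]::'a::tree_code list) = [1]" "ecode (x # xs) = 2 # ecode x @ ecode xs"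
  by (simp_all add: ecode_def)

lemma esize_list [simp]: "esize ([]::'a::tree_code list) = 1" "esize (x # xs) = Suc (esize x + esize xs)"
  by (simp_all add: esize_def)

lemma length_le_esize: "length xs < esize xs"
  by (induction xs) auto

lemma esize_append: "Suc (esize (xs @ ys)) = esize xs + esize ys"
  by (induction xs) auto

lemma esize_rev [simp]: "esize (rev xs) = esize xs"
proof (induction xs)
  case (Cons a xs)
  then show ?case using esize_append[of "rev xs" "[a]"] by simp
qed simp

lemma esize_member: "x \<in> set xs \<Longrightarrow> esize x < esize xs"
  by (induction xs) auto

lemma esize_drop: "esize (drop i xs) \<le> esize xs"
proof (induction xs arbitrary: i)
  case (Cons x xs)
  show ?case
  proof (cases i)
    case (Suc n)
    then show ?thesis using Cons[of n] by simp
  qed simp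
qed simp

lemma polytime_Cons [polytime_intros]:
  assumes "polytime f" "polytime g" shows "polytime (\<lambda>x. f x # g x)"
  by (rule polytime_code_eq[OF polytime_pair[OF assms]]) (simp add: enc_prod_def)

text \<open>A nonempty list has the same code as the pair of its head and tail, so the programs for
  pairs apply. The value at \<open>[]\<close>, even an unspecified one such as \<open>hd []\<close>,
  is a constant that can be written out.\<close>

lemma polytime_list_case:
  fixes f :: "'a::tree_code list \<Rightarrow> 'b::tree_code"
  assumes P: "list_all wfc P"
    "\<And>a l \<sigma> rest. \<sigma> 0 = tcode (Node a l) @ rest \<Longrightarrow>
       exec P \<sigma> (16 * length (tcode (Node a l)) + 15) (\<sigma>(0 := tcode (F a l) @ rest))"
    and f: "\<And>x xs. enc (f (x # xs)) = F (enc x) (enc xs)"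
  shows "polytime f"
proof -
  define Q where "Q = Pop 0 # map (Push 0) (rev (ecode (f [])))"
  have Q: "list_all wfc Q"
    unfolding Q_def using tcode_symb by (fastforce simp: list_all_iff ecode_def)
  show ?thesis
  proof (rule polytimeI[of "[Branch 0 [2] P Q]" "\<lambda>s. Suc (16 * s + 16 + esize (f []))"])
    fix xs :: "'a list" and \<sigma> :: store and rest assume p: "\<sigma> 0 = ecode xs @ rest"
    show "exec [Branch 0 [2] P Q] \<sigma> (Suc (16 * esize xs + 16 + esize (f []))) (\<sigma>(0 := ecode (f xs) @ rest))"
    proof (cases xs)
      case Nil
      have "exec Q \<sigma> (Suc (length (rev (ecode (f [])))))
        ((\<sigma>(0 := rest))(0 := rev (rev (ecode (f []))) @ rest))"
        using p Nil exec_pushes[of 0 "rev (ecode (f []))" "\<sigma>(0 := rest)"] unfolding Q_def by (intro exec_Pop) simp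
      then have "exec (Q @ []) \<sigma> (16 * esize xs + 16 + esize (f [])) (\<sigma>(0 := ecode (f xs) @ rest))"
        unfolding append_Nil2 rev_rev_ident fun_upd_upd Nil by (rule exec_mono) (simp add: esize_def)
      then show ?thesis using p Nil by (intro exec_Branch2) simp_all
    next
      case (Cons y ys)
      have "\<sigma> 0 = tcode (Node (enc y) (enc ys)) @ rest" using p Cons by (simp add: ecode_def)
      from P(2)[of \<sigma>, OF this]
      have "exec (P @ []) \<sigma> (16 * esize xs + 16 + esize (f [])) (\<sigma>(0 := ecode (f xs) @ rest))"
        unfolding append_Nil2 Cons ecode_def f by (rule exec_mono) (simp add: esize_def ecode_def)
      then show ?thesis using p Cons by (intro exec_Branch1) simp_all
    qed
  qed (use P(1) Q in \<open>auto intro!: poly_intros\<close>)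
qed

lemma polytime_hd1: "polytime hd"
  by (rule polytime_list_case[OF wf_fst_snd(1) exec_fst_prog]) simp_all

lemma polytime_tl1: "polytime tl"
  by (rule polytime_list_case[OF wf_fst_snd(2) exec_snd_prog]) simp_all

lemma polytime_null1: "polytime (\<lambda>xs. xs = [])"
proof (rule polytime_list_case[of "drop_tree @ map (Push 0) (rev (ecode False))" "\<lambda>_ _. enc False"])
  fix a l and \<sigma> :: store and rest assume "\<sigma> 0 = tcode (Node a l) @ rest"
  from exec_append[OF exec_drop_tree[of \<sigma>, OF this] exec_pushes[of 0 "rev (ecode False)"]]
  have "exec (drop_tree @ map (Push 0) (rev (ecode False))) \<sigma> (7 * length (tcode (Node a l)) + 12)
    (\<sigma>(0 := ecode False @ rest))" by (simp add: ecode_bool)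
  then show "exec (drop_tree @ map (Push 0) (rev (ecode False))) \<sigma> (16 * length (tcode (Node a l)) + 15)
    (\<sigma>(0 := tcode (enc False) @ rest))"
    unfolding ecode_def by (rule exec_mono) simp
qed (auto simp: wf_tree_programs ecode_bool)

lemmas polytime_hd [polytime_intros] = polytime_comp[OF _ polytime_hd1]
  and polytime_tl [polytime_intros] = polytime_comp[OF _ polytime_tl1]
  and polytime_null [polytime_intros] = polytime_comp[OF _ polytime_null1]

text \<open>The remaining list lies directly above the state. Pushing 2 turns the two codes into
  that of a pair, on which the step program works; popping dissolves the pair again. The loop stops
  when the code 1 of the empty list is on top.\<close>

lemma exec_fold_loop:
  assumes H: "\<And>y \<sigma> rest. \<sigma> 0 = ecode y @ rest \<Longrightarrow>
      exec P \<sigma> ((esize y + 2) ^ d) (\<sigma>(0 := ecode (tl (fst y), h (snd y) (hd (fst y))) @ rest))"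
    and M: "\<And>i. i \<le> length l \<Longrightarrow> esize (drop i l, foldl h z (take i l)) \<le> M"
    and \<sigma>: "\<sigma> 0 = ecode l @ ecode z @ rest"
  shows "exec [Loop 0 [2] (Push 0 2 # P @ [Pop 0])] \<sigma> (length l * ((M + 2) ^ d + 3) + 1)
    (\<sigma>(0 := 1 # ecode (foldl h z l) @ rest))"
  using M \<sigma>
proof (induction l arbitrary: z \<sigma>)
  case Nil
  have "exec [Loop 0 [2] (Push 0 2 # P @ [Pop 0])] \<sigma> (Suc 0) (\<sigma>(0 := 1 # ecode (foldl h z []) @ rest))"
    by (rule exec_Loop2, use Nil in simp, rule exec_eq, rule exec_Nil) (use Nil in auto)
  then show ?case by (rule exec_mono) simp
next
  case (Cons a l)
  define \<sigma>1 where "\<sigma>1 = \<sigma>(0 := ecode l @ ecode (h z a) @ rest)"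
  have IH: "exec [Loop 0 [2] (Push 0 2 # P @ [Pop 0])] \<sigma>1 (length l * ((M + 2) ^ d + 3) + 1)
    (\<sigma>1(0 := 1 # ecode (foldl h (h z a) l) @ rest))"
  proof (rule Cons.IH)
    show "esize (drop i l, foldl h (h z a) (take i l)) \<le> M" if "i \<le> length l" for i
      using Cons.prems(1)[of "Suc i"] that by simp
  qed (simp add: \<sigma>1_def)
  let ?s = "\<sigma>(0 := 2 # \<sigma> 0)"
  have m: "esize (a # l, z) \<le> M" using Cons.prems(1)[of 0] by simp
  have "exec P ?s ((esize (a # l, z) + 2) ^ d) (?s(0 := ecode (tl (fst (a # l, z)), h (snd (a # l, z)) (hd (fst (a # l, z)))) @ rest))"
    by (rule H) (use Cons.prems in simp)
  then have 1: "exec P ?s ((M + 2) ^ d) (\<sigma>(0 := 2 # ecode l @ ecode (h z a) @ rest))"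
    unfolding fun_upd_upd by (rule exec_mono[OF exec_eq]) (use power_mono_le[OF m] in auto)
  have 2: "exec (Pop 0 # [Loop 0 [2] (Push 0 2 # P @ [Pop 0])]) (\<sigma>(0 := 2 # ecode l @ ecode (h z a) @ rest))
    (Suc (length l * ((M + 2) ^ d + 3) + 1)) (\<sigma>1(0 := 1 # ecode (foldl h (h z a) l) @ rest))"
    by (rule exec_Pop) (use IH in \<open>simp add: \<sigma>1_def\<close>)
  have "exec ((Push 0 2 # P @ [Pop 0]) @ [Loop 0 [2] (Push 0 2 # P @ [Pop 0])]) \<sigma>
    (Suc ((M + 2) ^ d + (Suc (length l * ((M + 2) ^ d + 3) + 1)))) (\<sigma>1(0 := 1 # ecode (foldl h (h z a) l) @ rest))"
    using exec_Push[OF exec_append[OF 1 2]] by simp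
  from exec_Loop1[OF _ this]
  have "exec [Loop 0 [2] (Push 0 2 # P @ [Pop 0])] \<sigma> (Suc (Suc ((M + 2) ^ d + (Suc (length l * ((M + 2) ^ d + 3) + 1)))))
    (\<sigma>1(0 := 1 # ecode (foldl h (h z a) l) @ rest))" using Cons.prems(2) by simp
  then show ?case unfolding \<sigma>1_def fun_upd_upd by (rule exec_mono[OF exec_eq]) auto
qed

lemma foldl_env: "foldl (\<lambda>y a. (fst y, g (fst y) (snd y) a)) (x, s) l = (x, foldl (g x) s l)"
  by (induction l arbitrary: s) auto

text \<open>The input \<open>x\<close> travels along as an unchanging component of the state, so the
  step function may consult it. The size bound covers all intermediate states, since a step in
  polynomial time could square the size each time.\<close>

lemma polytime_foldl:
  fixes g :: "'x::tree_code \<Rightarrow> 's::tree_code \<Rightarrow> 'a::tree_code \<Rightarrow> 's" and l :: "'x \<Rightarrow> 'a list"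
  assumes l: "polytime l" and s: "polytime s"
    and g: "polytime (\<lambda>p. g (fst (fst p)) (snd (fst p)) (snd p))"
    and b: "poly_bdd b"
    and size: "\<And>x i. i \<le> length (l x) \<Longrightarrow> esize (foldl (g x) (s x) (take i (l x))) \<le> b (esize x)"
  shows "polytime (\<lambda>x. foldl (g x) (s x) (l x))"
proof -
  define h :: "'x \<times> 's \<Rightarrow> 'a \<Rightarrow> 'x \<times> 's" where "h = (\<lambda>y a. (fst y, g (fst y) (snd y) a))"
  have "polytime (\<lambda>y::'a list \<times> ('x \<times> 's). (snd y, hd (fst y)))" by (intro polytime_intros)
  from polytime_comp[OF this g]
  have "polytime (\<lambda>y::'a list \<times> ('x \<times> 's). (tl (fst y), h (snd y) (hd (fst y))))"
    unfolding h_def by (intro polytime_intros) simp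
  then obtain P d where P: "list_all wfc P" "\<And>y \<sigma> rest. \<sigma> 0 = ecode y @ rest \<Longrightarrow>
      exec P \<sigma> ((esize y + 2) ^ d) (\<sigma>(0 := ecode (tl (fst y), h (snd y) (hd (fst y))) @ rest))"
    by (rule polytimeE) blast
  have "polytime (\<lambda>x. (l x, (x, s x)))" by (intro polytime_intros l s)
  then obtain Q e where Q: "list_all wfc Q" "\<And>x \<sigma> rest. \<sigma> 0 = ecode x @ rest \<Longrightarrow>
      exec Q \<sigma> ((esize x + 2) ^ e) (\<sigma>(0 := ecode (l x, (x, s x)) @ rest))"
    by (rule polytimeE) blast
  obtain k where k: "\<And>x. esize (l x) \<le> (esize x + 2) ^ k" by (rule polytime_size[OF l]) blast
  define M where "M = (\<lambda>n. (n + 2) ^ k + n + b n + 2)"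
  have "polytime (\<lambda>x. (x, foldl (g x) (s x) (l x)))"
  proof (rule polytimeI[of "Q @ [Pop 0] @ [Loop 0 [2] (Push 0 2 # P @ [Pop 0])] @ [Pop 0]"
      "\<lambda>n. (n + 2) ^ e + (Suc 0 + (((n + 2) ^ k * ((M n + 2) ^ d + 3) + 1) + Suc 0))"])
    fix x :: 'x and \<sigma> :: store and rest assume x: "\<sigma> 0 = ecode x @ rest"
    let ?s1 = "\<sigma>(0 := ecode (l x) @ ecode (x, s x) @ rest)"
    let ?s2 = "\<sigma>(0 := 1 # ecode (foldl h (x, s x) (l x)) @ rest)"
    note 1 = Q(2)[of \<sigma>, OF x]
    have 2: "exec [Pop 0] (\<sigma>(0 := ecode (l x, (x, s x)) @ rest)) (Suc 0) ?s1"
      by (rule exec_Pop, rule exec_eq, rule exec_Nil) simp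
    have "exec [Loop 0 [2] (Push 0 2 # P @ [Pop 0])] ?s1 (length (l x) * ((M (esize x) + 2) ^ d + 3) + 1)
      (?s1(0 := 1 # ecode (foldl h (x, s x) (l x)) @ rest))"
    proof (rule exec_fold_loop[OF P(2)])
      fix i assume i: "i \<le> length (l x)"
      show "esize (drop i (l x), foldl h (x, s x) (take i (l x))) \<le> M (esize x)"
        using size[OF i] esize_drop[of i "l x"] k[of x] unfolding h_def foldl_env M_def by simp
    qed auto
    then have 3: "exec [Loop 0 [2] (Push 0 2 # P @ [Pop 0])] ?s1
      ((esize x + 2) ^ k * ((M (esize x) + 2) ^ d + 3) + 1) ?s2"
      unfolding fun_upd_upd
      by (rule exec_mono) (use length_le_esize[of "l x"] k[of x] in \<open>auto intro!: mult_le_mono1\<close>)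
    have 4: "exec [Pop 0] ?s2 (Suc 0) (\<sigma>(0 := ecode (x, foldl (g x) (s x) (l x)) @ rest))"
      by (rule exec_Pop, rule exec_eq, rule exec_Nil) (simp add: h_def foldl_env)
    show "exec (Q @ [Pop 0] @ [Loop 0 [2] (Push 0 2 # P @ [Pop 0])] @ [Pop 0]) \<sigma>
      ((esize x + 2) ^ e + (Suc 0 + (((esize x + 2) ^ k * ((M (esize x) + 2) ^ d + 3) + 1) + Suc 0)))
      (\<sigma>(0 := ecode (x, foldl (g x) (s x) (l x)) @ rest))"
      by (intro exec_append[OF 1] exec_append[OF 2] exec_append[OF 3] 4)
  qed (use P Q b in \<open>auto intro!: poly_intros simp: M_def\<close>)
  from polytime_snd[OF this] show ?thesis by simp
qed

text \<open>The increment is bounded independently of the current state, so the state grows at most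
  by the number of rounds times a polynomial. This criterion handles most of the folds
  below.\<close>

lemma polytime_foldl_additive:
  fixes g :: "'x::tree_code \<Rightarrow> 's::tree_code \<Rightarrow> 'a::tree_code \<Rightarrow> 's" and l :: "'x \<Rightarrow> 'a list"
  assumes l: "polytime l" and s: "polytime s"
    and g: "polytime (\<lambda>p. g (fst (fst p)) (snd (fst p)) (snd p))"
    and size: "\<And>x s a. a \<in> set (l x) \<Longrightarrow> esize (g x s a) \<le> esize s + (esize x + esize a + 2) ^ d"
  shows "polytime (\<lambda>x. foldl (g x) (s x) (l x))"
proof -
  obtain k where k: "\<And>x. esize (l x) \<le> (esize x + 2) ^ k" by (rule polytime_size[OF l]) blast
  obtain e where e: "\<And>x. esize (s x) \<le> (esize x + 2) ^ e" by (rule polytime_size[OF s]) blast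
  show ?thesis
  proof (rule polytime_foldl[OF l s g, where b = "\<lambda>n. (n + 2) ^ e + (n + 2) ^ k * (n + (n + 2) ^ k + 2) ^ d"])
    fix x i assume i: "i \<le> length (l x)"
    have *: "esize (foldl (g x) z xs) \<le> esize z + length xs * (esize x + (esize x + 2) ^ k + 2) ^ d"
      if "set xs \<subseteq> set (l x)" for xs z
      using that
    proof (induction xs arbitrary: z)
      case (Cons a xs)
      have "esize a \<le> (esize x + 2) ^ k" using esize_member[of a "l x"] Cons.prems k[of x] by simp
      then have "(esize x + esize a + 2) ^ d \<le> (esize x + (esize x + 2) ^ k + 2) ^ d"
        by (intro power_mono_le) simp
      then have "esize (g x z a) \<le> esize z + (esize x + (esize x + 2) ^ k + 2) ^ d"
        using size[of a x z] Cons.prems by simp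
      then show ?case using Cons.IH[of "g x z a"] Cons.prems by simp
    qed simp
    have "length (take i (l x)) \<le> (esize x + 2) ^ k"
      using i length_le_esize[of "l x"] k[of x] by simp
    then have "length (take i (l x)) * (esize x + (esize x + 2) ^ k + 2) ^ d
      \<le> (esize x + 2) ^ k * (esize x + (esize x + 2) ^ k + 2) ^ d" by (rule mult_le_mono1)
    moreover have "set (take i (l x)) \<subseteq> set (l x)" by (rule set_take_subset)
    ultimately show "esize (foldl (g x) (s x) (take i (l x)))
      \<le> (esize x + 2) ^ e + (esize x + 2) ^ k * (esize x + (esize x + 2) ^ k + 2) ^ d"
      using *[of "take i (l x)" "s x"] e[of x] by linarith
  qed (intro poly_intros)
qed

lemma rev_foldl: "rev (map f xs) = foldl (\<lambda>s a. f a # s) [] xs"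
proof -
  have "foldl (\<lambda>s a. f a # s) ys xs = rev (map f xs) @ ys" for ys
    by (induction xs arbitrary: ys) auto
  then show ?thesis by simp
qed

lemma polytime_rev_map:
  fixes f :: "'a::tree_code \<Rightarrow> 'b::tree_code \<Rightarrow> 'c::tree_code"
  assumes l: "polytime l" and f: "polytime (\<lambda>p. f (fst p) (snd p))"
  shows "polytime (\<lambda>x. rev (map (f x) (l x)))"
proof -
  obtain d where d: "\<And>p. esize (f (fst p) (snd p)) \<le> (esize p + 2) ^ d"
    by (rule polytime_size[OF f]) blast
  have d': "esize (f x a) \<le> (esize x + esize a + 3) ^ d" for x a
    using d[of "(x, a)"] by (simp add: numeral_3_eq_3)
  obtain e where e: "\<And>n. Suc ((n + 3) ^ d) \<le> (n + 2) ^ e" for n :: nat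
    by (rule poly_bddE[of "\<lambda>n. Suc ((n + 3) ^ d)"]) (intro poly_intros, blast)
  have "polytime (\<lambda>p. (fst (fst p), snd p))" by (intro polytime_intros)
  from polytime_comp[OF this f]
  have g: "polytime (\<lambda>p::('a \<times> 'c list) \<times> 'b. f (fst (fst p)) (snd p) # snd (fst p))"
    by (intro polytime_intros) simp
  have "polytime (\<lambda>x. foldl (\<lambda>s a. f x a # s) [] (l x))"
  proof (rule polytime_foldl_additive[where d = e, OF l polytime_const g])
    show "esize (f x a # s) \<le> esize s + (esize x + esize a + 2) ^ e" for x and s :: "'c list" and a
      using d'[of x a] e[of "esize x + esize a"] by simp
  qed
  then show ?thesis by (simp add: rev_foldl)
qed

lemma polytime_rev [polytime_intros]: "polytime l \<Longrightarrow> polytime (\<lambda>x. rev (l x))"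
  using polytime_rev_map[of l "\<lambda>_ a. a"] by (simp add: polytime_snd polytime_id)

lemma polytime_map [polytime_intros]:
  assumes "polytime l" "polytime (\<lambda>p. f (fst p) (snd p))"
  shows "polytime (\<lambda>x. map (f x) (l x))"
  using polytime_rev[OF polytime_rev_map[OF assms]] by simp

lemma polytime_append [polytime_intros]:
  assumes "polytime f" "polytime g" shows "polytime (\<lambda>x. f x @ g x)"
proof -
  have "polytime (\<lambda>x. foldl (\<lambda>s a. a # s) (g x) (rev (f x)))"
    by (intro polytime_foldl_additive[where d = 1] polytime_intros assms) auto
  moreover have "foldl (\<lambda>s a. a # s) ys xs = rev xs @ ys" for xs ys :: "'b list"
    by (induction xs arbitrary: ys) auto
  ultimately show ?thesis by simp
qed

lemma polytime_concat [polytime_intros]: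
  fixes l :: "'a::tree_code \<Rightarrow> 'b::tree_code list list"
  assumes "polytime l" shows "polytime (\<lambda>x. concat (l x))"
proof -
  have "polytime (\<lambda>x. foldl (\<lambda>s a. s @ a) [] (l x))"
  proof (rule polytime_foldl_additive[where d = 1])
    show "esize (s @ a) \<le> esize s + (esize x + esize a + 2) ^ 1" for x :: 'a and s a :: "'b list"
      using esize_append[of s a] by simp
  qed (intro polytime_intros assms)+
  moreover have "foldl (\<lambda>s a. s @ a) ys xs = ys @ concat xs" for xs and ys :: "'b list"
    by (induction xs arbitrary: ys) auto
  ultimately show ?thesis by simp
qed

lemma polytime_list_ex [polytime_intros]:
  fixes l :: "'a::tree_code \<Rightarrow> 'b::tree_code list"
  assumes "polytime l" "polytime (\<lambda>p. f (fst p) (snd p))"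
  shows "polytime (\<lambda>x. list_ex (f x) (l x))"
proof -
  have "polytime (\<lambda>p. (fst (fst p), snd p))" by (intro polytime_intros)
  from polytime_comp[OF this assms(2)]
  have "polytime (\<lambda>x. foldl (\<lambda>s a. s \<or> f x a) False (l x))"
    by (intro polytime_foldl_additive[where d = 0] polytime_intros assms) auto
  moreover have "foldl (\<lambda>s a. s \<or> P a) b xs \<longleftrightarrow> b \<or> list_ex P xs" for P b and xs :: "'b list"
    by (induction xs arbitrary: b) auto
  ultimately show ?thesis by simp
qed

lemma polytime_list_all [polytime_intros]:
  assumes "polytime l" "polytime (\<lambda>p. f (fst p) (snd p))"
  shows "polytime (\<lambda>x. list_all (f x) (l x))"
proof -
  have "polytime (\<lambda>x. \<not> list_ex (\<lambda>a. \<not> f x a) (l x))" by (intro polytime_intros assms)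
  then show ?thesis by (simp add: list_all_iff list_ex_iff)
qed

lemma polytime_drop [polytime_intros]: "polytime l \<Longrightarrow> polytime (\<lambda>x. drop n (l x))"
proof (induction n)
  case (Suc n)
  then show ?case using polytime_tl[of "\<lambda>x. drop n (l x)"] by (simp add: drop_Suc tl_drop)
qed simp

text \<open>The number of iterations is given in unary, as the length of a list that is itself
  computed in polynomial time.\<close>

lemma polytime_funpow:
  fixes l :: "'x::tree_code \<Rightarrow> 'a::tree_code list" and g :: "'x \<Rightarrow> 's::tree_code \<Rightarrow> 's"
  assumes l: "polytime l" and s: "polytime s" and g: "polytime (\<lambda>p. g (fst p) (snd p))"
    and b: "poly_bdd b" "\<And>x i. i \<le> length (l x) \<Longrightarrow> esize ((g x ^^ i) (s x)) \<le> b (esize x)"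
  shows "polytime (\<lambda>x. (g x ^^ length (l x)) (s x))"
proof -
  have f: "foldl (\<lambda>s _. g x s) z xs = (g x ^^ length xs) z" for x z and xs :: "'a list"
    by (induction xs arbitrary: z) (auto simp: funpow_swap1)
  have "polytime (\<lambda>p::('x \<times> 's) \<times> 'a. (fst (fst p), snd (fst p)))" by (intro polytime_intros)
  from polytime_comp[OF this g]
  have "polytime (\<lambda>x. foldl (\<lambda>s _. g x s) (s x) (l x))"
    by (intro polytime_foldl[OF l s _ b(1)]) (simp_all add: f b(2))
  then show ?thesis by (simp add: f)
qed

section \<open>Binary arithmetic\<close>

fun nat_bits :: "nat \<Rightarrow> bool list" where
  "nat_bits n = (if n = 0 then [] else odd n # nat_bits (n div 2))"

declare nat_bits.simps [simp del]

lemma nat_bits_0 [simp]: "nat_bits 0 = []" by (simp add: nat_bits.simps)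

instantiation nat :: tree_code
begin
definition "enc (n::nat) = enc (nat_bits n)"
instance ..
end

definition nbits :: "nat \<Rightarrow> nat" where "nbits n = length (nat_bits n)"

lemma esize_bits: "esize (bs::bool list) = 6 * length bs + 1"
  by (induction bs) auto

lemma esize_nat: "esize n = 6 * nbits n + 1"
  using esize_bits[of "nat_bits n"] by (simp add: nbits_def esize_def ecode_def enc_nat_def)

lemma nbits_le: "nbits n \<le> k \<longleftrightarrow> n < 2 ^ k"
proof (induction k arbitrary: n)
  case 0
  then show ?case by (simp add: nbits_def nat_bits.simps)
next
  case (Suc k)
  show ?case
  proof (cases "n = 0")
    case False
    then have "nbits n = Suc (nbits (n div 2))" by (simp add: nbits_def nat_bits.simps[of n])
    then show ?thesis using Suc[of "n div 2"] by auto
  qed (simp add: nbits_def)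
qed

lemma nbits_less: "n < 2 ^ nbits n" using nbits_le[of n "nbits n"] by simp

lemma nbits_mono: "m \<le> n \<Longrightarrow> nbits m \<le> nbits n"
  using nbits_le[of m "nbits n"] nbits_less[of n] by simp

lemma nbits_mult: "nbits (m * n) \<le> nbits m + nbits n"
  unfolding nbits_le power_add using nbits_less[of m] nbits_less[of n] by (intro mult_strict_mono) auto

text \<open>Additive in both arguments, which serves for bounding the growth in folds as well as the
  number of rounds of the addition. If neither number is 0, both powers of two are at least 2, and
  then their product is at least their sum.\<close>

lemma nbits_add: "nbits (m + n) \<le> nbits m + nbits n"
proof (cases "m = 0 \<or> n = 0")
  case False
  then have "1 \<le> nbits m" "1 \<le> nbits n" by (auto simp: nbits_def nat_bits.simps[of m] nat_bits.simps[of n])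
  then have "(2::nat) ^ 1 \<le> 2 ^ nbits m" "(2::nat) ^ 1 \<le> 2 ^ nbits n" by (intro power_increasing; simp)+
  then obtain a b where ab: "2 ^ nbits m = a + (2::nat)" "2 ^ nbits n = b + (2::nat)"
    by (metis add.commute le_Suc_ex power_one_right)
  have "m + n < 2 ^ nbits m * 2 ^ nbits n"
    using nbits_less[of m] nbits_less[of n] unfolding ab by (simp add: algebra_simps)
  then show ?thesis unfolding nbits_le power_add .
qed (auto simp: nbits_def)

lemma polytime_nat_bits [polytime_intros]: "polytime f \<Longrightarrow> polytime (\<lambda>x. nat_bits (f x))"
  by (rule polytime_comp[OF _ polytime_same_code]) (simp_all add: enc_nat_def)

lemma polytime_nat_by_bits: "polytime (\<lambda>x. nat_bits (f x)) \<Longrightarrow> polytime f"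
  by (erule polytime_code_eq) (simp add: enc_nat_def)

lemma polytime_div2 [polytime_intros]:
  assumes "polytime f" shows "polytime (\<lambda>x. f x div 2 :: nat)"
proof (rule polytime_nat_by_bits)
  have "nat_bits (n div 2) = tl (nat_bits n)" for n by (simp add: nat_bits.simps[of n])
  then show "polytime (\<lambda>x. nat_bits (f x div 2))" using assms by (simp add: polytime_intros)
qed

lemma polytime_odd [polytime_intros]:
  assumes "polytime f" shows "polytime (\<lambda>x. odd (f x :: nat))"
proof -
  have e: "odd n \<longleftrightarrow> \<not> nat_bits n = [] \<and> hd (nat_bits n)" for n by (auto simp: nat_bits.simps[of n])
  show ?thesis unfolding e by (intro polytime_intros assms)
qed

lemma polytime_even [polytime_intros]: "polytime f \<Longrightarrow> polytime (\<lambda>x. even (f x :: nat))"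
  using polytime_not[OF polytime_odd, of f] by simp

lemma polytime_iff [polytime_intros]:
  "polytime b \<Longrightarrow> polytime c \<Longrightarrow> polytime (\<lambda>x. b x = (c x :: bool))"
  by (rule polytime_code_eq[OF polytime_if[OF _ _ polytime_not, of b c c]]) auto

lemma polytime_is_0 [polytime_intros]:
  assumes "polytime f" shows "polytime (\<lambda>x. f x = (0::nat))"
proof -
  have e: "n = 0 \<longleftrightarrow> nat_bits n = []" for n by (auto simp: nat_bits.simps[of n])
  show ?thesis unfolding e by (intro polytime_intros assms)
qed

lemma polytime_bit_cons:
  assumes "polytime f" "polytime b" shows "polytime (\<lambda>x. of_bool (b x) + 2 * f x :: nat)"
proof (rule polytime_nat_by_bits)
  have e: "nat_bits (of_bool c + 2 * n) = (if \<not> c \<and> n = 0 then [] else c # nat_bits n)" for c n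
    by (simp add: nat_bits.simps[of "of_bool c + 2 * n"])
  show "polytime (\<lambda>x. nat_bits (of_bool (b x) + 2 * f x))"
    unfolding e by (intro polytime_intros assms)
qed

definition horner :: "bool list \<Rightarrow> nat" where
  "horner bs = foldl (\<lambda>n b. of_bool b + 2 * n) 0 bs"

lemma horner_snoc: "horner (bs @ [b]) = of_bool b + 2 * horner bs" by (simp add: horner_def)

lemma foldl_horner: "foldl (\<lambda>n b. of_bool b + 2 * n) m bs = m * 2 ^ length bs + horner bs"
  for m :: nat
proof (induction bs rule: rev_induct)
  case (snoc b bs)
  then show ?case by (simp add: horner_snoc)
qed (simp add: horner_def)

lemma horner_Cons: "horner (b # bs) = of_bool b * 2 ^ length bs + horner bs"
  using foldl_horner[of "of_bool b" bs] by (simp add: horner_def)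

lemma nbits_bit_cons: "nbits (of_bool b + 2 * n) \<le> Suc (nbits n)"
  unfolding nbits_le using nbits_less[of n] by (cases b) auto

text \<open>Provides the constant growth per round, less than two bits, for folds with exponent 3 in
  \<open>polytime_foldl_additive\<close>; one bit occupies 6 symbols.\<close>

lemma eight_le_cube: "8 \<le> (n + 2 :: nat) ^ 3"
  using power_mono[of 2 "n + 2" 3] by simp

lemma polytime_horner [polytime_intros]:
  fixes f :: "'a::tree_code \<Rightarrow> bool list"
  assumes "polytime f" shows "polytime (\<lambda>x. horner (f x))"
  unfolding horner_def
proof (rule polytime_foldl_additive[where d = 3])
  show "esize (of_bool a + 2 * n) \<le> esize n + (esize x + esize a + 2) ^ 3" for x :: 'a and n :: nat and a
    using nbits_bit_cons[of a n] eight_le_cube[of "esize x + esize a"] by (simp add: esize_nat)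
qed (intro assms polytime_bit_cons polytime_intros)+

text \<open>Schoolbook addition. The state holds the remaining parts of both summands, the carry,
  and the sum bits produced so far, most significant bit first; in this order they can be
  evaluated by the Horner scheme.\<close>
definition add_step :: "nat \<times> nat \<times> bool \<times> bool list \<Rightarrow> bool \<Rightarrow> nat \<times> nat \<times> bool \<times> bool list" where
  "add_step s _ = (case s of (x, y, c, bs) \<Rightarrow>
     (x div 2, y div 2, (odd x \<and> odd y) \<or> (odd x \<and> c) \<or> (odd y \<and> c), (odd x = (odd y = c)) # bs))"

lemma add_step_inv:
  assumes "foldl add_step (x, y, c, bs) l = (x', y', c', bs')"
  shows "(x' + y' + of_bool c') * 2 ^ length bs' + horner bs' = (x + y + of_bool c) * 2 ^ length bs + horner bs
    \<and> length bs' = length l + length bs"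
  using assms
proof (induction l arbitrary: x y c bs)
  case (Cons a l)
  obtain x1 y1 c1 bs1 where s: "add_step (x, y, c, bs) a = (x1, y1, c1, bs1)" by (metis prod_cases4)
  have *: "x + y + of_bool c = 2 * (x1 + y1 + of_bool c1) + of_bool (hd bs1)" "bs1 = hd bs1 # bs"
  proof -
    define p q where "p = odd x" and "q = odd y"
    have x: "x = 2 * (x div 2) + of_bool p" and y: "y = 2 * (y div 2) + of_bool q"
      by (simp_all add: p_def q_def)
    have e: "x1 = x div 2" "y1 = y div 2" "c1 = ((p \<and> q) \<or> (p \<and> c) \<or> (q \<and> c))" "bs1 = (p = (q = c)) # bs"
      using s unfolding add_step_def p_def q_def by auto
    then show "bs1 = hd bs1 # bs" by simp
    show "x + y + of_bool c = 2 * (x1 + y1 + of_bool c1) + of_bool (hd bs1)"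
      by (subst x, subst y, unfold e) (cases p; cases q; cases c; simp)
  qed
  have "(x1 + y1 + of_bool c1) * 2 ^ length bs1 + horner bs1 = (x + y + of_bool c) * 2 ^ length bs + horner bs"
    unfolding *(1) by (subst *(2), subst (2) *(2)) (simp add: horner_Cons algebra_simps)
  moreover have "length bs1 = Suc (length bs)" by (subst *(2)) simp
  moreover have "foldl add_step (x1, y1, c1, bs1) l = (x', y', c', bs')" using Cons.prems s by simp
  note Cons.IH[OF this]
  ultimately show ?case by (metis add_Suc_right add_Suc length_Cons)
qed simp

text \<open>After as many rounds as both summands have bits together, any remaining part would
  contribute a positive multiple of \<open>2 ^ length bs\<close>, whereas the total is smaller than
  this power. So the digits produced are the whole sum.\<close>

lemma add_by_steps:
  "x + y = horner (snd (snd (snd (foldl add_step (x, y, False, []) (nat_bits x @ nat_bits y)))))"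
proof -
  obtain x' y' c' bs where s: "foldl add_step (x, y, False, []) (nat_bits x @ nat_bits y) = (x', y', c', bs)"
    by (metis prod_cases4)
  have "(x' + y' + of_bool c') * 2 ^ length bs + horner bs = x + y"
    using conjunct1[OF add_step_inv[OF s]] by (simp add: horner_def[of "[]"])
  moreover have "length bs = nbits x + nbits y"
    using conjunct2[OF add_step_inv[OF s]] by (simp add: nbits_def)
  ultimately have *: "(x' + y' + of_bool c') * 2 ^ length bs + horner bs = x + y"
    "length bs = nbits x + nbits y" by blast+
  have "x + y < 2 ^ length bs" using nbits_add[of x y] unfolding nbits_le *(2) .
  then have "(x' + y' + of_bool c') * 2 ^ length bs < 1 * 2 ^ length bs" using * by linarith
  then have "x' + y' + of_bool c' = 0" unfolding mult_less_cancel2 by linarith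
  then show ?thesis using * s by simp
qed

lemma polytime_add [polytime_intros]:
  fixes f :: "'a::tree_code \<Rightarrow> nat"
  assumes "polytime f" "polytime g" shows "polytime (\<lambda>x. f x + g x :: nat)"
proof -
  have "polytime (\<lambda>x. foldl add_step (f x, g x, False, []) (nat_bits (f x) @ nat_bits (g x)))"
  proof (rule polytime_foldl_additive[where d = 3])
    show "polytime (\<lambda>p. add_step (snd (fst p)) (snd p))"
      unfolding add_step_def case_prod_beta by (intro polytime_intros)
    fix x :: 'a and s :: "nat \<times> nat \<times> bool \<times> bool list" and a :: bool
    obtain x1 y1 c1 bs1 where s: "s = (x1, y1, c1, bs1)" by (metis prod_cases4)
    have "nbits (x1 div 2) \<le> nbits x1" "nbits (y1 div 2) \<le> nbits y1" by (auto intro: nbits_mono)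
    then show "esize (add_step s a) \<le> esize s + (esize x + esize a + 2) ^ 3"
      using eight_le_cube[of "esize x + esize a"] by (simp add: s add_step_def esize_nat)
  qed (intro polytime_intros assms)+
  then show ?thesis unfolding add_by_steps[of "f _" "g _"] by (intro polytime_intros)
qed

lemma mult_horner: "foldl (\<lambda>n b. (if b then x else 0) + 2 * n) 0 bs = x * horner bs" for x :: nat
  by (induction bs rule: rev_induct) (auto simp: horner_snoc horner_def algebra_simps)

lemma horner_nat_bits: "horner (rev (nat_bits n)) = n"
proof (induction n rule: nat_bits.induct)
  case (1 n)
  then show ?case by (cases "n = 0") (auto simp: nat_bits.simps[of n] horner_snoc horner_def)
qed

lemma polytime_double: "polytime f \<Longrightarrow> polytime (\<lambda>x. 2 * f x :: nat)"
  using polytime_bit_cons[OF _ polytime_const[of False], of f] by simp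

lemma nbits_double: "nbits (2 * n) \<le> Suc (nbits n)"
  using nbits_bit_cons[of False n] by simp

lemma polytime_mult [polytime_intros]:
  fixes f :: "'a::tree_code \<Rightarrow> nat"
  assumes "polytime f" "polytime g" shows "polytime (\<lambda>x. f x * g x :: nat)"
proof -
  obtain d where d: "\<And>x. esize (f x) \<le> (esize x + 2) ^ d" by (rule polytime_size[OF assms(1)]) blast
  have "polytime (\<lambda>x. foldl (\<lambda>n b. (if b then f x else 0) + 2 * n) 0 (rev (nat_bits (g x))))"
  proof (rule polytime_foldl_additive[where d = "Suc d"])
    have "polytime (\<lambda>p::('a \<times> nat) \<times> bool. f (fst (fst p)))"
      by (intro polytime_comp[OF _ assms(1)] polytime_intros)
    then show "polytime (\<lambda>p::('a \<times> nat) \<times> bool. (if snd p then f (fst (fst p)) else 0) + 2 * snd (fst p))"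
      by (intro polytime_intros polytime_double)
    fix x :: 'a and n :: nat and b :: bool
    have "nbits ((if b then f x else 0) + 2 * n) \<le> nbits (f x) + Suc (nbits n)"
      using nbits_add[of "f x" "2 * n"] nbits_double[of n] by auto
    then have "esize ((if b then f x else 0) + 2 * n) \<le> esize n + (esize (f x) + 6)"
      by (simp add: esize_nat)
    also have "esize (f x) + 6 \<le> (esize x + 2) ^ d + 6 * (esize x + 2) ^ d"
      using d[of x] one_le_power[of "esize x + 2" d] by linarith
    also have "\<dots> = 7 * (esize x + 2) ^ d" by simp
    also have "\<dots> \<le> (esize x + esize b + 2) * (esize x + esize b + 2) ^ d"
      by (intro mult_le_mono power_mono_le) simp_all
    finally show "esize ((if b then f x else 0) + 2 * n) \<le> esize n + (esize x + esize b + 2) ^ Suc d" by simp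
  qed (intro polytime_intros assms)+
  then show ?thesis by (simp add: mult_horner horner_nat_bits)
qed

text \<open>Bits are compared from the least significant one upwards: \<open>r\<close> is the
  verdict on the bits already removed, and a difference at a higher bit overrides it.\<close>

definition less_step :: "nat \<times> nat \<times> bool \<Rightarrow> bool \<Rightarrow> nat \<times> nat \<times> bool" where
  "less_step s _ = (case s of (x, y, r) \<Rightarrow>
     (x div 2, y div 2, if odd x = odd y then r else odd y))"

lemma less_step_inv:
  assumes "foldl less_step (x, y, r) l = (x', y', r')"
  shows "(x' < y' \<or> x' = y' \<and> r' \<longleftrightarrow> x < y \<or> x = y \<and> r) \<and> x' = x div 2 ^ length l \<and> y' = y div 2 ^ length l"
  using assms
proof (induction l arbitrary: x y r)
  case (Cons a l)
  let ?r = "if odd x = odd y then r else odd y"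
  have *: "(2 * u + of_bool p < 2 * v + of_bool q \<or> 2 * u + of_bool p = 2 * v + of_bool q \<and> r)
    \<longleftrightarrow> (u < v \<or> u = v \<and> (if p = q then r else q))" for u v :: nat and p q
    by (cases p; cases q; cases r; simp; linarith)
  have A: "(x div 2 < y div 2 \<or> x div 2 = y div 2 \<and> ?r) \<longleftrightarrow> (x < y \<or> x = y \<and> r)"
  proof -
    have "2 * (x div 2) + of_bool (odd x) = x" "2 * (y div 2) + of_bool (odd y) = y" by simp_all
    then show ?thesis using *[of "x div 2" "odd x" "y div 2" "odd y"] by metis
  qed
  have "less_step (x, y, r) a = (x div 2, y div 2, ?r)" by (simp add: less_step_def)
  with Cons.prems have "foldl less_step (x div 2, y div 2, ?r) l = (x', y', r')" by simp
  note B = Cons.IH[OF this]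
  have C: "n div 2 ^ length (a # l) = n div 2 div 2 ^ length l" for n :: nat
    by (simp add: div_mult2_eq)
  show ?case unfolding C using trans[OF conjunct1[OF B] A] conjunct2[OF B] by (rule conjI)
qed simp

lemma less_by_steps:
  "x < y \<longleftrightarrow> snd (snd (foldl less_step (x, y, False) (nat_bits x @ nat_bits y)))"
proof -
  obtain x' y' r where s: "foldl less_step (x, y, False) (nat_bits x @ nat_bits y) = (x', y', r)"
    by (metis prod_cases3)
  have "x < 2 ^ (nbits x + nbits y)" "y < 2 ^ (nbits x + nbits y)"
    using nbits_le[of x "nbits x + nbits y"] nbits_le[of y "nbits x + nbits y"] by simp_all
  then have z: "x' = 0" "y' = 0" using less_step_inv[OF s] by (simp_all add: nbits_def)
  show ?thesis using less_step_inv[OF s] unfolding s z by simp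
qed

lemma polytime_less [polytime_intros]:
  fixes f :: "'a::tree_code \<Rightarrow> nat"
  assumes "polytime f" "polytime g" shows "polytime (\<lambda>x. (f x :: nat) < g x)"
proof -
  have "polytime (\<lambda>x. foldl less_step (f x, g x, False) (nat_bits (f x) @ nat_bits (g x)))"
  proof (rule polytime_foldl_additive[where d = 3])
    show "polytime (\<lambda>p. less_step (snd (fst p)) (snd p))"
      unfolding less_step_def case_prod_beta by (intro polytime_intros)
    fix x :: 'a and s :: "nat \<times> nat \<times> bool" and a :: bool
    obtain x1 y1 r1 where s: "s = (x1, y1, r1)" by (metis prod_cases3)
    have "nbits (x1 div 2) \<le> nbits x1" "nbits (y1 div 2) \<le> nbits y1" by (auto intro: nbits_mono)
    then show "esize (less_step s a) \<le> esize s + (esize x + esize a + 2) ^ 3"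
      using eight_le_cube[of "esize x + esize a"] by (simp add: s less_step_def esize_nat)
  qed (intro polytime_intros assms)+
  then show ?thesis unfolding less_by_steps[of "f _" "g _"] by (intro polytime_intros)
qed

lemma polytime_nat_eq [polytime_intros]:
  assumes "polytime f" "polytime g" shows "polytime (\<lambda>x. f x = (g x :: nat))"
proof -
  have "polytime (\<lambda>x. \<not> f x < g x \<and> \<not> g x < f x)" by (intro polytime_intros assms)
  moreover have "(\<not> m < n \<and> \<not> n < m) \<longleftrightarrow> m = n" for m n :: nat by auto
  ultimately show ?thesis by simp
qed

lemma foldl_list_eq:
  "foldl (\<lambda>s a. (tl (fst s), snd s \<and> fst s \<noteq> [] \<and> a = hd (fst s))) (ys, b) xs
    = (drop (length xs) ys, b \<and> length xs \<le> length ys \<and> take (length xs) ys = xs)"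
proof (induction xs arbitrary: ys b)
  case (Cons x xs)
  note IH = Cons.IH
  show ?case
  proof (cases ys)
    case Nil
    then show ?thesis using Cons.IH[of "[]" False] by simp
  next
    case (Cons y zs)
    then show ?thesis using IH[of zs "b \<and> x = y"] by auto
  qed
qed simp

lemma polytime_nat_list_eq [polytime_intros]:
  fixes f :: "'a::tree_code \<Rightarrow> nat list"
  assumes "polytime f" "polytime g" shows "polytime (\<lambda>x. f x = (g x :: nat list))"
proof -
  let ?st = "\<lambda>s a. (tl (fst s), snd s \<and> fst s \<noteq> [] \<and> a = hd (fst s))"
  have tl: "esize (tl xs) \<le> esize xs" for xs :: "nat list" by (cases xs) auto
  have "polytime (\<lambda>x. foldl ?st (g x, True) (f x))"
  proof (rule polytime_foldl_additive[where d = 0])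
    show "polytime (\<lambda>p::('a \<times> nat list \<times> bool) \<times> nat. ?st (snd (fst p)) (snd p))"
      by (intro polytime_intros)
    show "esize (?st s a) \<le> esize s + (esize x + esize a + 2) ^ 0"
      for x :: 'a and s :: "nat list \<times> bool" and a :: nat
      using tl[of "fst s"] by (cases s) simp
  qed (intro polytime_intros assms)+
  then have "polytime (\<lambda>x. snd (foldl ?st (g x, True) (f x)) \<and> fst (foldl ?st (g x, True) (f x)) = [])"
    by (intro polytime_intros)
  moreover have "snd (foldl ?st (ys, True) xs) \<and> fst (foldl ?st (ys, True) xs) = [] \<longleftrightarrow> xs = ys" for xs ys :: "nat list"
  proof -
    have "length xs \<le> length ys \<and> take (length xs) ys = xs \<and> length ys \<le> length xs \<longleftrightarrow> xs = ys"
      by (metis dual_order.refl take_all)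
    then show ?thesis unfolding foldl_list_eq fst_conv snd_conv drop_eq_Nil by blast
  qed
  ultimately show ?thesis by (simp only:)
qed

section \<open>From polynomial-time functions to Turing machines\<close>

text \<open>Recodes one symbol of the raw input as a list entry. The input lies on stack 0 with its
  last symbol on top, so consing from that end builds the list in the right order.\<close>

definition push_symb :: "nat \<Rightarrow> cmd list" where
  "push_symb s = Pop 0 # map (Push 1) (rev (ecode s)) @ [Push 1 2]"

primrec read_symb :: "nat list \<Rightarrow> cmd list" where
  "read_symb [] = []"
| "read_symb (s # ss) = [Branch 0 [s] (push_symb s) (read_symb ss)]"

lemma exec_push_symb:
  assumes "\<sigma> 0 = s # w"
  shows "exec (push_symb s) \<sigma> (esize s + 2) (\<sigma>(0 := w, 1 := 2 # ecode s @ \<sigma> 1))"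
proof -
  let ?s = "\<sigma>(0 := w)"
  have "exec (map (Push 1) (rev (ecode s))) ?s (length (rev (ecode s))) (?s(1 := rev (rev (ecode s)) @ ?s 1))"
    by (rule exec_pushes)
  moreover have "exec [Push 1 2] (?s(1 := rev (rev (ecode s)) @ ?s 1)) (Suc 0) (\<sigma>(0 := w, 1 := 2 # ecode s @ \<sigma> 1))"
    by (rule exec_Push, rule exec_eq, rule exec_Nil) simp
  ultimately have "exec (map (Push 1) (rev (ecode s)) @ [Push 1 2]) ?s (length (rev (ecode s)) + Suc 0)
    (\<sigma>(0 := w, 1 := 2 # ecode s @ \<sigma> 1))" by (rule exec_append)
  then have "exec (map (Push 1) (rev (ecode s)) @ [Push 1 2]) (\<sigma>(0 := tl (\<sigma> 0))) (esize s + 1)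
    (\<sigma>(0 := w, 1 := 2 # ecode s @ \<sigma> 1))" using assms by (simp add: esize_def)
  from exec_Pop[OF this] show ?thesis unfolding push_symb_def by simp
qed

lemma exec_read_symb:
  assumes "\<sigma> 0 = s # w" "s \<in> set ss"
  shows "exec (read_symb ss) \<sigma> (length ss + esize s + 2) (\<sigma>(0 := w, 1 := 2 # ecode s @ \<sigma> 1))"
  using assms(2)
proof (induction ss)
  case (Cons a ss)
  show ?case
  proof (cases "a = s")
    case True
    have "exec (push_symb s @ []) \<sigma> (esize s + 2) (\<sigma>(0 := w, 1 := 2 # ecode s @ \<sigma> 1))"
      using exec_push_symb[of \<sigma>, OF assms(1)] by simp
    from exec_Branch1[OF _ this, of 0 "[a]"] show ?thesis unfolding read_symb.simps True
      by (rule exec_mono) (use assms(1) True in auto)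
  next
    case False
    then have "s \<in> set ss" using Cons.prems by simp
    from Cons.IH[OF this] have "exec (read_symb ss @ []) \<sigma> (length ss + esize s + 2) (\<sigma>(0 := w, 1 := 2 # ecode s @ \<sigma> 1))"
      unfolding append_Nil2 .
    from exec_Branch2[OF _ this, of 0 "[a]"] show ?thesis unfolding read_symb.simps
      by (rule exec_mono) (use assms(1) False in auto)
  qed
qed simp

lemma esize_symb: "(s::nat) < 6 \<Longrightarrow> esize s \<le> 19"
  using nbits_le[of s 3] by (simp add: esize_nat)

lemma exec_read_loop:
  assumes "set w \<subseteq> {0<..<6}" "\<sigma> 0 = rev w" "\<sigma> 1 = ecode v"
  shows "exec [Loop 0 [1, 2, 3, 4, 5] (read_symb [1, 2, 3, 4, 5])] \<sigma> (27 * length w + 1)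
    (\<sigma>(0 := [], 1 := ecode (w @ v)))"
  using assms
proof (induction w arbitrary: v \<sigma> rule: rev_induct)
  case Nil
  have "exec [Loop 0 [1, 2, 3, 4, 5] (read_symb [1, 2, 3, 4, 5])] \<sigma> (Suc 0) (\<sigma>(0 := [], 1 := ecode ([] @ v)))"
    by (rule exec_Loop2, use Nil in simp, rule exec_eq, rule exec_Nil) (use Nil in \<open>auto simp: fun_eq_iff\<close>)
  then show ?case by (rule exec_mono) simp
next
  case (snoc s w)
  let ?L = "[Loop 0 [1, 2, 3, 4, 5] (read_symb [1, 2, 3, 4, 5])]"
  let ?s = "\<sigma>(0 := rev w, 1 := 2 # ecode s @ \<sigma> 1)"
  have s: "s = 1 \<or> s = 2 \<or> s = 3 \<or> s = 4 \<or> s = 5" "\<sigma> 0 = s # rev w" "s < 6" using snoc.prems by auto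
  have "exec (read_symb [1, 2, 3, 4, 5]) \<sigma> (length [1, 2, 3, 4, 5::nat] + esize s + 2) ?s"
    by (rule exec_read_symb) (use s in auto)
  then have 1: "exec (read_symb [1, 2, 3, 4, 5]) \<sigma> 26 ?s"
    by (rule exec_mono) (use esize_symb[OF s(3)] in simp)
  have "exec ?L ?s (27 * length w + 1) (?s(0 := [], 1 := ecode (w @ s # v)))"
    by (rule snoc.IH) (use snoc.prems in auto)
  from exec_append[OF 1 this]
  have "exec ?L \<sigma> (Suc (26 + (27 * length w + 1))) (?s(0 := [], 1 := ecode (w @ s # v)))"
    by (intro exec_Loop1) (use s in auto)
  then show ?case by (rule exec_mono[OF exec_eq]) (auto simp: fun_eq_iff)
qed

lemma esize_word: "set w \<subseteq> {0<..<6} \<Longrightarrow> esize w \<le> 20 * length w + 1" for w :: "nat list"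
proof (induction w)
  case (Cons a w)
  then show ?case using esize_symb[of a] by simp
qed simp

theorem polytime_tm:
  fixes f :: "nat list \<Rightarrow> bool"
  assumes "polytime f"
  shows "\<exists>M c d. valid_tm M \<and> (\<forall>w. set w \<subseteq> {0<..<6} \<longrightarrow>
    (\<exists>t \<le> c * length w ^ d + c. fst (tm_run M t w) = (if f w then 1 else 2)))"
proof -
  obtain P d where P: "list_all wfc P" "\<And>x \<sigma> rest. \<sigma> 0 = ecode x @ rest \<Longrightarrow>
    exec P \<sigma> ((esize x + 2) ^ d) (\<sigma>(0 := ecode (f x) @ rest))" using assms by (rule polytimeE) blast
  define R where "R = [Loop 0 [1, 2, 3, 4, 5] (read_symb [1, 2, 3, 4, 5])]"
  \<comment> \<open>The first 1 is the code of \<open>[]\<close>. Two transfers bring the finished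
    code from stack 1 to stack 0 in its original orientation. The second symbol of the code of the
    result tells \<open>True\<close> from \<open>False\<close>.\<close>
  define prog where "prog = [Push 1 1] @ R @ transfer 1 2 @ transfer 2 0 @ P @
    [Pop 0, Branch 0 [1] [Halt True] [Halt False]]"
  have ecode: "list_all wfc (map (Push 1) (rev (ecode x)))" for x :: nat
    using tcode_symb by (fastforce simp: list_all_iff ecode_def)
  have "list_all wfc prog"
    using P(1) ecode unfolding prog_def R_def by (simp add: wf_tree_programs push_symb_def)
  from stack_program_tm[OF this] obtain M where M: "valid_tm M"
    "\<And>w n b k' \<sigma>'. set w \<subseteq> {0<..<6} \<Longrightarrow> (cstep ^^ n) (prog, init_store w) = (Halt b # k', \<sigma>') \<Longrightarrow>
      \<exists>t \<le> n * (2 * (length w + n) + 7) + 3. fst (tm_run M t w) = (if b then 1 else 2)" by blast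
  define N where "N = (\<lambda>n. Suc 0 + ((27 * n + 1) + ((4 * (20 * n + 1) + 1) + ((4 * (20 * n + 1) + 1) +
    (20 * n + 1 + 2) ^ d))) + 2)"
  have "poly_bdd (\<lambda>n. N n * (2 * (n + N n) + 7) + 3)"
    unfolding N_def by (intro poly_intros)
  then obtain D where D: "\<And>n. N n * (2 * (n + N n) + 7) + 3 \<le> (n + 2) ^ D" by (rule poly_bddE) blast
  have "\<exists>t \<le> 3 ^ D * length w ^ D + 3 ^ D. fst (tm_run M t w) = (if f w then 1 else 2)"
    if w: "set w \<subseteq> {0<..<6}" for w
  proof -
    have sz: "esize w \<le> 20 * length w + 1" by (rule esize_word[OF w])
    define s0 where "s0 = init_store w"
    define s1 where "s1 = s0(1 := [1])"
    define s2 where "s2 = s0(0 := [], 1 := ecode w)"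
    define s3 where "s3 = s0(0 := [], 2 := rev (ecode w))"
    define s4 where "s4 = s0(0 := ecode w)"
    define s5 where "s5 = s0(0 := ecode (f w))"
    have 1: "exec [Push 1 1] s0 (Suc 0) s1"
      by (rule exec_Push, rule exec_eq, rule exec_Nil) (simp add: s1_def s0_def init_store_def)
    have "exec R s1 (27 * length w + 1) (s1(0 := [], 1 := ecode (w @ [])))"
      unfolding R_def by (rule exec_read_loop) (use w in \<open>auto simp: s1_def s0_def init_store_def\<close>)
    then have 2: "exec R s1 (27 * length w + 1) s2"
      by (rule exec_eq) (auto simp: s1_def s2_def fun_eq_iff)
    have "exec (transfer 1 2) s2 (4 * length (ecode w) + 1) (s2(1 := [], 2 := rev (ecode w) @ s2 2))"
      by (rule exec_transfer) (use set_tcode in \<open>auto simp: s2_def ecode_def\<close>)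
    then have 3: "exec (transfer 1 2) s2 (4 * (20 * length w + 1) + 1) s3"
      by (rule exec_mono[OF exec_eq]) (use sz in \<open>auto simp: s2_def s3_def s0_def init_store_def fun_eq_iff esize_def\<close>)
    have "exec (transfer 2 0) s3 (4 * length (rev (ecode w)) + 1) (s3(2 := [], 0 := rev (rev (ecode w)) @ s3 0))"
      by (rule exec_transfer) (use set_tcode in \<open>auto simp: s3_def ecode_def\<close>)
    then have 4: "exec (transfer 2 0) s3 (4 * (20 * length w + 1) + 1) s4"
      by (rule exec_mono[OF exec_eq]) (use sz in \<open>auto simp: s4_def s3_def s0_def init_store_def fun_eq_iff esize_def\<close>)
    have "exec P s4 ((esize w + 2) ^ d) (s4(0 := ecode (f w) @ []))"
      by (rule P(2)) (simp add: s4_def)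
    then have 5: "exec P s4 ((20 * length w + 1 + 2) ^ d) s5"
      by (rule exec_mono[OF exec_eq]) (use power_mono_le[OF sz] in \<open>auto simp: s4_def s5_def\<close>)
    have "exec ([Push 1 1] @ R @ transfer 1 2 @ transfer 2 0 @ P) s0 (N (length w) - 2) s5"
      unfolding N_def diff_add_inverse2
      by (intro exec_append[OF 1] exec_append[OF 2] exec_append[OF 3] exec_append[OF 4] 5)
    then obtain n where n: "n \<le> N (length w) - 2"
      "(cstep ^^ n) (prog, s0) = ([Pop 0, Branch 0 [1] [Halt True] [Halt False]], s5)"
      unfolding exec_def prog_def by (metis append_assoc)
    have "(cstep ^^ 2) ([Pop 0, Branch 0 [1] [Halt True] [Halt False]], s5) = ([Halt (f w)], s5(0 := tl (s5 0)))"
      by (cases "f w") (simp_all add: numeral_2_eq_2 s5_def ecode_bool)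
    then have "(cstep ^^ (2 + n)) (prog, init_store w) = (Halt (f w) # [], s5(0 := tl (s5 0)))"
      using n(2) by (simp only: funpow_add o_apply s0_def)
    from M(2)[OF w this] obtain t where t: "t \<le> (2 + n) * (2 * (length w + (2 + n)) + 7) + 3"
      "fst (tm_run M t w) = (if f w then 1 else 2)" by blast
    have "2 + n \<le> N (length w)" using n(1) by (simp add: N_def)
    then have "(2 + n) * (2 * (length w + (2 + n)) + 7) + 3 \<le> N (length w) * (2 * (length w + N (length w)) + 7) + 3"
      by (intro add_mono mult_le_mono) auto
    also have "\<dots> \<le> (length w + 2) ^ D" by (rule D)
    \<comment> \<open>For a nonempty word, length + 2 is at most 3 * length; for the empty word the
      additive constant covers \<open>2 ^ D\<close>.\<close>
    also have "\<dots> \<le> 3 ^ D * length w ^ D + 3 ^ D"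
    proof (cases "length w = 0")
      case True
      have "(2::nat) ^ D \<le> 3 ^ D" by (rule power_mono) auto
      then show ?thesis unfolding True by (simp add: numeral_2_eq_2 trans_le_add2)
    next
      case False
      then have "length w + 2 \<le> 3 * length w" by linarith
      then have "(length w + 2) ^ D \<le> (3 * length w) ^ D" by (rule power_mono) simp
      then show ?thesis by (simp add: power_mult_distrib)
    qed
    finally show ?thesis using t by (meson le_trans)
  qed
  then show ?thesis using M(1) by blast
qed

section \<open>Definable relations\<close>

text \<open>The positions of a game that look alike: no comparison of an entry with a multiple of an
  entry by a factor in \<open>C\<close> distinguishes \<open>f\<close> from
  \<open>g\<close>.\<close>

definition sim :: "rat set \<Rightarrow> 'i set \<Rightarrow> ('i \<Rightarrow> rat) \<Rightarrow> ('i \<Rightarrow> rat) \<Rightarrow> bool" where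
  "sim C I f g \<longleftrightarrow> (\<forall>i\<in>I. \<forall>j\<in>I. \<forall>c\<in>C. sgn (f i - c * f j) = sgn (g i - c * g j))"

lemma simD: "sim C I f g \<Longrightarrow> i \<in> I \<Longrightarrow> j \<in> I \<Longrightarrow> c \<in> C \<Longrightarrow> sgn (f i - c * f j) = sgn (g i - c * g j)"
  unfolding sim_def by blast

lemma sim_mono: "sim C I f g \<Longrightarrow> C' \<subseteq> C \<Longrightarrow> J \<subseteq> I \<Longrightarrow> sim C' J f g"
  unfolding sim_def by blast

lemma sim_reindex: "sim C I f g \<Longrightarrow> h ` J \<subseteq> I \<Longrightarrow> sim C J (\<lambda>j. f (h j)) (\<lambda>j. g (h j))"
  unfolding sim_def by blast

lemma sim_sym: "sim C I f g \<Longrightarrow> sim C I g f"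
  unfolding sim_def by simp

lemma sgn_less_iff: "sgn (a - b :: rat) = sgn (c - d) \<Longrightarrow> (a < b \<longleftrightarrow> c < d) \<and> (a = b \<longleftrightarrow> c = d)"
  by (auto simp: sgn_if split: if_splits)

lemma sgn_scale_diff:
  fixes a b c d :: rat
  assumes "c \<noteq> 0" shows "sgn (c * a - d * b) = sgn c * sgn (a - (d / c) * b)"
proof -
  have "c * a - d * b = c * (a - (d / c) * b)" using assms by (simp add: right_diff_distrib)
  then show ?thesis by (simp add: sgn_mult)
qed

lemma sim_scaled:
  assumes s: "sim C I f g" and ij: "i \<in> I" "j \<in> I" and C: "0 \<in> C" "d / c \<in> C"
  shows "sgn (c * f i - d * f j) = sgn (c * g i - d * g j)"
proof (cases "c = 0")
  case True
  \<comment> \<open>For \<open>c = 0\<close> only the sign of the entry at \<open>j\<close> matters;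
    comparing that entry with 0 times itself reveals it.\<close>
  have "sgn (f j) = sgn (g j)" using simD[OF s ij(2,2) C(1)] by simp
  then show ?thesis using True by (simp add: sgn_mult)
next
  case False
  then show ?thesis using simD[OF s ij C(2)] by (simp add: sgn_scale_diff)
qed

text \<open>Density and absence of endpoints of the rationals, in the form for finite and possibly
  empty sets.\<close>

lemma ex_between:
  fixes X Y :: "rat set"
  assumes "finite X" "finite Y" "\<And>x y. x \<in> X \<Longrightarrow> y \<in> Y \<Longrightarrow> x < y"
  shows "\<exists>q. (\<forall>x\<in>X. x < q) \<and> (\<forall>y\<in>Y. q < y)"
proof (cases "X = {} \<or> Y = {}")
  case True
  have "x < Max (insert 0 X) + 1" if "x \<in> X" for x
  proof -
    have "x \<le> Max (insert 0 X)" using assms(1) that by (intro Max_ge) auto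
    then show ?thesis by linarith
  qed
  moreover have "Min (insert 0 Y) - 1 < y" if "y \<in> Y" for y
  proof -
    have "Min (insert 0 Y) \<le> y" using assms(2) that by (intro Min_le) auto
    then show ?thesis by linarith
  qed
  ultimately show ?thesis using True by blast
next
  case False
  then have "Max X < Min Y" using assms by simp
  then obtain q where "Max X < q" "q < Min Y" using dense by blast
  then show ?thesis using False assms by (intro exI[of _ q]) auto
qed

text \<open>The back-and-forth step for dense orders without endpoints: \<open>q\<close> either
  equals one of the finitely many marked points or lies in a gap between them, and the corresponding
  gap on the other side is nonempty.\<close>

lemma ex_same_position:
  fixes f f' :: "'t \<Rightarrow> rat"
  assumes T: "finite T" and ord: "\<And>s t. s \<in> T \<Longrightarrow> t \<in> T \<Longrightarrow> sgn (f s - f t) = sgn (f' s - f' t)"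
  shows "\<exists>q'. \<forall>t\<in>T. sgn (q' - f' t) = sgn (q - f t)"
proof (cases "\<exists>t\<in>T. q = f t")
  case True
  then obtain t0 where "t0 \<in> T" "q = f t0" by blast
  then show ?thesis using ord[of t0] by (intro exI[of _ "f' t0"]) simp
next
  case False
  have "x < y" if xy: "x \<in> f' ` {t\<in>T. f t < q}" "y \<in> f' ` {t\<in>T. q < f t}" for x y
  proof -
    obtain s t where "s \<in> T" "t \<in> T" "x = f' s" "y = f' t" "f s < f t" using xy by force
    then show ?thesis using sgn_less_iff[OF ord[of s t]] by simp
  qed
  moreover have "finite (f' ` {t\<in>T. f t < q})" "finite (f' ` {t\<in>T. q < f t})" using T by simp_all
  ultimately have "\<exists>q'. (\<forall>x\<in>f' ` {t\<in>T. f t < q}. x < q') \<and> (\<forall>y\<in>f' ` {t\<in>T. q < f t}. q' < y)"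
    by (intro ex_between)
  then obtain q' where q': "\<forall>x\<in>f' ` {t\<in>T. f t < q}. x < q'" "\<forall>y\<in>f' ` {t\<in>T. q < f t}. q' < y"
    by blast
  have "sgn (q' - f' t) = sgn (q - f t)" if "t \<in> T" for t
  proof (cases "f t < q")
    case True
    then have "f' t < q'" using q'(1) that by blast
    then show ?thesis using True by (simp add: sgn_if)
  next
    case F: False
    have "q \<noteq> f t" using False that by blast
    with F have "q < f t" by simp
    moreover from this have "q' < f' t" using q'(2) that by blast
    ultimately show ?thesis by (simp add: sgn_if)
  qed
  then show ?thesis by blast
qed

text \<open>One round of an Ehrenfeucht-Fraisse game.\<close>
lemma sim_extend:
  assumes C: "finite C" and I: "finite I" "z \<in> I" "x \<noteq> z"
    and C1: "C1 = insert 0 (insert 1 (C \<union> inverse ` C))" and C': "C' = (\<lambda>(c, d). d / c) ` (C1 \<times> C1)"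
    and s: "sim C' I f g"
  shows "\<exists>q'. sim C I (f(x := q)) (g(x := q'))"
proof -
  \<comment> \<open>The new value has to be placed among all multiples c * f j. Two such multiples
    compare like the entries with the factor d / c, whence the quotients in \<open>C'\<close>. The
    inverses in \<open>C1\<close> serve comparisons in which the new value stands on the
    right.\<close>
  define T where "T = C1 \<times> (I - {x})"
  have fin: "finite T" unfolding T_def C1 using C I by simp
  have in_C': "0 \<in> C'" "\<And>c d. c \<in> C1 \<Longrightarrow> d \<in> C1 \<Longrightarrow> d / c \<in> C'"
  proof -
    show *: "d / c \<in> C'" if "c \<in> C1" "d \<in> C1" for c d
      unfolding C' using that by (intro image_eqI[of _ _ "(c, d)"]) simp_all
    show "0 \<in> C'" using *[of 1 0] by (simp add: C1)
  qed
  have CC': "C \<subseteq> C'"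
  proof
    fix c assume "c \<in> C"
    then show "c \<in> C'" using in_C'(2)[of 1 c] by (simp add: C1)
  qed
  have "\<exists>q'. \<forall>t\<in>T. sgn (q' - (\<lambda>(c, j). c * g j) t) = sgn (q - (\<lambda>(c, j). c * f j) t)"
  proof (rule ex_same_position[OF fin])
    fix t u assume "t \<in> T" "u \<in> T"
    then obtain c i d j where "t = (c, i)" "u = (d, j)" "c \<in> C1" "d \<in> C1" "i \<in> I" "j \<in> I"
      unfolding T_def by blast
    then show "sgn ((\<lambda>(c, j). c * f j) t - (\<lambda>(c, j). c * f j) u) = sgn ((\<lambda>(c, j). c * g j) t - (\<lambda>(c, j). c * g j) u)"
      using sim_scaled[OF s _ _ in_C'(1), of i j d c] in_C'(2)[of c d] by simp
  qed
  then obtain q' where q': "\<And>c j. c \<in> C1 \<Longrightarrow> j \<in> I \<Longrightarrow> j \<noteq> x \<Longrightarrow> sgn (q' - c * g j) = sgn (q - c * f j)"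
    unfolding T_def by auto
  \<comment> \<open>Comparing the new value with a multiple of itself amounts to knowing its sign.
    The multiple of \<open>z\<close> by 0 supplies it.\<close>
  have q0: "sgn q' = sgn q" using q'[of 0 z] I by (simp add: C1)
  have "sgn ((f(x := q)) i - c * (f(x := q)) j) = sgn ((g(x := q')) i - c * (g(x := q')) j)"
    if "i \<in> I" "j \<in> I" "c \<in> C" for i j c
  proof -
    consider "i = x" "j = x" | "i = x" "j \<noteq> x" | "i \<noteq> x" "j = x" | "i \<noteq> x" "j \<noteq> x" by blast
    then show ?thesis
    proof cases
      case 1
      have "q - c * q = (1 - c) * q" "q' - c * q' = (1 - c) * q'" by (simp_all add: left_diff_distrib)
      then show ?thesis using 1 q0 by (simp add: sgn_mult)
    next
      case 2
      then show ?thesis using q'[of c j] that by (simp add: C1)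
    next
      case 3
      show ?thesis
      proof (cases "c = 0")
        case True
        then show ?thesis using 3 simD[OF s that(1,1) in_C'(1)] by simp
      next
        case False
        have e: "sgn (a - c * b) = sgn (- c) * sgn (b - inverse c * a)" for a b :: rat
        proof -
          have "a - c * b = (- c) * (b - inverse c * a)" using False by (simp add: algebra_simps)
          then show ?thesis by (simp only: sgn_mult)
        qed
        have "inverse c \<in> C1" using that by (simp add: C1)
        then show ?thesis using 3 q'[of "inverse c" i] that(1) by (simp add: e)
      qed
    next
      case 4
      then show ?thesis using simD[OF s that(1,2)] CC' that by auto
    qed
  qed
  then show ?thesis unfolding sim_def by blast
qed

text \<open>Coordinate 0 is the constant 1, so that comparisons with constants need no special case.\<close>
definition pt :: "(nat \<Rightarrow> rat) \<Rightarrow> nat \<Rightarrow> rat" where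
  "pt \<rho> i = (case i of 0 \<Rightarrow> 1 | Suc j \<Rightarrow> \<rho> j)"

lemma pt_simps [simp]: "pt \<rho> 0 = 1" "pt \<rho> (Suc j) = \<rho> j"
  by (simp_all add: pt_def)

lemma pt_upd: "pt (\<rho>(x := q)) = (pt \<rho>)(Suc x := q)"
  by (auto simp: pt_def fun_eq_iff split: nat.splits)

text \<open>A semantic counterpart of quantifier-free definability. The indices up to
  \<open>N\<close> of \<open>pt\<close> are the constant 1 and the variables below
  \<open>N\<close>.\<close>

definition fin_det :: "nat \<Rightarrow> ((nat \<Rightarrow> rat) \<Rightarrow> bool) \<Rightarrow> bool" where
  "fin_det N P \<longleftrightarrow> (\<exists>C. finite C \<and> (\<forall>\<rho> \<rho>'. sim C {..N} (pt \<rho>) (pt \<rho>') \<longrightarrow> P \<rho> = P \<rho>'))"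

lemma fin_detI: "finite C \<Longrightarrow> (\<And>\<rho> \<rho>'. sim C {..N} (pt \<rho>) (pt \<rho>') \<Longrightarrow> P \<rho> = P \<rho>') \<Longrightarrow> fin_det N P"
  unfolding fin_det_def by blast

lemma fin_det_not: "fin_det N P \<Longrightarrow> fin_det N (\<lambda>\<rho>. \<not> P \<rho>)"
  unfolding fin_det_def by blast

lemma fin_det_conj:
  assumes "fin_det N P" "fin_det N Q" shows "fin_det N (\<lambda>\<rho>. P \<rho> \<and> Q \<rho>)"
proof -
  obtain C D where "finite C" "finite D"
    "\<And>\<rho> \<rho>'. sim C {..N} (pt \<rho>) (pt \<rho>') \<Longrightarrow> P \<rho> = P \<rho>'" "\<And>\<rho> \<rho>'. sim D {..N} (pt \<rho>) (pt \<rho>') \<Longrightarrow> Q \<rho> = Q \<rho>'"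
    using assms unfolding fin_det_def by blast
  then show ?thesis
    by (intro fin_detI[of "C \<union> D"]) (auto dest: sim_mono)
qed

lemma fin_det_ball:
  assumes "finite A" "\<And>a. a \<in> A \<Longrightarrow> fin_det N (P a)" shows "fin_det N (\<lambda>\<rho>. \<forall>a\<in>A. P a \<rho>)"
  using assms
proof (induction A rule: finite_induct)
  case empty
  show ?case by (rule fin_detI[of "{}"]) auto
next
  case (insert a A)
  then show ?case using fin_det_conj[of N "P a" "\<lambda>\<rho>. \<forall>a\<in>A. P a \<rho>"] by simp
qed

text \<open>This replaces quantifier elimination: on points that agree with respect to a finer,
  still finite set of factors, every witness on one side is answered by a witness on the other, with
  agreement for the original set.\<close>

lemma fin_det_ex:
  assumes "fin_det N P" "x < N" shows "fin_det N (\<lambda>\<rho>. \<exists>q. P (\<rho>(x := q)))"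
proof -
  obtain C where C: "finite C" "\<And>\<rho> \<rho>'. sim C {..N} (pt \<rho>) (pt \<rho>') \<Longrightarrow> P \<rho> = P \<rho>'"
    using assms unfolding fin_det_def by blast
  define C1 where "C1 = insert 0 (insert 1 (C \<union> inverse ` C))"
  define C' where "C' = (\<lambda>(c, d). d / c) ` (C1 \<times> C1)"
  have imp: "\<exists>q'. P (\<rho>'(x := q'))" if h: "sim C' {..N} (pt \<rho>) (pt \<rho>')" "P (\<rho>(x := q))" for \<rho> \<rho>' q
  proof -
    obtain q' where "sim C {..N} ((pt \<rho>)(Suc x := q)) ((pt \<rho>')(Suc x := q'))"
      using sim_extend[OF C(1) _ _ _ C1_def C'_def h(1), of 0 "Suc x" q] by auto
    then show ?thesis using C(2) h(2) unfolding pt_upd[symmetric] by blast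
  qed
  show ?thesis
  proof (rule fin_detI)
    show "finite C'" unfolding C'_def C1_def using C(1) by simp
  qed (use imp sim_sym in blast)
qed

lemma fin_det_ex_set:
  assumes "finite X" "fin_det N P" "X \<subseteq> {..<N}"
  shows "fin_det N (\<lambda>\<rho>. \<exists>f. P (\<lambda>i. if i \<in> X then f i else \<rho> i))"
  using assms
proof (induction X arbitrary: P rule: finite_induct)
  case empty
  then show ?case by simp
next
  case (insert x X)
  have "fin_det N (\<lambda>\<rho>. \<exists>f. \<exists>q. P ((\<lambda>i. if i \<in> X then f i else \<rho> i)(x := q)))"
    using insert by (intro insert.IH fin_det_ex) auto
  moreover have "(\<exists>f. \<exists>q. P ((\<lambda>i. if i \<in> X then f i else \<rho> i)(x := q)))
    \<longleftrightarrow> (\<exists>f. P (\<lambda>i. if i \<in> insert x X then f i else \<rho> i))" for \<rho>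
  proof
    assume "\<exists>f. \<exists>q. P ((\<lambda>i. if i \<in> X then f i else \<rho> i)(x := q))"
    then obtain f q where "P ((\<lambda>i. if i \<in> X then f i else \<rho> i)(x := q))" by blast
    moreover have "(\<lambda>i. if i \<in> X then f i else \<rho> i)(x := q) = (\<lambda>i. if i \<in> insert x X then (f(x := q)) i else \<rho> i)"
      using insert.hyps by auto
    ultimately show "\<exists>f. P (\<lambda>i. if i \<in> insert x X then f i else \<rho> i)" by metis
  next
    assume "\<exists>f. P (\<lambda>i. if i \<in> insert x X then f i else \<rho> i)"
    then obtain f where "P (\<lambda>i. if i \<in> insert x X then f i else \<rho> i)" by blast
    moreover have "(\<lambda>i. if i \<in> insert x X then f i else \<rho> i) = (\<lambda>i. if i \<in> X then f i else \<rho> i)(x := f x)"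
      by auto
    ultimately show "\<exists>f. \<exists>q. P ((\<lambda>i. if i \<in> X then f i else \<rho> i)(x := q))" by metis
  qed
  ultimately show ?case by simp
qed

lemma fin_det_rename:
  assumes "fin_det N P" "\<And>i. i < N \<Longrightarrow> h i < M"
  shows "fin_det M (\<lambda>\<rho>. P (\<lambda>i. \<rho> (h i)))"
proof -
  obtain C where C: "finite C" "\<And>\<rho> \<rho>'. sim C {..N} (pt \<rho>) (pt \<rho>') \<Longrightarrow> P \<rho> = P \<rho>'"
    using assms unfolding fin_det_def by blast
  show ?thesis
  proof (rule fin_detI[OF C(1)])
    fix \<rho> \<rho>' assume s: "sim C {..M} (pt \<rho>) (pt \<rho>')"
    let ?h = "\<lambda>i. case i of 0 \<Rightarrow> 0 | Suc j \<Rightarrow> Suc (h j)"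
    have "?h ` {..N} \<subseteq> {..M}" using assms(2) by (auto split: nat.splits simp: Suc_le_eq)
    from sim_reindex[OF s this] have "sim C {..N} (\<lambda>j. pt \<rho> (?h j)) (\<lambda>j. pt \<rho>' (?h j))" .
    moreover have "pt \<rho> (?h j) = pt (\<lambda>i. \<rho> (h i)) j" for \<rho> j by (cases j) auto
    ultimately show "P (\<lambda>i. \<rho> (h i)) = P (\<lambda>i. \<rho>' (h i))" by (intro C(2)) simp
  qed
qed

lemma fin_det_less:
  assumes "i \<le> N" "j \<le> N" shows "fin_det N (\<lambda>\<rho>. c * pt \<rho> i < d * pt \<rho> j)"
proof (rule fin_detI[of "{0, d / c}"])
  fix \<rho> \<rho>' assume "sim {0, d / c} {..N} (pt \<rho>) (pt \<rho>')"
  then have "sgn (c * pt \<rho> i - d * pt \<rho> j) = sgn (c * pt \<rho>' i - d * pt \<rho>' j)"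
    by (rule sim_scaled) (use assms in simp_all)
  from sgn_less_iff[OF this] show "(c * pt \<rho> i < d * pt \<rho> j) = (c * pt \<rho>' i < d * pt \<rho>' j)"
    by blast
qed simp

lemma fin_det_eq:
  assumes "i \<le> N" "j \<le> N" shows "fin_det N (\<lambda>\<rho>. c * pt \<rho> i = d * pt \<rho> j)"
proof (rule fin_detI[of "{0, d / c}"])
  fix \<rho> \<rho>' assume "sim {0, d / c} {..N} (pt \<rho>) (pt \<rho>')"
  then have "sgn (c * pt \<rho> i - d * pt \<rho> j) = sgn (c * pt \<rho>' i - d * pt \<rho>' j)"
    by (rule sim_scaled) (use assms in simp_all)
  from sgn_less_iff[OF this] show "(c * pt \<rho> i = d * pt \<rho> j) = (c * pt \<rho>' i = d * pt \<rho>' j)"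
    by blast
qed simp

text \<open>A term has a single leaf, since all function symbols are unary; this is the index of
  that leaf in \<open>pt\<close>.\<close>

primrec term_bound :: "lterm \<Rightarrow> nat" where
  "term_bound (LVar i) = Suc i"
| "term_bound LOne = 0"
| "term_bound (LScale c t) = term_bound t"

primrec form_bound :: "lform \<Rightarrow> nat" where
  "form_bound (LLess s t) = max (term_bound s) (term_bound t)"
| "form_bound (LEq s t) = max (term_bound s) (term_bound t)"
| "form_bound (LNot \<phi>) = form_bound \<phi>"
| "form_bound (LAnd \<phi> \<psi>) = max (form_bound \<phi>) (form_bound \<psi>)"
| "form_bound (LEx x \<phi>) = max (Suc x) (form_bound \<phi>)"

lemma leval_monomial: "\<exists>c. \<forall>\<rho>. leval t \<rho> = c * pt \<rho> (term_bound t)"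
proof (induction t)
  case (LVar i)
  show ?case by (intro exI[of _ 1]) simp
next
  case LOne
  show ?case by (intro exI[of _ 1]) simp
next
  case (LScale c t)
  then obtain d where "\<forall>\<rho>. leval t \<rho> = d * pt \<rho> (term_bound t)" by blast
  then show ?case by (intro exI[of _ "c * d"]) simp
qed

lemma fin_det_lsat: "form_bound \<phi> \<le> N \<Longrightarrow> fin_det N (lsat \<phi>)"
proof (induction \<phi>)
  case (LLess s t)
  obtain c d where "\<forall>\<rho>. leval s \<rho> = c * pt \<rho> (term_bound s)" "\<forall>\<rho>. leval t \<rho> = d * pt \<rho> (term_bound t)"
    using leval_monomial by metis
  then show ?case using fin_det_less[of "term_bound s" N "term_bound t" c d] LLess by simp
next
  case (LEq s t)
  obtain c d where "\<forall>\<rho>. leval s \<rho> = c * pt \<rho> (term_bound s)" "\<forall>\<rho>. leval t \<rho> = d * pt \<rho> (term_bound t)"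
    using leval_monomial by metis
  then show ?case using fin_det_eq[of "term_bound s" N "term_bound t" c d] LEq by simp
next
  case (LNot \<phi>)
  then show ?case using fin_det_not[of N "lsat \<phi>"] by (simp add: fin_det_def)
next
  case (LAnd \<phi> \<psi>)
  then show ?case using fin_det_conj[of N "lsat \<phi>" "lsat \<psi>"] by (simp add: fin_det_def)
next
  case (LEx x \<phi>)
  then show ?case using fin_det_ex[of N "lsat \<phi>" x] by (simp add: fin_det_def)
qed

definition point_list :: "nat \<Rightarrow> (nat \<Rightarrow> rat) \<Rightarrow> rat list" where
  "point_list k \<rho> = map \<rho> [0..<k]"

lemma point_list_simps [simp]: "length (point_list k \<rho>) = k" "i < k \<Longrightarrow> point_list k \<rho> ! i = \<rho> i"
  by (simp_all add: point_list_def)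

lemma point_list_cong: "(\<And>i. i < k \<Longrightarrow> f i = g i) \<Longrightarrow> point_list k f = point_list k g"
  by (simp add: point_list_def)

text \<open>The irrelevant coordinates are set to 1, the value of coordinate 0, so that comparisons
  with them are comparisons with the constant.\<close>
lemma fin_det_restrict:
  assumes "fin_det M Q" and loc: "\<And>\<rho> \<rho>'. (\<And>i. i < k \<Longrightarrow> \<rho> i = \<rho>' i) \<Longrightarrow> Q \<rho> = Q \<rho>'"
  shows "fin_det k Q"
proof -
  obtain C where C: "finite C" "\<And>\<rho> \<rho>'. sim C {..M} (pt \<rho>) (pt \<rho>') \<Longrightarrow> Q \<rho> = Q \<rho>'"
    using assms(1) unfolding fin_det_def by blast
  show ?thesis
  proof (rule fin_detI[OF C(1)])
    fix \<rho> \<rho>' assume s: "sim C {..k} (pt \<rho>) (pt \<rho>')"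
    let ?e = "\<lambda>\<rho> i. if i < k then \<rho> i else (1::rat)"
    let ?h = "\<lambda>i. if i \<le> k then i else 0"
    have "sim C {..M} (\<lambda>j. pt \<rho> (?h j)) (\<lambda>j. pt \<rho>' (?h j))"
      by (rule sim_reindex[OF s]) auto
    moreover have "pt \<rho> (?h j) = pt (?e \<rho>) j" for \<rho> j by (cases j) auto
    ultimately have "Q (?e \<rho>) = Q (?e \<rho>')" by (intro C(2)) simp
    moreover have "Q (?e \<rho>) = Q \<rho>" for \<rho> by (rule loc) simp
    ultimately show "Q \<rho> = Q \<rho>'" by simp
  qed
qed

text \<open>The defining formula may mention variables other than the first \<open>k\<close>, but
  its truth depends on these alone. Hence the detour through \<open>form_bound\<close> and the
  restriction afterwards.\<close>

lemma L_definable_fin_det: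
  assumes "L_definable k R" shows "fin_det k (\<lambda>\<rho>. point_list k \<rho> \<in> R)"
proof -
  obtain \<phi> where \<phi>: "\<And>xs \<rho>. length xs = k \<Longrightarrow> (\<And>i. i < k \<Longrightarrow> \<rho> i = xs ! i) \<Longrightarrow> lsat \<phi> \<rho> \<longleftrightarrow> xs \<in> R"
    using assms unfolding L_definable_def by blast
  have e: "lsat \<phi> \<rho> \<longleftrightarrow> point_list k \<rho> \<in> R" for \<rho>
    by (rule \<phi>) simp_all
  have "fin_det (form_bound \<phi>) (lsat \<phi>)" by (rule fin_det_lsat) simp
  then show ?thesis unfolding e by (rule fin_det_restrict) (metis point_list_cong)
qed

text \<open>If the current upper bound us of a solution is attained at every coordinate, then the maximum
  of the witnesses is us, so us lies in R when R is preserved by max; if it is not attained at p,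
  then the bound at p can be lowered.\<close>
definition attained :: "nat \<Rightarrow> rat list set \<Rightarrow> nat \<Rightarrow> rat list set" where
  "attained k R p = {us. \<exists>xs\<in>R. length xs = k \<and> (\<forall>i<k. xs ! i \<le> us ! i) \<and> xs ! p = us ! p}"

text \<open>The witness tuple is placed in the coordinates from \<open>k\<close> to
  \<open>2 * k - 1\<close> and then quantified away, so the property is again determined by finitely
  many comparisons.\<close>

lemma fin_det_attained:
  assumes R: "fin_det k (\<lambda>\<rho>. point_list k \<rho> \<in> R)" and p: "p < k"
  shows "fin_det k (\<lambda>\<rho>. point_list k \<rho> \<in> attained k R p)"
proof -
  define P where "P = (\<lambda>\<rho>. point_list k (\<lambda>i. \<rho> (i + k)) \<in> R \<and>
    (\<forall>i\<in>{..<k}. \<not> 1 * pt \<rho> (Suc i) < 1 * pt \<rho> (Suc (i + k))) \<and> 1 * pt \<rho> (Suc (p + k)) = 1 * pt \<rho> (Suc p))"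
  have "fin_det (2 * k) (\<lambda>\<rho>. point_list k (\<lambda>i. \<rho> (i + k)) \<in> R)"
    by (rule fin_det_rename[OF R]) simp
  moreover have "fin_det (2 * k) (\<lambda>\<rho>. \<forall>i\<in>{..<k}. \<not> 1 * pt \<rho> (Suc i) < 1 * pt \<rho> (Suc (i + k)))"
    by (rule fin_det_ball, simp, rule fin_det_not, rule fin_det_less) auto
  moreover have "fin_det (2 * k) (\<lambda>\<rho>. 1 * pt \<rho> (Suc (p + k)) = 1 * pt \<rho> (Suc p))"
    by (rule fin_det_eq) (use p in auto)
  ultimately have P: "fin_det (2 * k) P" unfolding P_def by (intro fin_det_conj)
  define mg where "mg = (\<lambda>f \<rho> i. if i \<in> {k..<2 * k} then f i else \<rho> i :: rat)"
  have "fin_det (2 * k) (\<lambda>\<rho>. \<exists>f. P (mg f \<rho>))"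
    unfolding mg_def by (rule fin_det_ex_set[OF _ P]) auto
  moreover have "(\<exists>f. P (mg f \<rho>)) \<longleftrightarrow> point_list k \<rho> \<in> attained k R p" for \<rho>
  proof -
    have lo: "mg f \<rho> i = \<rho> i" if "i < k" for f i using that by (simp add: mg_def)
    have hi: "mg f \<rho> (i + k) = f (i + k)" if "i < k" for f i using that by (simp add: mg_def)
    have Pmg: "P (mg f \<rho>) \<longleftrightarrow> point_list k (\<lambda>i. f (i + k)) \<in> R \<and> (\<forall>i<k. f (i + k) \<le> \<rho> i) \<and> f (p + k) = \<rho> p" for f
    proof -
      have "point_list k (\<lambda>i. mg f \<rho> (i + k)) = point_list k (\<lambda>i. f (i + k))"
        by (rule point_list_cong) (rule hi)
      then show ?thesis unfolding P_def using lo hi p by (auto simp: not_less)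
    qed
    show ?thesis
    proof
      assume "\<exists>f. P (mg f \<rho>)"
      then obtain f where "point_list k (\<lambda>i. f (i + k)) \<in> R" "\<forall>i<k. f (i + k) \<le> \<rho> i" "f (p + k) = \<rho> p"
        unfolding Pmg by blast
      then show "point_list k \<rho> \<in> attained k R p" using p unfolding attained_def
        by (intro CollectI bexI[of _ "point_list k (\<lambda>i. f (i + k))"]) simp_all
    next
      assume "point_list k \<rho> \<in> attained k R p"
      then obtain xs where xs: "xs \<in> R" "length xs = k" "\<And>i. i < k \<Longrightarrow> xs ! i \<le> \<rho> i" "xs ! p = \<rho> p"
        using p unfolding attained_def by auto
      have "point_list k (\<lambda>i. xs ! (i + k - k)) = xs" using xs(2) by (intro nth_equalityI) simp_all
      then show "\<exists>f. P (mg f \<rho>)" unfolding Pmg using xs by (intro exI[of _ "\<lambda>i. xs ! (i - k)"]) simp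
    qed
  qed
  ultimately have "fin_det (2 * k) (\<lambda>\<rho>. point_list k \<rho> \<in> attained k R p)" by simp
  then show ?thesis by (rule fin_det_restrict) (metis point_list_cong)
qed

section \<open>Sampling\<close>

definition small_fraction :: "nat \<Rightarrow> rat \<Rightarrow> bool" where
  "small_fraction K c \<longleftrightarrow> (\<exists>p q. 0 < p \<and> p \<le> K \<and> 0 < q \<and> q \<le> K \<and> c = of_nat p / of_nat q)"

lemma small_fraction_mono: "small_fraction K c \<Longrightarrow> K \<le> L \<Longrightarrow> small_fraction L c"
  unfolding small_fraction_def using le_trans by blast

lemma small_fraction_pos: "small_fraction K c \<Longrightarrow> 0 < c"
  unfolding small_fraction_def by auto

lemma small_fraction_mult:
  assumes "small_fraction K c" "small_fraction L d" shows "small_fraction (K * L) (c * d)"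
proof -
  obtain p q r s where "0 < p" "p \<le> K" "0 < q" "q \<le> K" "c = of_nat p / of_nat q"
    "0 < r" "r \<le> L" "0 < s" "s \<le> L" "d = of_nat r / of_nat s"
    using assms unfolding small_fraction_def by blast
  then show ?thesis unfolding small_fraction_def
    by (intro exI[of _ "p * r"] exI[of _ "q * s"]) (simp add: mult_le_mono)
qed

lemma small_fraction_prod_list:
  assumes "\<And>c. c \<in> set cs \<Longrightarrow> small_fraction K c" shows "small_fraction (K ^ length cs) (prod_list cs)"
  using assms
proof (induction cs)
  case Nil
  then show ?case unfolding small_fraction_def by (intro exI[of _ 1]) simp
next
  case (Cons c cs)
  then show ?case using small_fraction_mult[of K c] by simp
qed

lemma small_fraction_ge: "small_fraction K c \<Longrightarrow> 1 / of_nat K \<le> c"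
  unfolding small_fraction_def
proof (elim exE conjE)
  fix p q assume "0 < p" "p \<le> K" "0 < q" "q \<le> K" "c = of_nat p / of_nat q"
  then have "1 / of_nat K \<le> (1::rat) / of_nat q" "(1::rat) / of_nat q \<le> of_nat p / of_nat q"
    by (auto intro!: divide_left_mono divide_right_mono)
  then show "1 / of_nat K \<le> c" using \<open>c = _\<close> by linarith
qed

text \<open>For p / q > 1 with integers p and q, p is at least q + 1, which leaves a gap of 1 / q
  above 1.\<close>

lemma small_fraction_gap:
  assumes "small_fraction K c" "1 < c" shows "1 + 1 / of_nat K \<le> c"
proof -
  obtain p q where pq: "0 < p" "p \<le> K" "0 < q" "q \<le> K" "c = of_nat p / of_nat q"
    using assms unfolding small_fraction_def by blast
  then have "q + 1 \<le> p" using assms(2) by (simp add: less_divide_eq)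
  then have "(of_nat (q + 1) :: rat) / of_nat q \<le> of_nat p / of_nat q"
    by (intro divide_right_mono of_nat_mono) simp_all
  moreover have "(of_nat (q + 1) :: rat) / of_nat q = 1 + 1 / of_nat q"
    using pq by (simp add: add_divide_distrib)
  moreover have "1 / of_nat K \<le> (1::rat) / of_nat q" using pq by (intro divide_left_mono) auto
  ultimately show ?thesis using pq by linarith
qed

lemma ex_small_fraction_bound:
  assumes "finite C" "\<And>c. c \<in> C \<Longrightarrow> 0 < c"
  shows "\<exists>K\<ge>1. \<forall>c\<in>C. small_fraction K c"
  using assms
proof (induction C rule: finite_induct)
  case (insert c C)
  then obtain K where K: "K \<ge> 1" "\<forall>c\<in>C. small_fraction K c" by auto
  obtain a b where ab: "quotient_of c = (a, b)" by fastforce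
  have b: "b > 0" using quotient_of_denom_pos[OF ab] .
  have c: "c = of_int a / of_int b" using quotient_of_div[OF ab] .
  have a: "a > 0" using b c insert.prems[of c] by (simp add: zero_less_divide_iff)
  have "c = of_nat (nat a) / of_nat (nat b)" using a b c by simp
  then have "small_fraction (max (nat a) (nat b)) c" unfolding small_fraction_def
    using a b by (intro exI[of _ "nat a"] exI[of _ "nat b"]) auto
  then have "\<forall>d\<in>insert c C. small_fraction (max K (max (nat a) (nat b))) d"
    using K(2) by (auto intro: small_fraction_mono)
  then show ?case using K(1) by (intro exI[of _ "max K (max (nat a) (nat b))"]) auto
qed (auto intro: exI[of _ 1])

text \<open>The generous base 4 absorbs the mixed terms of the product in the induction step. It is
  the origin of the factor 4 in the choice of \<open>B\<close>.\<close>

lemma one_plus_power_le: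
  fixes b :: rat assumes "b \<ge> 1" shows "(1 + 1 / b) ^ n \<le> 1 + 4 ^ n / b"
proof (induction n)
  case (Suc n)
  have "(1 + 1 / b) ^ Suc n \<le> (1 + 1 / b) * (1 + 4 ^ n / b)"
    using Suc assms by (simp add: mult_left_mono)
  also have "\<dots> = 1 + (1 + 4 ^ n) / b + 4 ^ n / b / b"
    by (simp add: algebra_simps add_divide_distrib)
  also have "4 ^ n / b / b \<le> 4 ^ n / b"
    using assms by (simp add: divide_le_eq mult_le_cancel_left1)
  also have "1 + (1 + 4 ^ n) / b + 4 ^ n / b = 1 + (1 + 2 * 4 ^ n) / b"
    by (simp add: add_divide_distrib)
  also have "\<dots> \<le> 1 + 4 ^ Suc n / b"
  proof -
    have "(1::rat) \<le> 4 ^ n" by simp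
    then have "1 + 2 * 4 ^ n \<le> (4::rat) ^ Suc n" unfolding power_Suc by linarith
    then show ?thesis using assms by (intro add_left_mono divide_right_mono) auto
  qed
  finally show ?case by simp
qed (use assms in simp)

text \<open>The possible weights of simple paths: \<open>s\<close> is the value at the starting
  node, \<open>cs\<close> are the constants on the edges, and \<open>m\<close> is the number of
  strict edges.\<close>

definition samples :: "rat set \<Rightarrow> nat \<Rightarrow> rat \<Rightarrow> rat set" where
  "samples C N B = {s * prod_list cs / (1 + 1 / B) ^ m | s cs m.
     s \<in> {1, B} \<and> set cs \<subseteq> C \<and> length cs \<le> N \<and> m \<le> N}"

lemma finite_samples:
  assumes "finite C" shows "finite (samples C N B)"
proof -
  have "samples C N B \<subseteq> (\<lambda>(s, cs, m). s * prod_list cs / (1 + 1 / B) ^ m) `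
    ({1, B} \<times> {cs. set cs \<subseteq> C \<and> length cs \<le> N} \<times> {..N})"
  proof
    fix x assume "x \<in> samples C N B"
    then obtain s cs m where "x = s * prod_list cs / (1 + 1 / B) ^ m" "s \<in> {1, B}" "set cs \<subseteq> C"
      "length cs \<le> N" "m \<le> N" unfolding samples_def by blast
    then show "x \<in> (\<lambda>(s, cs, m). s * prod_list cs / (1 + 1 / B) ^ m) `
      ({1, B} \<times> {cs. set cs \<subseteq> C \<and> length cs \<le> N} \<times> {..N})"
      by (intro image_eqI[of _ _ "(s, cs, m)"]) simp_all
  qed
  moreover have "finite ((\<lambda>(s, cs, m). s * prod_list cs / (1 + 1 / B) ^ m) `
      ({1, B} \<times> {cs. set cs \<subseteq> C \<and> length cs \<le> N} \<times> {..N}))"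
    by (intro finite_imageI finite_cartesian_product finite_lists_length_le assms) simp_all
  ultimately show ?thesis by (rule finite_subset)
qed

text \<open>A Bellman-Ford argument, written multiplicatively: the relations v i \<le> c * v j are
  the edges of a graph, an edge with a strict relation gets the weight c diminished by the
  factor 1 + 1 / B, and the new values are the weights of shortest paths. Since B is huge,
  diminishing does not create cycles of weight below 1. Paths may start at any node, with value
  B at the nodes other than z, where B exceeds every bound that the relations can impose.\<close>
locale difference_system =
  fixes I :: "'i set" and z :: 'i and v :: "'i \<Rightarrow> rat" and C :: "rat set" and N K :: nat and B \<eta> :: rat
  assumes I: "finite I" "card I \<le> N" "z \<in> I" and v: "v z = 1" "\<And>i. i \<in> I \<Longrightarrow> 0 < v i"
    and C: "finite C" "\<And>c. c \<in> C \<Longrightarrow> small_fraction K c" "\<And>c. c \<in> C \<Longrightarrow> inverse c \<in> C" and K: "1 \<le> K"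
    and B: "B = (4 * of_nat K) ^ N" and \<eta>: "\<eta> = 1 + 1 / B"
begin

lemma N_pos: "1 \<le> N"
proof -
  have "card I \<noteq> 0" using I by auto
  then show ?thesis using I(2) by linarith
qed

lemma B_ge: "1 \<le> B" unfolding B using K by (intro one_le_power) simp

lemma eta: "1 < \<eta>" using B_ge unfolding \<eta> by simp

lemma C_pos: "c \<in> C \<Longrightarrow> 0 < c" using C(2) small_fraction_pos by blast

text \<open>With B = (4 * K)^N the error 4^N / B of the power estimate becomes 1 / K^N, exactly the
  gap above 1 of fractions bounded by K^N.\<close>

lemma eta_power:
  assumes "m \<le> N" shows "\<eta> ^ m \<le> 1 + 1 / of_nat K ^ N"
proof -
  have "\<eta> ^ m \<le> \<eta> ^ N" using eta assms by (intro power_increasing) auto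
  also have "\<dots> \<le> 1 + 4 ^ N / B" unfolding \<eta> by (rule one_plus_power_le[OF B_ge])
  also have "4 ^ N / B = 1 / of_nat K ^ N" unfolding B by (simp add: power_mult_distrib)
  finally show ?thesis .
qed

lemma prod_small:
  assumes "set cs \<subseteq> C" "length cs \<le> N" shows "small_fraction (K ^ N) (prod_list cs)"
proof (rule small_fraction_mono)
  show "small_fraction (K ^ length cs) (prod_list cs)"
    using assms C(2) by (intro small_fraction_prod_list) auto
qed (use assms K in \<open>auto intro: power_increasing\<close>)

text \<open>Meant for cycles: a cycle with a strict edge has a product above 1, hence above it by
  the gap, and the at most N diminishing factors cannot consume the gap.\<close>

lemma diminished_ge_1:
  assumes "set cs \<subseteq> C" "length cs \<le> N" "m \<le> N" "1 \<le> prod_list cs" "m > 0 \<longrightarrow> 1 < prod_list cs"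
  shows "1 \<le> prod_list cs / \<eta> ^ m"
proof (cases "m = 0")
  case False
  then have "\<eta> ^ m \<le> prod_list cs"
    using eta_power[OF assms(3)] small_fraction_gap[OF prod_small[OF assms(1,2)]] assms(5) by simp
  then show ?thesis using eta by simp
qed (use assms in simp)

definition wt :: "'i \<Rightarrow> rat \<Rightarrow> 'i \<Rightarrow> rat" where
  "wt i c j = (if v i = c * v j then c else c / \<eta>)"

text \<open>Paths are read backwards: \<open>i\<close> is the end node and the last element of
  \<open>i # p\<close> is the node where the path starts.\<close>

inductive path :: "'i \<Rightarrow> 'i list \<Rightarrow> rat \<Rightarrow> bool" where
  start: "i \<in> I \<Longrightarrow> path i [] (if i = z then 1 else B)"
| step: "path j p x \<Longrightarrow> i \<in> I \<Longrightarrow> c \<in> C \<Longrightarrow> v i \<le> c * v j \<Longrightarrow> path i (j # p) (x * wt i c j)"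

lemma path_nodes: "path i p x \<Longrightarrow> insert i (set p) \<subseteq> I"
  by (induction rule: path.induct) auto

lemma path_length:
  assumes "path i p x" "distinct (i # p)" shows "length p < N"
proof -
  have "length (i # p) = card (set (i # p))" using distinct_card[OF assms(2)] by simp
  also have "\<dots> \<le> card I" using path_nodes[OF assms(1)] I(1) by (intro card_mono) auto
  finally show ?thesis using I(2) by simp
qed

lemma path_value:
  "path i p x \<Longrightarrow> \<exists>cs m. set cs \<subseteq> C \<and> length cs = length p \<and> m \<le> length p \<and>
    x = (if last (i # p) = z then 1 else B) * prod_list cs / \<eta> ^ m"
proof (induction rule: path.induct)
  case (start i)
  show ?case by (intro exI[of _ "[]"] exI[of _ 0]) simp
next
  case (step j p x i c)
  then obtain cs m where "set cs \<subseteq> C" "length cs = length p" "m \<le> length p"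
    "x = (if last (j # p) = z then 1 else B) * prod_list cs / \<eta> ^ m" by blast
  then show ?case using step.hyps(3) unfolding wt_def
    by (intro exI[of _ "c # cs"] exI[of _ "if v i = c * v j then m else Suc m"]) auto
qed

text \<open>Cuts a path to \<open>j\<close> at a node \<open>i\<close> visited before. Multiplying
  the relations on the part from \<open>i\<close> to \<open>j\<close> bounds \<open>v j\<close> by a
  multiple of \<open>v i\<close>, strictly if the part has a strict edge. An edge from
  \<open>j\<close> back to \<open>i\<close> then yields a condition on the product of the resulting
  cycle.\<close>

lemma path_suffix:
  "path j p x \<Longrightarrow> distinct (j # p) \<Longrightarrow> i \<in> set (j # p) \<Longrightarrow>
    \<exists>q y cs m. path i q y \<and> distinct (i # q) \<and> set cs \<subseteq> C \<and> length p = length q + length cs \<and>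
      m \<le> length cs \<and> x = y * prod_list cs / \<eta> ^ m \<and> v j \<le> prod_list cs * v i \<and>
      (m > 0 \<longrightarrow> v j < prod_list cs * v i)"
proof (induction rule: path.induct)
  case (start j)
  then have "i = j" by simp
  then show ?case using path.start[OF start.hyps]
    by (intro exI[of _ "[]"] exI[of _ "if j = z then 1 else B"] exI[of _ 0]) simp
next
  case (step j p x k c)
  show ?case
  proof (cases "i = k")
    case True
    show ?thesis using path.step[OF step.hyps] step.prems True
      by (intro exI[of _ "j # p"] exI[of _ "x * wt k c j"] exI[of _ "[]"] exI[of _ 0]) simp
  next
    case False
    then have "i \<in> set (j # p)" "distinct (j # p)" using step.prems by auto
    then obtain q y cs m where h: "path i q y" "distinct (i # q)" "set cs \<subseteq> C" "length p = length q + length cs"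
      "m \<le> length cs" "x = y * prod_list cs / \<eta> ^ m" "v j \<le> prod_list cs * v i"
      "m > 0 \<longrightarrow> v j < prod_list cs * v i" using step.IH by blast
    have c: "0 < c" by (rule C_pos[OF step.hyps(3)])
    have le: "c * v j \<le> c * (prod_list cs * v i)" using c h(7) by (intro mult_left_mono) auto
    have lt: "m > 0 \<longrightarrow> c * v j < c * (prod_list cs * v i)" using c h(8) by simp
    show ?thesis
      using h step.hyps(3,4) le lt
      by (intro exI[of _ q] exI[of _ y] exI[of _ "c # cs"] exI[of _ "if v k = c * v j then m else Suc m"])
        (auto simp: wt_def mult.assoc)
  qed
qed

definition vals :: "'i \<Rightarrow> rat set" where
  "vals i = {x. \<exists>p. path i p x \<and> distinct (i # p)}"

lemma vals_samples: "vals i \<subseteq> samples C N B"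
proof
  fix x assume "x \<in> vals i"
  then obtain p where p: "path i p x" "distinct (i # p)" unfolding vals_def by blast
  obtain cs m where "set cs \<subseteq> C" "length cs = length p" "m \<le> length p"
    "x = (if last (i # p) = z then 1 else B) * prod_list cs / \<eta> ^ m" using path_value[OF p(1)] by blast
  moreover have "length p \<le> N" using path_length[OF p] by simp
  ultimately show "x \<in> samples C N B" unfolding samples_def \<eta>
    by (intro CollectI exI[of _ "if last (i # p) = z then 1 else B"] exI[of _ cs] exI[of _ m]) simp
qed

lemma vals_finite: "finite (vals i)"
  using vals_samples finite_samples[OF C(1)] finite_subset by blast

lemma vals_nonempty:
  assumes "i \<in> I" shows "vals i \<noteq> {}"
proof -
  have "(if i = z then 1 else B) \<in> vals i"
    unfolding vals_def using path.start[OF assms] by (intro CollectI exI[of _ "[]"]) simp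
  then show ?thesis by blast
qed

lemma wt_pos: "c \<in> C \<Longrightarrow> 0 < wt i c j"
  unfolding wt_def using C_pos eta by simp

lemma path_pos: "path i p x \<Longrightarrow> 0 < x"
proof (induction rule: path.induct)
  case (start i)
  then show ?case using B_ge by simp
next
  case (step j p x i c)
  then show ?case using wt_pos by simp
qed

definition w :: "'i \<Rightarrow> rat" where "w i = Min (vals i)"

lemma w_in: "i \<in> I \<Longrightarrow> w i \<in> vals i"
  unfolding w_def using vals_finite vals_nonempty by (intro Min_in) auto

lemma w_le: "x \<in> vals i \<Longrightarrow> w i \<le> x"
  unfolding w_def using vals_finite by (intro Min_le) auto

lemma w_pos: "i \<in> I \<Longrightarrow> 0 < w i"
  using w_in path_pos unfolding vals_def by blast

text \<open>If the lightest path to \<open>j\<close> avoids \<open>i\<close>, it is extended by the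
  edge. Otherwise the edge closes a cycle of weight at least 1, and the part of the path up to its
  visit of \<open>i\<close> is no heavier than the path with the cycle.\<close>

lemma w_edge:
  assumes ij: "i \<in> I" "j \<in> I" and c: "c \<in> C" "v i \<le> c * v j" shows "w i \<le> w j * wt i c j"
proof -
  obtain p where p: "path j p (w j)" "distinct (j # p)" using w_in[OF ij(2)] unfolding vals_def by blast
  show ?thesis
  proof (cases "i \<in> set (j # p)")
    case False
    then have "w j * wt i c j \<in> vals i"
      using path.step[OF p(1) ij(1) c] p(2) False unfolding vals_def by (intro CollectI exI[of _ "j # p"]) simp
    then show ?thesis by (rule w_le)
  next
    case True
    obtain q y cs m where h: "path i q y" "distinct (i # q)" "set cs \<subseteq> C" "length p = length q + length cs"
      "m \<le> length cs" "w j = y * prod_list cs / \<eta> ^ m" "v j \<le> prod_list cs * v i"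
      "m > 0 \<longrightarrow> v j < prod_list cs * v i" using path_suffix[OF p True] by blast
    \<comment> \<open>The number of strict edges on the cycle, including the new edge.\<close>
    define m' where "m' = (if v i = c * v j then m else Suc m)"
    have pos: "0 < c" "0 < v i" using C_pos c(1) v(2) ij by auto
    have le: "c * v j \<le> c * prod_list cs * v i" and lt: "m > 0 \<longrightarrow> c * v j < c * prod_list cs * v i"
      using pos h(7,8) by (simp_all add: mult.assoc)
    \<comment> \<open>Going around the cycle compares \<open>v i\<close> with a multiple of itself,
      and positivity of \<open>v i\<close> turns this into a bound on the product.\<close>
    have "1 * v i \<le> prod_list (c # cs) * v i" using le c(2) by simp
    then have 1: "1 \<le> prod_list (c # cs)" using pos(2) by (simp only: mult_le_cancel_right_pos)
    have 2: "m' > 0 \<longrightarrow> 1 < prod_list (c # cs)"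
    proof
      assume "m' > 0"
      then have "1 * v i < prod_list (c # cs) * v i" using le lt c(2) unfolding m'_def
        by (cases "v i = c * v j") auto
      then show "1 < prod_list (c # cs)" using pos(2) by (simp only: mult_less_cancel_right_pos)
    qed
    have "length cs < N" using path_length[OF p] h(4) by simp
    then have "1 \<le> prod_list (c # cs) / \<eta> ^ m'"
      using h(3,5) c(1) 1 2 by (intro diminished_ge_1) (auto simp: m'_def)
    then have "y * 1 \<le> y * (prod_list (c # cs) / \<eta> ^ m')"
      using path_pos[OF h(1)] by (intro mult_left_mono) auto
    also have "\<dots> = w j * wt i c j" unfolding h(6) wt_def m'_def by (simp add: mult.commute)
    finally have "y \<le> w j * wt i c j" by simp
    moreover have "y \<in> vals i" using h(1,2) unfolding vals_def by blast
    then have "w i \<le> y" by (rule w_le)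
    ultimately show ?thesis by simp
  qed
qed

text \<open>A nonempty simple path to \<open>z\<close> starts elsewhere, hence with the value B. Its
  product is at least 1 / K^N, so before diminishing the weight is at least B / K^N = 4^N, and the
  diminishing factors amount to at most 2.\<close>

lemma w_z: "w z = 1"
proof (rule antisym)
  have "1 \<in> vals z" unfolding vals_def using path.start[OF I(3)] by (intro CollectI exI[of _ "[]"]) simp
  then show "w z \<le> 1" by (rule w_le)
  obtain p where p: "path z p (w z)" "distinct (z # p)" using w_in[OF I(3)] unfolding vals_def by blast
  obtain cs m where h: "set cs \<subseteq> C" "length cs = length p" "m \<le> length p"
    "w z = (if last (z # p) = z then 1 else B) * prod_list cs / \<eta> ^ m" using path_value[OF p(1)] by blast
  show "1 \<le> w z"
  proof (cases "p = []")
    case True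
    then show ?thesis using h by simp
  next
    case False
    then have "last (z # p) \<noteq> z" using p(2) by auto
    then have w: "w z = B * prod_list cs / \<eta> ^ m" using h by simp
    have len: "length p < N" by (rule path_length[OF p])
    have "1 / of_nat (K ^ N) \<le> prod_list cs"
      by (rule small_fraction_ge[OF prod_small]) (use h len in auto)
    then have "B * (1 / of_nat (K ^ N)) \<le> B * prod_list cs"
      using B_ge by (intro mult_left_mono) auto
    moreover have "B * (1 / of_nat (K ^ N)) = 4 ^ N"
      unfolding B using K by (simp add: power_mult_distrib)
    moreover have "(2::rat) \<le> 4 ^ N"
      using power_increasing[OF N_pos, of "4::rat"] by simp
    moreover have "\<eta> ^ m \<le> 2"
    proof -
      have "1 / of_nat K ^ N \<le> (1::rat)" using K by (simp add: one_le_power)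
      then show ?thesis using eta_power[of m] h(3) len by linarith
    qed
    ultimately have "\<eta> ^ m \<le> B * prod_list cs" by (metis order_trans)
    then show ?thesis unfolding w using eta by simp
  qed
qed

text \<open>Edges express upper bounds only. A lower bound on \<open>v i\<close> is an upper bound
  on \<open>v j\<close> with the inverse factor, which is why \<open>C\<close> is closed under
  inverses.\<close>

lemma w_sgn:
  assumes ij: "i \<in> I" "j \<in> I" and c: "c \<in> C" shows "sgn (v i - c * v j) = sgn (w i - c * w j)"
proof -
  have less: "w k < d * w l" if "k \<in> I" "l \<in> I" "d \<in> C" "v k < d * v l" for k l d
  proof -
    have "w k \<le> w l * (d / \<eta>)" using w_edge[of k l d] that by (simp add: wt_def)
    also have "\<dots> < w l * d"
      using w_pos[OF that(2)] C_pos[OF that(3)] eta by (intro mult_strict_left_mono) (simp_all add: divide_less_eq)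
    finally show ?thesis by (simp add: mult.commute)
  qed
  have le: "w k \<le> d * w l" if "k \<in> I" "l \<in> I" "d \<in> C" "v k = d * v l" for k l d
    using w_edge[of k l d] that by (simp add: wt_def mult.commute)
  have pos: "0 < c" by (rule C_pos[OF c])
  have inv: "inverse c \<in> C" by (rule C(3)[OF c])
  consider "v i < c * v j" | "v i = c * v j" | "c * v j < v i" by linarith
  then show ?thesis
  proof cases
    case 1
    then show ?thesis using less[OF ij c] by (simp add: sgn_if)
  next
    case 2
    then have "v j = inverse c * v i" using pos by simp
    then have "w j \<le> inverse c * w i" using le[OF ij(2,1) inv] by blast
    then have "c * w j \<le> w i" using pos by (simp add: field_simps)
    then show ?thesis using le[OF ij c 2] 2 by simp
  next
    case 3
    then have "v j < inverse c * v i" using pos by (simp add: field_simps)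
    then have "w j < inverse c * w i" using less[OF ij(2,1) inv] by blast
    then have "c * w j < w i" using pos by (simp add: field_simps)
    then show ?thesis using 3 by (simp add: sgn_if)
  qed
qed

end

definition positive_part :: "rat set \<Rightarrow> rat set" where
  "positive_part C = (\<lambda>c. \<bar>c\<bar>) ` (C - {0}) \<union> (\<lambda>c. inverse \<bar>c\<bar>) ` (C - {0})"

lemma positive_part: "finite C \<Longrightarrow> finite (positive_part C)" "c \<in> positive_part C \<Longrightarrow> 0 < c"
  "c \<in> positive_part C \<Longrightarrow> inverse c \<in> positive_part C"
  unfolding positive_part_def by (auto simp: image_iff)

definition signed_samples :: "rat set \<Rightarrow> nat \<Rightarrow> nat \<Rightarrow> rat set" where
  "signed_samples C K N = insert 0 (samples (positive_part C) N ((4 * of_nat K) ^ N) \<union>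
     uminus ` samples (positive_part C) N ((4 * of_nat K) ^ N))"

text \<open>Signs are kept and absolute values replaced. If \<open>f i\<close> and c * f j have
  different signs, these alone decide the comparison; if the signs agree, it reduces to comparing
  absolute values with the factor |c|.\<close>

theorem sampling:
  assumes C: "finite C" "1 \<le> K" "\<And>c. c \<in> positive_part C \<Longrightarrow> small_fraction K c"
    and I: "finite I" "card I \<le> N" "z \<in> I" and f: "f z = 1"
  shows "\<exists>g. g z = 1 \<and> g ` I \<subseteq> signed_samples C K N \<and> sim C I f g"
proof -
  \<comment> \<open>The system needs positive values; where \<open>f\<close> vanishes the default 1
    is cancelled later by the factor \<open>sgn (f i)\<close>.\<close>
  define v where "v = (\<lambda>i. if f i = 0 then 1 else \<bar>f i\<bar>)"
  interpret difference_system I z v "positive_part C" N K "(4 * of_nat K) ^ N" "1 + 1 / (4 * of_nat K) ^ N"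
    by standard (use assms positive_part in \<open>simp_all add: v_def\<close>)
  define g where "g = (\<lambda>i. sgn (f i) * w i)"
  have fv: "sgn (f i) * v i = f i" for i by (simp add: v_def sgn_if)
  have "sgn (f i - c * f j) = sgn (g i - c * g j)" if ij: "i \<in> I" "j \<in> I" and c: "c \<in> C" for i j c
  proof -
    define s t where "s = sgn (f i)" and "t = sgn c * sgn (f j)"
    have st: "s \<in> {-1, 0, 1}" "t \<in> {-1, 0, 1}" by (auto simp: s_def t_def sgn_if)
    have c': "c = sgn c * \<bar>c\<bar>" by (simp add: sgn_mult_abs)
    have ct: "c * (sgn (f j) * b) = t * (\<bar>c\<bar> * b)" for b
    proof -
      have "c * (sgn (f j) * b) = (sgn c * \<bar>c\<bar>) * (sgn (f j) * b)" using c' by simp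
      then show ?thesis unfolding t_def by (simp only: mult_ac)
    qed
    have 1: "f i - c * f j = s * v i - t * (\<bar>c\<bar> * v j)"
      using ct[of "v j"] unfolding s_def fv by simp
    have 2: "g i - c * g j = s * w i - t * (\<bar>c\<bar> * w j)"
      unfolding s_def g_def ct by (rule refl)
    have p: "0 < v i" "0 < w i"
      using v(2) w_pos ij by simp_all
    have p': "0 < \<bar>c\<bar> * v j" "0 < \<bar>c\<bar> * w j" if "c \<noteq> 0"
      using v(2)[OF ij(2)] w_pos[OF ij(2)] that by simp_all
    show ?thesis
    proof (cases "c = 0")
      case True
      then show ?thesis unfolding 1 2 using p by (simp add: sgn_mult)
    next
      case False
      then have "\<bar>c\<bar> \<in> positive_part C" using c unfolding positive_part_def by blast
      note e = w_sgn[OF ij this]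
      show ?thesis
      proof (cases "s = t")
        case True
        have "s * v i - t * (\<bar>c\<bar> * v j) = s * (v i - \<bar>c\<bar> * v j)" "s * w i - t * (\<bar>c\<bar> * w j) = s * (w i - \<bar>c\<bar> * w j)"
          unfolding True by (simp_all add: right_diff_distrib)
        then show ?thesis unfolding 1 2 using e by (simp add: sgn_mult)
      next
        case F: False
        have "sgn (s * a - t * b) = sgn (s * a' - t * b')" if "0 < a" "0 < b" "0 < a'" "0 < b'" for a b a' b'
          using st F that by (auto simp: sgn_if)
        then show ?thesis unfolding 1 2 using p(1,2) p'[OF False] by blast
      qed
    qed
  qed
  then have "sim C I f g" unfolding sim_def by blast
  moreover have "g z = 1" using f w_z by (simp add: g_def)
  moreover have "g i \<in> signed_samples C K N" if "i \<in> I" for i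
  proof -
    have "w i \<in> samples (positive_part C) N ((4 * of_nat K) ^ N)" using w_in[OF that] vals_samples by blast
    then show ?thesis unfolding g_def signed_samples_def by (cases "f i" "0::rat" rule: linorder_cases) auto
  qed
  ultimately show ?thesis by blast
qed

section \<open>Descent for relations preserved by max\<close>

text \<open>Values without a smaller candidate stay put, so the descent becomes stationary even for
  unsatisfiable instances.\<close>

definition lower :: "rat set \<Rightarrow> rat \<Rightarrow> rat" where
  "lower D y = (if \<exists>d\<in>D. d < y then Max {d\<in>D. d < y} else y)"

lemma lower_cases:
  assumes "finite D"
  obtains "\<forall>d\<in>D. \<not> d < y" "lower D y = y"
  | "lower D y \<in> D" "lower D y < y" "\<And>d. d \<in> D \<Longrightarrow> d < y \<Longrightarrow> d \<le> lower D y"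
proof (cases "\<exists>d\<in>D. d < y")
  case True
  have "finite {d\<in>D. d < y}" "{d\<in>D. d < y} \<noteq> {}" using assms True by auto
  then have "Max {d\<in>D. d < y} \<in> {d\<in>D. d < y}" "\<And>d. d \<in> {d\<in>D. d < y} \<Longrightarrow> d \<le> Max {d\<in>D. d < y}"
    by (rule Max_in, intro Max_ge)
  then show thesis using that(2) True unfolding lower_def by simp
next
  case False
  then show thesis using that(1) unfolding lower_def by auto
qed

lemma lower_le: "finite D \<Longrightarrow> lower D y \<le> y"
  by (rule lower_cases[of D y]) auto

lemma lower_ge: "finite D \<Longrightarrow> d \<in> D \<Longrightarrow> d < y \<Longrightarrow> d \<le> lower D y \<and> lower D y < y"
  by (rule lower_cases[of D y]) auto

definition max_closed :: "rat list set \<Rightarrow> bool" where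
  "max_closed R \<longleftrightarrow> (\<forall>xs\<in>R. \<forall>ys\<in>R. map2 max xs ys \<in> R)"

text \<open>The maximum of witnesses for the first \<open>n\<close> coordinates stays below
  \<open>us\<close> and attains \<open>us\<close> in all of them; \<open>xs\<close> starts the
  induction at \<open>n = 0\<close>.\<close>

lemma max_closed_attained:
  assumes R: "max_closed R" "\<And>xs. xs \<in> R \<Longrightarrow> length xs = k" and us: "length us = k"
    and xs: "xs \<in> R" "\<And>i. i < k \<Longrightarrow> xs ! i \<le> us ! i"
    and att: "\<And>p. p < k \<Longrightarrow> us \<in> attained k R p"
  shows "us \<in> R"
proof -
  have "\<exists>ys\<in>R. (\<forall>i<k. ys ! i \<le> us ! i) \<and> (\<forall>p<n. ys ! p = us ! p)" if "n \<le> k" for n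
    using that
  proof (induction n)
    case 0
    then show ?case using xs by auto
  next
    case (Suc n)
    then obtain ys where ys: "ys \<in> R" "\<forall>i<k. ys ! i \<le> us ! i" "\<forall>p<n. ys ! p = us ! p" by auto
    obtain zs where zs: "zs \<in> R" "\<forall>i<k. zs ! i \<le> us ! i" "zs ! n = us ! n"
      using att[of n] Suc.prems unfolding attained_def by auto
    have len: "length ys = k" "length zs = k" using R(2) ys(1) zs(1) by auto
    have nth: "map2 max ys zs ! i = max (ys ! i) (zs ! i)" if "i < k" for i
      using that len by simp
    have "map2 max ys zs \<in> R" using R(1) ys(1) zs(1) unfolding max_closed_def by blast
    moreover have "\<forall>i<k. map2 max ys zs ! i \<le> us ! i" using nth ys(2) zs(2) by simp
    moreover have "map2 max ys zs ! p = us ! p" if "p < Suc n" for p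
    proof (cases "p = n")
      case True
      then show ?thesis using nth[of p] ys(2) zs(3) Suc.prems by simp
    next
      case False
      then show ?thesis using nth[of p] ys(3) zs(2) Suc.prems that by simp
    qed
    ultimately show ?case by blast
  qed
  from this[of k] obtain ys where "ys \<in> R" "\<forall>p<k. ys ! p = us ! p" by auto
  moreover from this have "ys = us" using R(2) us by (intro nth_equalityI) auto
  ultimately show ?thesis by simp
qed

type_synonym 'v constraint = "'v list \<times> nat \<times> rat list set"

definition satisfies :: "('v \<Rightarrow> rat) \<Rightarrow> 'v constraint \<Rightarrow> bool" where
  "satisfies u c = (case c of (vs, k, R) \<Rightarrow> map u vs \<in> R)"

definition blocked :: "('v \<Rightarrow> rat) \<Rightarrow> 'v \<Rightarrow> 'v constraint \<Rightarrow> bool" where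
  "blocked u x c = (case c of (vs, k, R) \<Rightarrow> \<exists>p<k. vs ! p = x \<and> map u vs \<notin> attained k R p)"

text \<open>One round tests all variables against the same assignment and lowers the blocked ones
  simultaneously.\<close>

definition descend :: "rat set \<Rightarrow> 'v constraint set \<Rightarrow> ('v \<Rightarrow> rat) \<Rightarrow> 'v \<Rightarrow> rat" where
  "descend D S u x = (if \<exists>c\<in>S. blocked u x c then lower D (u x) else u x)"

locale max_closed_instance =
  fixes D :: "rat set" and S :: "'v constraint set" and V :: "'v set"
  assumes D: "finite D" and V: "finite V"
    and S: "\<And>vs k R. (vs, k, R) \<in> S \<Longrightarrow> length vs = k \<and> set vs \<subseteq> V \<and> (\<forall>xs\<in>R. length xs = k) \<and> max_closed R"
begin

text \<open>The tuple of the solution lies below the current values. If it agreed with them at the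
  blocked position, it would itself be the missing witness.\<close>

lemma blocked_less:
  assumes "(vs, k, R) \<in> S" "satisfies s (vs, k, R)" "\<And>x. x \<in> V \<Longrightarrow> s x \<le> u x" "blocked u x (vs, k, R)"
  shows "x \<in> V \<and> s x < u x"
proof -
  obtain p where p: "p < k" "vs ! p = x" "map u vs \<notin> attained k R p"
    using assms(4) unfolding blocked_def by auto
  have len: "length vs = k" and vs: "set vs \<subseteq> V" using S[OF assms(1)] by auto
  have x: "x \<in> V" using p len vs by force
  have "map s vs \<in> R" using assms(2) by (simp add: satisfies_def)
  moreover have "map s vs ! i \<le> map u vs ! i" if "i < k" for i
    using that len vs assms(3)[of "vs ! i"] by force
  ultimately have "map s vs ! p \<noteq> map u vs ! p" using p(3) len unfolding attained_def by auto
  then show ?thesis using p len x assms(3)[OF x] by simp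
qed

lemma descend_sound:
  assumes "\<And>c. c \<in> S \<Longrightarrow> satisfies s c" "\<And>x. x \<in> V \<Longrightarrow> s x \<in> D" "\<And>x. x \<in> V \<Longrightarrow> s x \<le> u x" "x \<in> V"
  shows "s x \<le> descend D S u x"
proof (cases "\<exists>c\<in>S. blocked u x c")
  case True
  then obtain vs k R where c: "(vs, k, R) \<in> S" "blocked u x (vs, k, R)" by (metis prod_cases3)
  have "s x < u x" using blocked_less[OF c(1) assms(1)[OF c(1)] assms(3) c(2)] by blast
  then show ?thesis using True lower_ge[OF D assms(2)[OF assms(4)]] unfolding descend_def by auto
next
  case False
  then show ?thesis using assms(3)[OF assms(4)] unfolding descend_def by auto
qed

lemma descend_outside: "x \<notin> V \<Longrightarrow> descend D S u x = u x"
proof -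
  assume x: "x \<notin> V"
  have "\<not> blocked u x (vs, k, R)" if "(vs, k, R) \<in> S" for vs k R
    using S[OF that] x unfolding blocked_def by force
  then show ?thesis unfolding descend_def by auto
qed

text \<open>A blocked variable lies strictly above the solution, whose value is a candidate, so
  \<open>lower\<close> would change it. At a fixpoint nothing is blocked, and closure under max
  applies to every constraint.\<close>

lemma fixpoint_satisfies:
  assumes sol: "\<And>c. c \<in> S \<Longrightarrow> satisfies s c" "\<And>x. x \<in> V \<Longrightarrow> s x \<in> D" and le: "\<And>x. x \<in> V \<Longrightarrow> s x \<le> u x"
    and fixp: "descend D S u = u" and c: "c \<in> S"
  shows "satisfies u c"
proof -
  obtain vs k R where [simp]: "c = (vs, k, R)" by (cases c)
  have vs: "length vs = k" "set vs \<subseteq> V" and R: "max_closed R" "\<And>xs. xs \<in> R \<Longrightarrow> length xs = k"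
    using S[of vs k R] c by auto
  have "\<not> blocked u x c" for x
  proof
    assume b: "blocked u x c"
    then have x: "x \<in> V" "s x < u x" using blocked_less[of vs k R s u x] c sol(1) le by auto
    have "lower D (u x) < u x" using lower_ge[OF D sol(2)[OF x(1)] x(2)] by blast
    moreover have "descend D S u x = lower D (u x)" using b c unfolding descend_def by auto
    ultimately show False using fixp by simp
  qed
  then have att: "map u vs \<in> attained k R p" if "p < k" for p
    using that unfolding blocked_def by auto
  have "map u vs \<in> R"
  proof (rule max_closed_attained[OF R _ _ _ att])
    show "map s vs \<in> R" using sol(1)[OF c] by (simp add: satisfies_def)
    show "map s vs ! i \<le> map u vs ! i" if "i < k" for i
      using that vs le[of "vs ! i"] by force
  qed (use vs in simp_all)
  then show ?thesis by (simp add: satisfies_def)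
qed

text \<open>The potential that limits the number of effective rounds by
  \<open>card V * card D\<close>.\<close>

definition rank :: "('v \<Rightarrow> rat) \<Rightarrow> nat" where
  "rank u = (\<Sum>x\<in>V. card {d\<in>D. d < u x})"

lemma rank_descend:
  assumes "descend D S u \<noteq> u" shows "rank (descend D S u) < rank u"
  unfolding rank_def
proof (rule sum_strict_mono_ex1[OF V])
  have le: "descend D S u x \<le> u x" for x
    using lower_le[OF D] unfolding descend_def by auto
  show "\<forall>x\<in>V. card {d \<in> D. d < descend D S u x} \<le> card {d \<in> D. d < u x}"
    using le D by (intro ballI card_mono) (auto intro: less_le_trans)
  obtain x where x: "descend D S u x \<noteq> u x" using assms by blast
  have xV: "x \<in> V" using x descend_outside by blast
  have d: "descend D S u x = lower D (u x)" "lower D (u x) \<noteq> u x"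
    using x unfolding descend_def by presburger+
  from lower_cases[OF D, of "u x"] have "lower D (u x) \<in> D" "lower D (u x) < u x" using d(2) by metis+
  then have "{d \<in> D. d < lower D (u x)} \<subset> {d \<in> D. d < u x}" by force
  then have "card {d \<in> D. d < descend D S u x} < card {d \<in> D. d < u x}"
    unfolding d(1) using D by (intro psubset_card_mono) auto
  then show "\<exists>x\<in>V. card {d \<in> D. d < descend D S u x} < card {d \<in> D. d < u x}" using xV by blast
qed

lemma rank_le: "rank u \<le> card V * card D"
proof -
  have "rank u \<le> (\<Sum>x\<in>V. card D)" unfolding rank_def using D by (intro sum_mono card_mono) auto
  then show ?thesis by simp
qed

lemma descend_stabilizes:
  assumes "rank u \<le> n" shows "descend D S ((descend D S ^^ n) u) = (descend D S ^^ n) u"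
  using assms
proof (induction n arbitrary: u)
  case 0
  then show ?case using rank_descend[of u] by auto
next
  case (Suc n)
  show ?case
  proof (cases "descend D S u = u")
    case True
    have "(descend D S ^^ m) u = u" for m by (induction m) (simp_all add: True)
    then show ?thesis using True by simp
  next
    case False
    then have "rank (descend D S u) \<le> n" using rank_descend[of u] Suc.prems by simp
    from Suc.IH[OF this] show ?thesis by (simp add: funpow_swap1)
  qed
qed

theorem descend_complete:
  assumes sol: "\<And>c. c \<in> S \<Longrightarrow> satisfies s c" "\<And>x. x \<in> V \<Longrightarrow> s x \<in> D"
    and u: "\<And>x. x \<in> V \<Longrightarrow> s x \<le> u x" and n: "card V * card D \<le> n" and c: "c \<in> S"
  shows "satisfies ((descend D S ^^ n) u) c"
proof (rule fixpoint_satisfies[OF sol _ _ c])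
  have "\<forall>x\<in>V. s x \<le> (descend D S ^^ m) u x" for m
    using descend_sound[OF sol] by (induction m) (auto intro: u)
  then show "s x \<le> (descend D S ^^ n) u x" if "x \<in> V" for x using that by blast
  show "descend D S ((descend D S ^^ n) u) = (descend D S ^^ n) u"
    using rank_le[of u] n by (intro descend_stabilizes) simp
qed

end

definition determines :: "rat set \<Rightarrow> nat \<Rightarrow> rat list set \<Rightarrow> bool" where
  "determines C k R \<longleftrightarrow> (\<forall>\<rho> \<rho>'. sim C {..k} (pt \<rho>) (pt \<rho>') \<longrightarrow> (point_list k \<rho> \<in> R \<longleftrightarrow> point_list k \<rho>' \<in> R))"

lemma fin_det_determines: "fin_det k (\<lambda>\<rho>. point_list k \<rho> \<in> R) \<longleftrightarrow> (\<exists>C. finite C \<and> determines C k R)"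
  unfolding fin_det_def determines_def ..

lemma determines_mono: "determines C k R \<Longrightarrow> C \<subseteq> C' \<Longrightarrow> determines C' k R"
  unfolding determines_def using sim_mono by blast

text \<open>The additional node \<open>None\<close> carries the constant 1 and acts as the
  distinguished node of the difference system; \<open>N\<close> exceeds the number of variables to
  make room for it.\<close>

lemma solution_in_samples:
  assumes C: "finite C" "1 \<le> K" "\<And>c. c \<in> positive_part C \<Longrightarrow> small_fraction K c"
    and V: "finite V" "card V < N"
    and S: "\<And>vs k R. (vs, k, R) \<in> S \<Longrightarrow> length vs = k \<and> set vs \<subseteq> V \<and> determines C k R"
    and sol: "\<And>c. c \<in> S \<Longrightarrow> satisfies s c"
  shows "\<exists>s'. (\<forall>x\<in>V. s' x \<in> signed_samples C K N) \<and> (\<forall>c\<in>S. satisfies s' c)"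
proof -
  define f where "f = (\<lambda>x. case x of None \<Rightarrow> 1 | Some v \<Rightarrow> s v)"
  have "card (insert None (Some ` V)) \<le> N" using V by (simp add: card_image)
  then obtain g where g: "g None = 1" "g ` insert None (Some ` V) \<subseteq> signed_samples C K N"
      "sim C (insert None (Some ` V)) f g"
    using sampling[OF C, of "insert None (Some ` V)" N None f] V by (auto simp: f_def)
  define s' where "s' = (\<lambda>v. g (Some v))"
  have "satisfies s' (vs, k, R)" if c: "(vs, k, R) \<in> S" for vs k R
  proof -
    have vs: "length vs = k" "set vs \<subseteq> V" and det: "determines C k R" using S[OF c] by auto
    \<comment> \<open>Sends index 0 of \<open>pt\<close> to the constant and the others to the
      arguments of the constraint; positions beyond the arity get the constant as a default.\<close>
    define h where "h = (\<lambda>i. case i of 0 \<Rightarrow> None | Suc j \<Rightarrow> if j < k then Some (vs ! j) else None)"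
    define \<rho> where "\<rho> = (\<lambda>j. f (h (Suc j)))"
    define \<rho>' where "\<rho>' = (\<lambda>j. g (h (Suc j)))"
    have "h ` {..k} \<subseteq> insert None (Some ` V)"
    proof
      fix y assume "y \<in> h ` {..k}"
      then obtain i where i: "i \<le> k" "y = h i" by blast
      show "y \<in> insert None (Some ` V)"
      proof (cases i)
        case (Suc j)
        then have "vs ! j \<in> V" using i vs nth_mem[of j vs] by auto
        then show ?thesis using i Suc by (simp add: h_def)
      qed (simp add: i h_def)
    qed
    from sim_reindex[OF g(3) this] have "sim C {..k} (\<lambda>j. f (h j)) (\<lambda>j. g (h j))" .
    moreover have "f (h j) = pt \<rho> j" "g (h j) = pt \<rho>' j" for j
      unfolding \<rho>_def \<rho>'_def using g(1) by (cases j; simp add: h_def f_def)+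
    ultimately have "point_list k \<rho> \<in> R \<longleftrightarrow> point_list k \<rho>' \<in> R"
      using det unfolding determines_def by simp
    moreover have "point_list k \<rho> = map s vs" "point_list k \<rho>' = map s' vs"
      using vs(1) by (auto intro!: nth_equalityI simp: \<rho>_def \<rho>'_def h_def f_def s'_def)
    ultimately show ?thesis using sol[OF c] by (simp add: satisfies_def)
  qed
  moreover have "\<forall>x\<in>V. s' x \<in> signed_samples C K N" using g(2) by (auto simp: s'_def)
  ultimately show ?thesis by auto
qed

section \<open>Implementation of the descent\<close>

text \<open>On \<open>X\<close> the property is a Boolean function of finitely many answers, so a
  decision tree of constant depth with constant leaves computes it. No formula for \<open>Q\<close>
  has to be produced.\<close>

lemma polytime_finite_tests:
  fixes Q :: "'a::tree_code \<Rightarrow> bool" and T :: "('a \<Rightarrow> bool) set"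
  assumes "finite T" "\<And>t. t \<in> T \<Longrightarrow> polytime t"
    "\<And>x y. x \<in> X \<Longrightarrow> y \<in> X \<Longrightarrow> (\<forall>t\<in>T. t x = t y) \<Longrightarrow> Q x = Q y"
  shows "\<exists>P. polytime P \<and> (\<forall>x\<in>X. P x = Q x)"
  using assms
proof (induction T arbitrary: X rule: finite_induct)
  case empty
  show ?case
  proof (cases "\<exists>x\<in>X. Q x")
    case True
    then have "\<forall>x\<in>X. Q x" using empty by blast
    then show ?thesis by (intro exI[of _ "\<lambda>_. True"]) (simp add: polytime_const)
  next
    case False
    then show ?thesis by (intro exI[of _ "\<lambda>_. False"]) (simp add: polytime_const)
  qed
next
  case (insert t T)
  have "\<exists>P. polytime P \<and> (\<forall>x\<in>{x\<in>X. t x = b}. P x = Q x)" for b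
    using insert.prems by (intro insert.IH) auto
  from this[of True] this[of False] obtain P P' where
    "polytime P" "\<forall>x\<in>{x\<in>X. t x = True}. P x = Q x" "polytime P'" "\<forall>x\<in>{x\<in>X. t x = False}. P' x = Q x"
    by blast
  moreover from this have "polytime (\<lambda>x. if t x then P x else P' x)"
    using insert.prems(1)[of t] by (intro polytime_if) simp_all
  ultimately show ?case by (intro exI[of _ "\<lambda>x. if t x then P x else P' x"]) simp
qed

lemma polytime_finite_ex:
  assumes "finite J" "\<And>j. j \<in> J \<Longrightarrow> polytime (Q j)" shows "polytime (\<lambda>x. \<exists>j\<in>J. Q j x)"
  using assms
proof (induction J rule: finite_induct)
  case (insert j J)
  then show ?case using polytime_disj[of "Q j" "\<lambda>x. \<exists>j\<in>J. Q j x"] by simp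
qed (simp add: polytime_const)

text \<open>A rational number is represented as a difference of two natural numbers over a
  common denominator.\<close>
definition val :: "nat \<Rightarrow> nat \<times> nat \<Rightarrow> rat" where
  "val W z = (of_nat (fst z) - of_nat (snd z)) / of_nat W"

text \<open>Comparison with the factor (p - q) / r after clearing denominators, with every negative
  term moved to the other side so that only natural numbers occur.\<close>

definition scaled_less :: "nat \<Rightarrow> nat \<Rightarrow> nat \<Rightarrow> nat \<times> nat \<Rightarrow> nat \<times> nat \<Rightarrow> bool" where
  "scaled_less r p q y z \<longleftrightarrow> r * fst y + p * snd z + q * fst z < r * snd y + p * fst z + q * snd z"

definition scaled_greater :: "nat \<Rightarrow> nat \<Rightarrow> nat \<Rightarrow> nat \<times> nat \<Rightarrow> nat \<times> nat \<Rightarrow> bool" where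
  "scaled_greater r p q y z \<longleftrightarrow> r * snd y + p * fst z + q * snd z < r * fst y + p * snd z + q * fst z"

lemma scaled_compare:
  assumes W: "0 < W" and r: "0 < r" and c: "c = (of_nat p - of_nat q) / of_nat r"
  shows "scaled_less r p q y z \<longleftrightarrow> val W y < c * val W z"
    and "scaled_greater r p q y z \<longleftrightarrow> c * val W z < val W y"
proof -
  define e :: rat where "e = of_nat r * (of_nat (fst y) - of_nat (snd y)) - (of_nat p - of_nat q) * (of_nat (fst z) - of_nat (snd z))"
  have e: "val W y - c * val W z = e / (of_nat r * of_nat W)"
    unfolding e_def val_def c using W r by (simp add: field_simps)
  have pos: "(0::rat) < of_nat r * of_nat W" using W r by simp
  have "scaled_less r p q y z \<longleftrightarrow> (of_nat (r * fst y + p * snd z + q * fst z) :: rat) < of_nat (r * snd y + p * fst z + q * snd z)"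
    unfolding scaled_less_def of_nat_less_iff ..
  also have "\<dots> \<longleftrightarrow> e < 0" unfolding e_def by (simp add: algebra_simps)
  also have "\<dots> \<longleftrightarrow> val W y - c * val W z < 0" unfolding e using pos by (simp add: divide_less_0_iff)
  finally show "scaled_less r p q y z \<longleftrightarrow> val W y < c * val W z" by simp
  have "scaled_greater r p q y z \<longleftrightarrow> (of_nat (r * snd y + p * fst z + q * snd z) :: rat) < of_nat (r * fst y + p * snd z + q * fst z)"
    unfolding scaled_greater_def of_nat_less_iff ..
  also have "\<dots> \<longleftrightarrow> 0 < e" unfolding e_def by (simp add: algebra_simps)
  also have "\<dots> \<longleftrightarrow> 0 < val W y - c * val W z" unfolding e using pos by (simp add: zero_less_divide_iff)
  finally show "scaled_greater r p q y z \<longleftrightarrow> c * val W z < val W y" by simp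
qed

lemma polytime_scaled [polytime_intros]:
  assumes "polytime f" "polytime g"
  shows "polytime (\<lambda>x. scaled_less r p q (f x) (g x))" "polytime (\<lambda>x. scaled_greater r p q (f x) (g x))"
  unfolding scaled_less_def scaled_greater_def by (intro polytime_intros assms)+

lemma rat_as_difference: "\<exists>p q r::nat. 0 < r \<and> c = (of_nat p - of_nat q) / (of_nat r :: rat)"
proof -
  obtain a b where ab: "quotient_of c = (a, b)" by fastforce
  have b: "b > 0" using quotient_of_denom_pos[OF ab] .
  have c: "c = of_int a / of_int b" using quotient_of_div[OF ab] .
  have "a = int (nat a) - int (nat (- a))" by simp
  then have "(of_int a :: rat) = of_nat (nat a) - of_nat (nat (- a))"
    by (metis of_int_diff of_int_of_nat_eq)
  moreover have "(of_int b :: rat) = of_nat (nat b)" using b by simp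
  ultimately show ?thesis using c b by (intro exI[of _ "nat a"] exI[of _ "nat (- a)"] exI[of _ "nat b"]) simp
qed

text \<open>The leading entry \<open>(W, 0)\<close> represents 1 over the denominator
  \<open>W\<close>. The list is therefore indexed like \<open>pt\<close>, with the constant at index
  0.\<close>

lemma polytime_determined_membership:
  assumes C: "finite C" and det: "determines C k R"
  shows "\<exists>P. polytime P \<and> (\<forall>W ys. 0 < W \<longrightarrow> length ys = k \<longrightarrow> (P ((W, 0) # ys) \<longleftrightarrow> map (val W) ys \<in> R))"
proof -
  obtain p q r where pqr: "\<And>c. 0 < r c \<and> c = (of_nat (p c) - of_nat (q c)) / (of_nat (r c) :: rat)"
    using rat_as_difference by metis
  define lt where "lt = (\<lambda>(c, i, j) (zs :: (nat \<times> nat) list). scaled_less (r c) (p c) (q c) (hd (drop i zs)) (hd (drop j zs)))"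
  define gt where "gt = (\<lambda>(c, i, j) (zs :: (nat \<times> nat) list). scaled_greater (r c) (p c) (q c) (hd (drop i zs)) (hd (drop j zs)))"
  define J where "J = C \<times> {..k} \<times> {..k}"
  define X :: "(nat \<times> nat) list set" where "X = {(W, 0) # ys | W ys. 0 < W \<and> length ys = k}"
  define Q where "Q = (\<lambda>zs. map (val (fst (hd zs))) (tl zs) \<in> R)"
  have "\<exists>P. polytime P \<and> (\<forall>x\<in>X. P x = Q x)"
  proof (rule polytime_finite_tests[of "lt ` J \<union> gt ` J"])
    show "finite (lt ` J \<union> gt ` J)" using C by (simp add: J_def)
    show "polytime t" if "t \<in> lt ` J \<union> gt ` J" for t
      using that unfolding lt_def gt_def by (auto intro!: polytime_intros)
    fix x y assume xy: "x \<in> X" "y \<in> X" and agree: "\<forall>t\<in>lt ` J \<union> gt ` J. t x = t y"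
    obtain W ys where x: "x = (W, 0) # ys" "0 < W" "length ys = k" using xy(1) unfolding X_def by blast
    obtain W' ys' where y: "y = (W', 0) # ys'" "0 < W'" "length ys' = k" using xy(2) unfolding X_def by blast
    define \<rho> where "\<rho> = (\<lambda>i. val W (ys ! i))"
    define \<rho>' where "\<rho>' = (\<lambda>i. val W' (ys' ! i))"
    have px: "val W (hd (drop i x)) = pt \<rho> i" if "i \<le> k" for i
      using that x by (cases i) (auto simp: \<rho>_def val_def hd_drop_conv_nth)
    have py: "val W' (hd (drop i y)) = pt \<rho>' i" if "i \<le> k" for i
      using that y by (cases i) (auto simp: \<rho>'_def val_def hd_drop_conv_nth)
    have "sim C {..k} (pt \<rho>) (pt \<rho>')"
      unfolding sim_def
    proof (intro ballI)
      fix i j c assume ij: "i \<in> {..k}" "j \<in> {..k}" and c: "c \<in> C"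
      then have "(c, i, j) \<in> J" by (simp add: J_def)
      then have "lt (c, i, j) x = lt (c, i, j) y" "gt (c, i, j) x = gt (c, i, j) y" using agree by blast+
      then have "(pt \<rho> i < c * pt \<rho> j) = (pt \<rho>' i < c * pt \<rho>' j)" "(c * pt \<rho> j < pt \<rho> i) = (c * pt \<rho>' j < pt \<rho>' i)"
        using scaled_compare[OF x(2) conjunct1[OF pqr] conjunct2[OF pqr], of c "hd (drop i x)" "hd (drop j x)"]
          scaled_compare[OF y(2) conjunct1[OF pqr] conjunct2[OF pqr], of c "hd (drop i y)" "hd (drop j y)"]
          px py ij unfolding lt_def gt_def by simp_all
      then show "sgn (pt \<rho> i - c * pt \<rho> j) = sgn (pt \<rho>' i - c * pt \<rho>' j)"
        by (cases "pt \<rho> i" "c * pt \<rho> j" rule: linorder_cases;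
            cases "pt \<rho>' i" "c * pt \<rho>' j" rule: linorder_cases) simp_all
    qed
    then have "point_list k \<rho> \<in> R \<longleftrightarrow> point_list k \<rho>' \<in> R" using det unfolding determines_def by blast
    moreover have "point_list k \<rho> = map (val W) ys" "point_list k \<rho>' = map (val W') ys'"
      using x(3) y(3) by (auto intro!: nth_equalityI simp: \<rho>_def \<rho>'_def)
    ultimately show "Q x = Q y" unfolding Q_def x y by simp
  qed
  then obtain P where P: "polytime P" "\<And>x. x \<in> X \<Longrightarrow> P x = Q x" by blast
  have "P ((W, 0) # ys) \<longleftrightarrow> map (val W) ys \<in> R" if "0 < W" "length ys = k" for W ys
    using P(2)[of "(W, 0) # ys"] that unfolding X_def Q_def by auto
  then show ?thesis using P(1) by blast
qed

section \<open>Enumerating the samples over a common denominator\<close>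

definition unary_power :: "nat \<Rightarrow> 'a list \<Rightarrow> nat" where
  "unary_power p l = foldl (\<lambda>a _. a * p) 1 l"

lemma unary_power: "unary_power p l = p ^ length l"
proof -
  have "foldl (\<lambda>a _. a * p) c l = c * p ^ length l" for c by (induction l arbitrary: c) auto
  then show ?thesis by (simp add: unary_power_def)
qed

lemma polytime_unary_power [polytime_intros]:
  fixes p :: "'x::tree_code \<Rightarrow> nat" and l :: "'x \<Rightarrow> 'a::tree_code list"
  assumes "polytime p" "polytime l" shows "polytime (\<lambda>x. unary_power (p x) (l x))"
proof -
  obtain d where d: "\<And>x. esize (p x) \<le> (esize x + 2) ^ d" by (rule polytime_size[OF assms(1)]) blast
  show ?thesis unfolding unary_power_def
  proof (rule polytime_foldl_additive[where d = d])
    have "polytime (\<lambda>q::('x \<times> nat) \<times> 'a. p (fst (fst q)))"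
      by (intro polytime_comp[OF _ assms(1)] polytime_intros)
    then show "polytime (\<lambda>q::('x \<times> nat) \<times> 'a. snd (fst q) * p (fst (fst q)))" by (intro polytime_intros)
    fix x and s :: nat and a :: 'a
    have "esize (s * p x) \<le> esize s + esize (p x)" using nbits_mult[of s "p x"] by (simp add: esize_nat)
    also have "esize (p x) \<le> (esize x + esize a + 2) ^ d"
      by (rule order_trans[OF d power_mono_le]) simp
    finally show "esize (s * p x) \<le> esize s + (esize x + esize a + 2) ^ d" by simp
  qed (intro polytime_intros assms)+
qed

text \<open>The tails of a list serve as the exponents from 0 to its length, in the unary form
  required by \<open>unary_power\<close>.\<close>

primrec tails :: "'a list \<Rightarrow> 'a list list" where
  "tails [] = [[]]"
| "tails (x # xs) = (x # xs) # tails xs"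

lemma length_tails: "length ` set (tails l) = {..length l}"
  by (induction l) (auto simp: atMost_Suc)

lemma tails_foldl: "tails (rev l) = foldl (\<lambda>s a. (a # hd s) # s) [[]] l"
proof (induction l rule: rev_induct)
  case (snoc a l)
  have hd: "hd (tails m) = m" for m :: "'a list" by (cases m) auto
  show ?case unfolding foldl_append snoc[symmetric] by (simp add: hd)
qed simp

lemma esize_tails: "esize (tails l) \<le> Suc (length l) * Suc (esize l) + 1"
proof (induction l)
  case (Cons a l)
  have "Suc (length l) * Suc (esize l) \<le> Suc (length l) * Suc (esize (a # l))"
    by (rule mult_le_mono2) simp
  then have "esize (tails l) \<le> Suc (length l) * Suc (esize (a # l)) + 1" using Cons by linarith
  then have "Suc (esize (a # l) + esize (tails l)) \<le> Suc (length (a # l)) * Suc (esize (a # l)) + 1"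
    by (simp del: esize_list)
  then show ?case by (simp only: tails.simps esize_list)
qed simp

lemma polytime_tails [polytime_intros]:
  fixes l :: "'x::tree_code \<Rightarrow> 'a::tree_code list"
  assumes "polytime l" shows "polytime (\<lambda>x. tails (l x))"
proof -
  obtain d where d: "\<And>x. esize (l x) \<le> (esize x + 2) ^ d" by (rule polytime_size[OF assms]) blast
  have "polytime (\<lambda>x. foldl (\<lambda>s a. (a # hd s) # s) [[]] (rev (l x)))"
  proof (rule polytime_foldl[where b = "\<lambda>n. Suc ((n + 2) ^ d) * Suc ((n + 2) ^ d) + 1"])
    fix x and i :: nat
    let ?t = "rev (take i (rev (l x)))"
    have "foldl (\<lambda>s a. (a # hd s) # s) [[]] (take i (rev (l x))) = tails ?t"
      using tails_foldl[of "take i (rev (l x))"] by simp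
    moreover have "esize (tails ?t) \<le> Suc (length ?t) * Suc (esize ?t) + 1" by (rule esize_tails)
    moreover have M: "esize ?t \<le> (esize x + 2) ^ d"
      using esize_drop[of "length (l x) - i" "l x"] d[of x] by (simp add: take_rev)
    moreover have "Suc (length ?t) * Suc (esize ?t) \<le> Suc ((esize x + 2) ^ d) * Suc ((esize x + 2) ^ d)"
      using M length_le_esize[of ?t] by (intro mult_le_mono) simp_all
    ultimately show "esize (foldl (\<lambda>s a. (a # hd s) # s) [[]] (take i (rev (l x))))
      \<le> Suc ((esize x + 2) ^ d) * Suc ((esize x + 2) ^ d) + 1"
      by (metis (no_types) add_right_mono order_trans)
  qed (intro polytime_intros poly_intros assms)+
  then show ?thesis using tails_foldl[of "rev (l _)"] by simp
qed

text \<open>Over the denominator q^M with M = length l, the multiple of x by (p / q)^e has the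
  numerator x * p^e * q^(M - e). Letting both exponents run freely covers these and multiplies the
  number of entries only by (M + 1)^2.\<close>

definition extend :: "nat \<Rightarrow> nat \<Rightarrow> 'a list \<Rightarrow> nat list \<Rightarrow> nat list" where
  "extend p q l xs = concat (map (\<lambda>x. concat (map (\<lambda>e. map (\<lambda>f.
     x * unary_power p e * unary_power q f) (tails l)) (tails l))) xs)"

lemma set_extend:
  "set (extend p q l xs) = {x * p ^ e * q ^ f | x e f. x \<in> set xs \<and> e \<le> length l \<and> f \<le> length l}"
proof -
  have "e \<le> length l \<longleftrightarrow> (\<exists>t\<in>set (tails l). length t = e)" for e
    using length_tails[of l] by (metis atMost_iff image_iff)
  then show ?thesis unfolding extend_def unary_power by auto
qed

lemma polytime_extend [polytime_intros]:
  fixes p q :: "'x::tree_code \<Rightarrow> nat" and l :: "'x \<Rightarrow> 'a::tree_code list"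
  assumes "polytime p" "polytime q" "polytime l" "polytime xs"
  shows "polytime (\<lambda>x. extend (p x) (q x) (l x) (xs x))"
  unfolding extend_def
  by (intro polytime_intros polytime_comp[OF _ assms(1)] polytime_comp[OF _ assms(2)]
    polytime_comp[OF _ assms(3)] polytime_comp[OF _ assms(4)])

definition fractions :: "(nat \<times> nat) list \<Rightarrow> rat set" where
  "fractions gens = (\<lambda>(p, q). of_nat p / of_nat q) ` set gens"

text \<open>The number of generators is fixed, so iterating \<open>extend\<close> yields a list of
  polynomial length, (length l + 1)^(2 * length gens).\<close>

definition numer_list :: "(nat \<times> nat) list \<Rightarrow> 'a list \<Rightarrow> nat list" where
  "numer_list gens l = foldr (\<lambda>g xs. extend (fst g) (snd g) l xs) gens [1]"

definition denom :: "(nat \<times> nat) list \<Rightarrow> 'a list \<Rightarrow> nat" where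
  "denom gens l = foldr (\<lambda>g a. a * unary_power (snd g) l) gens 1"

lemma prod_list_filter:
  "prod_list cs = c ^ length (filter ((=) c) cs) * prod_list (filter ((\<noteq>) c) cs)" for c :: rat
  by (induction cs) auto

lemma power_of_fraction:
  fixes p q :: nat
  assumes "0 < q" "e \<le> M"
  shows "(of_nat p / of_nat q :: rat) ^ e = of_nat (p ^ e * q ^ (M - e)) / of_nat (q ^ M)"
proof -
  have "(of_nat q :: rat) ^ M = of_nat q ^ e * of_nat q ^ (M - e)"
    using assms(2) by (simp flip: power_add)
  then show ?thesis using assms(1) by (simp add: power_divide)
qed

text \<open>Only multiplicities matter: the factors equal to the first generator are split off as a
  power, and missing denominators are supplied up to the common one.\<close>

lemma prod_list_numer:
  assumes "\<And>g. g \<in> set gens \<Longrightarrow> 0 < snd g" "set cs \<subseteq> fractions gens" "length cs \<le> length l"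
  shows "\<exists>y\<in>set (numer_list gens l). prod_list cs = of_nat y / of_nat (denom gens l)"
  using assms
proof (induction gens arbitrary: cs)
  case Nil
  then show ?case by (simp add: fractions_def numer_list_def denom_def)
next
  case (Cons g gens)
  define c :: rat where "c = of_nat (fst g) / of_nat (snd g)"
  define e where "e = length (filter ((=) c) cs)"
  let ?cs = "filter ((\<noteq>) c) cs"
  have e: "e \<le> length l" unfolding e_def using Cons.prems(3) length_filter_le order_trans by blast
  have "set ?cs \<subseteq> fractions gens"
    using Cons.prems(2) unfolding fractions_def c_def by (auto simp: case_prod_beta)
  moreover have "length ?cs \<le> length l" using Cons.prems(3) length_filter_le order_trans by blast
  ultimately obtain y where y: "y \<in> set (numer_list gens l)" "prod_list ?cs = of_nat y / of_nat (denom gens l)"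
    using Cons.IH[of ?cs] Cons.prems(1) by auto
  have "prod_list cs = of_nat (y * fst g ^ e * snd g ^ (length l - e)) / of_nat (denom (g # gens) l)"
    unfolding prod_list_filter[of cs c] y(2) e_def[symmetric]
    unfolding c_def power_of_fraction[OF Cons.prems(1)[of g, simplified] e]
    by (simp add: denom_def unary_power mult_ac)
  moreover have "y * fst g ^ e * snd g ^ (length l - e) \<in> set (numer_list (g # gens) l)"
  proof -
    have "length l - e \<le> length l" by simp
    then show ?thesis using y(1) e unfolding numer_list_def foldr.simps o_apply set_extend by blast
  qed
  ultimately show ?case by blast
qed

text \<open>The number B in binary. The lists used here have length N + 1, so that \<open>tl\<close>
  gives the exponent N.\<close>

definition big :: "nat \<Rightarrow> 'a list \<Rightarrow> nat" where "big K l = unary_power (4 * K) (tl l)"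

text \<open>The additional generator B / (B + 1) is the inverse of 1 + 1 / B, the factor that
  diminishes a strict edge.\<close>

definition all_gens :: "nat \<Rightarrow> (nat \<times> nat) list \<Rightarrow> 'a list \<Rightarrow> (nat \<times> nat) list" where
  "all_gens K gens l = (big K l, Suc (big K l)) # gens"

definition common_denom :: "nat \<Rightarrow> (nat \<times> nat) list \<Rightarrow> 'a list \<Rightarrow> nat" where
  "common_denom K gens l = denom (all_gens K gens l) l"

definition domain :: "nat \<Rightarrow> (nat \<times> nat) list \<Rightarrow> 'a list \<Rightarrow> (nat \<times> nat) list" where
  "domain K gens l = (0, 0) # map (\<lambda>x. (x, 0)) (numer_list (all_gens K gens l) l)
     @ map (\<lambda>x. (0, x)) (numer_list (all_gens K gens l) l)"

lemma common_denom_pos: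
  assumes "\<And>g. g \<in> set gens \<Longrightarrow> 0 < snd g" shows "0 < common_denom K gens l"
proof -
  have "0 < denom gs l" if "\<And>g. g \<in> set gs \<Longrightarrow> 0 < snd g" for gs
    using that by (induction gs) (auto simp: denom_def unary_power)
  then show ?thesis using assms unfolding common_denom_def all_gens_def by (metis list.set_cases set_ConsD snd_conv zero_less_Suc)
qed

lemma samples_in_domain:
  assumes g: "\<And>g. g \<in> set gens \<Longrightarrow> 0 < snd g" and K: "1 \<le> K" and l: "length l = Suc N"
    and x: "x \<in> samples (fractions gens) N ((4 * of_nat K) ^ N)"
  shows "\<exists>y\<in>set (numer_list (all_gens K gens l) l). x = of_nat y / of_nat (common_denom K gens l)"
proof -
  define B where "B = big K l"
  have B: "(4 * of_nat K) ^ N = (of_nat B :: rat)" "0 < B"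
    using K l by (simp_all add: B_def big_def unary_power)
  obtain s cs m where x: "x = s * prod_list cs / (1 + 1 / of_nat B) ^ m" "s \<in> {1, of_nat B}"
    "set cs \<subseteq> fractions gens" "length cs \<le> N" "m \<le> N"
    using x unfolding samples_def B by blast
  obtain y where y: "y \<in> set (numer_list gens l)" "prod_list cs = of_nat y / of_nat (denom gens l)"
    using prod_list_numer[OF g x(3), of l] x(4) l by auto
  have "1 + 1 / of_nat B = (of_nat (Suc B) / of_nat B :: rat)" using B(2) by (simp add: field_simps)
  then have "1 / (1 + 1 / of_nat B) ^ m = (of_nat B / of_nat (Suc B) :: rat) ^ m"
    by (simp add: power_divide)
  also have "\<dots> = of_nat (B ^ m * Suc B ^ (length l - m)) / of_nat (Suc B ^ length l)"
    by (rule power_of_fraction) (use x(5) l in auto)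
  finally have "x = s * (of_nat y / of_nat (denom gens l)) * (of_nat (B ^ m * Suc B ^ (length l - m)) / of_nat (Suc B ^ length l))"
    unfolding x(1) y(2) by (metis mult.assoc mult.right_neutral times_divide_eq_right)
  moreover obtain t where t: "s = of_nat t" "t = 1 \<or> t = B" using x(2) by auto
  ultimately have "x = of_nat (y * (t * B ^ m) * Suc B ^ (length l - m)) / of_nat (common_denom K gens l)"
    by (simp add: common_denom_def all_gens_def denom_def unary_power B_def[symmetric] mult_ac)
  moreover have "y * (t * B ^ m) * Suc B ^ (length l - m) \<in> set (numer_list (all_gens K gens l) l)"
  proof -
    \<comment> \<open>The starting value B is absorbed as one more factor of the numerator. The
      exponent may then reach N + 1, which is why the list is one longer than N.\<close>
    obtain e where e: "e \<le> length l" "t * B ^ m = B ^ e"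
      using t(2) x(5) l by (metis Suc_le_mono le_SucI mult_1 power_Suc)
    have "length l - m \<le> length l" by simp
    then show ?thesis using y(1) e(1) unfolding e(2) all_gens_def numer_list_def foldr.simps o_apply
        set_extend fst_conv snd_conv B_def[symmetric] by blast
  qed
  ultimately show ?thesis by blast
qed

lemma signed_samples_in_domain:
  assumes g: "\<And>g. g \<in> set gens \<Longrightarrow> 0 < snd g" and K: "1 \<le> K" and l: "length l = Suc N"
    and C: "fractions gens = positive_part C"
  shows "signed_samples C K N \<subseteq> val (common_denom K gens l) ` set (domain K gens l)"
proof
  fix x assume "x \<in> signed_samples C K N"
  then consider "x = 0" | "x \<in> samples (fractions gens) N ((4 * of_nat K) ^ N)"
    | "- x \<in> samples (fractions gens) N ((4 * of_nat K) ^ N)"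
    unfolding signed_samples_def C by auto
  then show "x \<in> val (common_denom K gens l) ` set (domain K gens l)"
  proof cases
    case 1
    then show ?thesis by (intro image_eqI[of _ _ "(0, 0)"]) (simp_all add: val_def domain_def)
  next
    case 2
    then obtain y where "y \<in> set (numer_list (all_gens K gens l) l)" "x = of_nat y / of_nat (common_denom K gens l)"
      using samples_in_domain[OF g K l] by blast
    then show ?thesis by (intro image_eqI[of _ _ "(y, 0)"]) (simp_all add: val_def domain_def)
  next
    case 3
    then obtain y where "y \<in> set (numer_list (all_gens K gens l) l)" "- x = of_nat y / of_nat (common_denom K gens l)"
      using samples_in_domain[OF g K l] by blast
    then show ?thesis by (intro image_eqI[of _ _ "(0, y)"]) (simp_all add: val_def domain_def flip: minus_divide_left)
  qed
qed

lemma polytime_big [polytime_intros]: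
  fixes l :: "'x::tree_code \<Rightarrow> 'a::tree_code list"
  shows "polytime l \<Longrightarrow> polytime (\<lambda>x. big K (l x))"
  unfolding big_def by (intro polytime_intros)

lemma polytime_Suc [polytime_intros]: "polytime f \<Longrightarrow> polytime (\<lambda>x. Suc (f x))"
  using polytime_add[OF polytime_const[of 1], of f] by simp

lemma polytime_numer_list:
  fixes l :: "'x::tree_code \<Rightarrow> 'a::tree_code list"
  assumes l: "polytime l" shows "polytime (\<lambda>x. numer_list (all_gens K gens (l x)) (l x))"
proof -
  have "polytime (\<lambda>x. numer_list gens (l x))"
    unfolding numer_list_def by (induction gens) (simp_all add: polytime_const polytime_extend l)
  then have "polytime (\<lambda>x. extend (big K (l x)) (Suc (big K (l x))) (l x) (numer_list gens (l x)))"
    by (intro polytime_intros l)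
  then show ?thesis by (simp add: all_gens_def numer_list_def)
qed

lemma polytime_domain [polytime_intros]:
  fixes l :: "'x::tree_code \<Rightarrow> 'a::tree_code list"
  shows "polytime l \<Longrightarrow> polytime (\<lambda>x. domain K gens (l x))"
  unfolding domain_def by (intro polytime_intros polytime_numer_list)

lemma polytime_common_denom [polytime_intros]:
  fixes l :: "'x::tree_code \<Rightarrow> 'a::tree_code list"
  assumes l: "polytime l" shows "polytime (\<lambda>x. common_denom K gens (l x))"
proof -
  have "polytime (\<lambda>x. denom gens (l x))"
    unfolding denom_def by (induction gens) (simp_all add: polytime_const polytime_mult polytime_unary_power l)
  then have "polytime (\<lambda>x. denom gens (l x) * unary_power (Suc (big K (l x))) (l x))"
    by (intro polytime_intros l)
  then show ?thesis by (simp add: common_denom_def all_gens_def denom_def)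
qed

section \<open>The descent on represented values\<close>

definition vless :: "nat \<times> nat \<Rightarrow> nat \<times> nat \<Rightarrow> bool" where
  "vless y z \<longleftrightarrow> fst y + snd z < fst z + snd y"

lemma vless: "0 < W \<Longrightarrow> vless y z \<longleftrightarrow> val W y < val W z"
proof -
  assume W: "0 < W"
  have "vless y z \<longleftrightarrow> (of_nat (fst y + snd z) :: rat) < of_nat (fst z + snd y)"
    unfolding vless_def of_nat_less_iff ..
  also have "\<dots> \<longleftrightarrow> val W y < val W z" using W unfolding val_def by (simp add: divide_less_cancel) linarith
  finally show ?thesis .
qed

lemma polytime_vless [polytime_intros]:
  "polytime f \<Longrightarrow> polytime g \<Longrightarrow> polytime (\<lambda>x. vless (f x) (g x))"
  unfolding vless_def by (intro polytime_intros)

text \<open>The accumulator starts at \<open>y\<close>; as long as it is not below \<open>y\<close>,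
  no smaller candidate has been met.\<close>

definition pred_in :: "(nat \<times> nat) list \<Rightarrow> nat \<times> nat \<Rightarrow> nat \<times> nat" where
  "pred_in D y = foldl (\<lambda>m d. if vless d y \<and> (\<not> vless m y \<or> vless m d) then d else m) y D"

lemma pred_in_props:
  assumes W: "0 < (W::nat)"
  shows "(\<forall>d\<in>set D. \<not> vless d y) \<and> pred_in D y = y \<or>
    pred_in D y \<in> set D \<and> vless (pred_in D y) y \<and> (\<forall>d\<in>set D. vless d y \<longrightarrow> \<not> vless (pred_in D y) d)"
proof (induction D rule: rev_induct)
  case (snoc d D)
  have *: "pred_in (D @ [d]) y = (if vless d y \<and> (\<not> vless (pred_in D y) y \<or> vless (pred_in D y) d) then d else pred_in D y)"
    by (simp only: pred_in_def foldl_append foldl.simps)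
  show ?case using snoc unfolding * vless[OF W] by auto
qed (simp add: pred_in_def)

lemma val_pred_in:
  assumes W: "0 < W" shows "val W (pred_in D y) = lower (val W ` set D) (val W y)"
proof -
  let ?D = "val W ` set D"
  consider "\<forall>d\<in>set D. \<not> vless d y" "pred_in D y = y"
    | "pred_in D y \<in> set D" "vless (pred_in D y) y" "\<forall>d\<in>set D. vless d y \<longrightarrow> \<not> vless (pred_in D y) d"
    using pred_in_props[OF W, of D y] by blast
  then show ?thesis
  proof cases
    case 1
    then show ?thesis unfolding lower_def vless[OF W] by auto
  next
    case 2
    have "Max {d \<in> ?D. d < val W y} = val W (pred_in D y)"
      using 2 unfolding vless[OF W] by (intro Max_eqI) (auto simp: not_less)
    then show ?thesis using 2 unfolding lower_def vless[OF W] by auto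
  qed
qed

lemma pred_in_mem: "pred_in D y \<in> insert y (set D)"
  using pred_in_props[of 1 D y] by auto

lemma esize_fold_choice:
  "a \<in> {s, t} \<Longrightarrow> esize a \<le> esize s + (esize x + esize t + 2) ^ 1"
  by auto

lemma polytime_pred_in [polytime_intros]:
  fixes D :: "'x::tree_code \<Rightarrow> (nat \<times> nat) list"
  assumes "polytime D" "polytime y" shows "polytime (\<lambda>x. pred_in (D x) (y x))"
proof -
  have y: "polytime (\<lambda>q::('x \<times> (nat \<times> nat)) \<times> (nat \<times> nat). y (fst (fst q)))"
    by (intro polytime_comp[OF _ assms(2)] polytime_intros)
  show ?thesis unfolding pred_in_def
    by (rule polytime_foldl_additive[where d = 1])
      (intro polytime_intros assms y | rule esize_fold_choice; simp)+
qed

text \<open>The initial value represents 0, which belongs to every \<open>domain\<close>, so there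
  the result is again a candidate.\<close>

definition top_of :: "(nat \<times> nat) list \<Rightarrow> nat \<times> nat" where
  "top_of D = foldl (\<lambda>m d. if vless m d then d else m) (0, 0) D"

lemma top_of: "top_of D \<in> insert (0, 0) (set D)" "0 < W \<Longrightarrow> d \<in> set D \<Longrightarrow> val W d \<le> val W (top_of D)"
proof (induction D arbitrary: d rule: rev_induct)
  case (snoc e D)
  have *: "top_of (D @ [e]) = (if vless (top_of D) e then e else top_of D)"
    by (simp add: top_of_def)
  { case 1 show ?case using snoc(1) unfolding * by auto }
  { case 2
    then show ?case using snoc(2)[of d] unfolding * vless[OF 2(1)] by auto }
qed (simp_all add: top_of_def)

lemma polytime_top_of [polytime_intros]:
  assumes "polytime D" shows "polytime (\<lambda>x. top_of (D x))"
  unfolding top_of_def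
  by (rule polytime_foldl_additive[where d = 1]) (intro polytime_intros assms | rule esize_fold_choice; simp)+

type_synonym assoc = "(nat list \<times> nat \<times> nat) list"

text \<open>A name may have several entries; in the assignments considered, these carry the same
  value.\<close>

definition lookup :: "assoc \<Rightarrow> nat list \<Rightarrow> nat \<times> nat" where
  "lookup u t = foldl (\<lambda>r e. if fst e = t then snd e else r) (0, 0) u"

lemma lookup_map:
  assumes "t \<in> set ts" shows "lookup (map (\<lambda>t. (t, h t)) ts) t = h t"
proof -
  have "foldl (\<lambda>r e. if fst e = t then snd e else r) r (map (\<lambda>t. (t, h t)) ts) = (if t \<in> set ts then h t else r)" for r
    by (induction ts arbitrary: r) auto
  then show ?thesis using assms unfolding lookup_def by simp
qed

lemma polytime_lookup [polytime_intros]: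
  fixes u :: "'x::tree_code \<Rightarrow> assoc"
  assumes "polytime u" "polytime t" shows "polytime (\<lambda>x. lookup (u x) (t x))"
proof -
  have t: "polytime (\<lambda>q::('x \<times> (nat \<times> nat)) \<times> (nat list \<times> nat \<times> nat). t (fst (fst q)))"
    by (intro polytime_comp[OF _ assms(2)] polytime_intros)
  show ?thesis unfolding lookup_def
  proof (rule polytime_foldl_additive[where d = 1])
    fix x and s :: "nat \<times> nat" and a :: "nat list \<times> nat \<times> nat"
    show "esize (if fst a = t x then snd a else s) \<le> esize s + (esize x + esize a + 2) ^ 1"
      by (cases a) auto
  qed (intro polytime_intros assms t)+
qed

lemma esize_assoc:
  assumes "\<And>e. e \<in> set u \<Longrightarrow> esize e \<le> M" shows "esize u \<le> length u * Suc M + 1"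
  using assms by (induction u) (simp, force)

text \<open>Gathers what is fixed with the structure: the constants, the generators and, for each
  relation and coordinate, a test in polynomial time. All that depends on the instance is computed
  from it.\<close>

locale max_closed_template =
  fixes A :: qstruct and code :: "nat \<Rightarrow> nat list" and C :: "rat set" and K :: nat and gens :: "(nat \<times> nat) list"
    and P :: "nat \<Rightarrow> (nat \<times> nat) list \<Rightarrow> bool" and T :: "nat \<Rightarrow> nat \<Rightarrow> (nat \<times> nat) list \<Rightarrow> bool"
  assumes rels: "\<And>j. j < length A \<Longrightarrow> (\<forall>xs\<in>snd (A ! j). length xs = fst (A ! j)) \<and>
      max_closed (snd (A ! j)) \<and> determines C (fst (A ! j)) (snd (A ! j))"
    and code: "inj_on code {..<length A}"
    and C: "finite C" "1 \<le> K" "\<And>c. c \<in> positive_part C \<Longrightarrow> small_fraction K c"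
    and gens: "fractions gens = positive_part C" "\<And>g. g \<in> set gens \<Longrightarrow> 0 < snd g"
    and P: "\<And>j. j < length A \<Longrightarrow> polytime (P j)"
      "\<And>j W ys. j < length A \<Longrightarrow> 0 < W \<Longrightarrow> length ys = fst (A ! j) \<Longrightarrow>
        P j ((W, 0) # ys) \<longleftrightarrow> map (val W) ys \<in> snd (A ! j)"
    and T: "\<And>j p. j < length A \<Longrightarrow> p < fst (A ! j) \<Longrightarrow> polytime (T j p)"
      "\<And>j p W ys. j < length A \<Longrightarrow> p < fst (A ! j) \<Longrightarrow> 0 < W \<Longrightarrow> length ys = fst (A ! j) \<Longrightarrow>
        T j p ((W, 0) # ys) \<longleftrightarrow> map (val W) ys \<in> attained (fst (A ! j)) (snd (A ! j)) p"
begin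

text \<open>A constraint is given by the code of its relation followed by the names of its variables.\<close>
definition wf_con :: "nat list list \<Rightarrow> bool" where
  "wf_con ts \<longleftrightarrow> (\<exists>j<length A. hd ts = code j \<and> length (tl ts) = fst (A ! j))"

definition constraints :: "nat list list list \<Rightarrow> nat list constraint set" where
  "constraints cs = {(tl ts, fst (A ! j), snd (A ! j)) | ts j. ts \<in> set cs \<and> j < length A \<and> hd ts = code j}"

definition blk :: "nat \<Rightarrow> assoc \<Rightarrow> nat list \<Rightarrow> nat list list \<Rightarrow> bool" where
  "blk W u x ts \<longleftrightarrow> (\<exists>j\<in>{..<length A}. \<exists>p\<in>{..<fst (A ! j)}. hd ts = code j \<and> hd (drop p (tl ts)) = x \<and>
     \<not> T j p ((W, 0) # map (lookup u) (tl ts)))"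

definition adjust :: "nat \<Rightarrow> (nat \<times> nat) list \<Rightarrow> nat list list list \<Rightarrow> assoc \<Rightarrow> assoc" where
  "adjust W D cs u = map (\<lambda>e. (fst e, if list_ex (blk W u (fst e)) cs then pred_in D (snd e) else snd e)) u"

definition holds :: "nat \<Rightarrow> nat list list list \<Rightarrow> assoc \<Rightarrow> bool" where
  "holds W cs u \<longleftrightarrow> list_all (\<lambda>ts. \<exists>j\<in>{..<length A}. hd ts = code j \<and> P j ((W, 0) # map (lookup u) (tl ts))) cs"

definition names :: "nat list list list \<Rightarrow> nat list list" where
  "names cs = concat (map tl cs)"

text \<open>The two dummy entries only adjust the unary length: with N = length (names cs) + 1,
  leaving room for the constant 1, a list of length N + 1 is required.\<close>

definition scale :: "nat list list list \<Rightarrow> nat" where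
  "scale cs = common_denom K gens ([] # [] # names cs)"

definition cand :: "nat list list list \<Rightarrow> (nat \<times> nat) list" where
  "cand cs = domain K gens ([] # [] # names cs)"

text \<open>A unary counter: its length is an upper bound for the number of variables times the
  number of candidates, hence for \<open>rank\<close>.\<close>

definition rounds :: "nat list list list \<Rightarrow> (nat \<times> nat) list" where
  "rounds cs = concat (map (\<lambda>_. cand cs) (names cs))"

definition start_values :: "nat list list list \<Rightarrow> assoc" where
  "start_values cs = map (\<lambda>t. (t, top_of (cand cs))) (names cs)"

definition decide :: "nat list list list \<Rightarrow> bool" where
  "decide cs \<longleftrightarrow> holds (scale cs) cs ((adjust (scale cs) (cand cs) cs ^^ length (rounds cs)) (start_values cs))"

lemma scale_pos: "0 < scale cs"
  unfolding scale_def by (rule common_denom_pos[OF gens(2)])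

lemma constraints_wf:
  assumes "\<forall>ts\<in>set cs. wf_con ts" "(vs, k, R) \<in> constraints cs"
  shows "length vs = k \<and> set vs \<subseteq> set (names cs) \<and> (\<forall>xs\<in>R. length xs = k) \<and> max_closed R \<and> determines C k R"
proof -
  obtain ts j where ts: "vs = tl ts" "k = fst (A ! j)" "R = snd (A ! j)" "ts \<in> set cs" "j < length A" "hd ts = code j"
    using assms(2) unfolding constraints_def by blast
  obtain j' where "j' < length A" "hd ts = code j'" "length (tl ts) = fst (A ! j')"
    using assms(1) ts(4) unfolding wf_con_def by blast
  moreover from this ts have "j' = j" using inj_onD[OF code, of j j'] by simp
  moreover have "set vs \<subseteq> set (names cs)" using ts(1,4) unfolding names_def by auto
  ultimately show ?thesis using rels[OF ts(5)] ts by simp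
qed

definition represents :: "nat list list list \<Rightarrow> assoc \<Rightarrow> (nat list \<Rightarrow> rat) \<Rightarrow> bool" where
  "represents cs u f \<longleftrightarrow> (\<exists>h. u = map (\<lambda>t. (t, h t)) (names cs) \<and> (\<forall>t\<in>set (names cs). f t = val (scale cs) (h t)))"

lemma represents_lookup:
  assumes "represents cs u f" "set vs \<subseteq> set (names cs)"
  shows "map (val (scale cs)) (map (lookup u) vs) = map f vs"
proof -
  obtain h where h: "u = map (\<lambda>t. (t, h t)) (names cs)" "\<forall>t\<in>set (names cs). f t = val (scale cs) (h t)"
    using assms(1) unfolding represents_def by blast
  have "val (scale cs) (lookup u t) = f t" if "t \<in> set vs" for t
  proof -
    have "t \<in> set (names cs)" using that assms(2) by blast
    then show ?thesis using lookup_map[of t "names cs" h] h by simp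
  qed
  then show ?thesis by simp
qed

lemma blk_blocked:
  assumes wf: "\<forall>ts\<in>set cs. wf_con ts" and u: "represents cs u f" and ts: "ts \<in> set cs"
  shows "blk (scale cs) u x ts \<longleftrightarrow> (\<exists>j<length A. hd ts = code j \<and> blocked f x (tl ts, fst (A ! j), snd (A ! j)))"
proof -
  have "hd (drop p (tl ts)) = x \<and> \<not> T j p ((scale cs, 0) # map (lookup u) (tl ts)) \<longleftrightarrow>
      tl ts ! p = x \<and> map f (tl ts) \<notin> attained (fst (A ! j)) (snd (A ! j)) p"
    if j: "j < length A" "hd ts = code j" and p: "p < fst (A ! j)" for j p
  proof -
    have "(tl ts, fst (A ! j), snd (A ! j)) \<in> constraints cs" using ts j unfolding constraints_def by blast
    from constraints_wf[OF wf this] have len: "length (tl ts) = fst (A ! j)" and vs: "set (tl ts) \<subseteq> set (names cs)"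
      by auto
    have "T j p ((scale cs, 0) # map (lookup u) (tl ts)) \<longleftrightarrow>
        map (val (scale cs)) (map (lookup u) (tl ts)) \<in> attained (fst (A ! j)) (snd (A ! j)) p"
      by (rule T(2)[OF j(1) p scale_pos]) (use len in simp)
    then have "T j p ((scale cs, 0) # map (lookup u) (tl ts)) \<longleftrightarrow> map f (tl ts) \<in> attained (fst (A ! j)) (snd (A ! j)) p"
      unfolding represents_lookup[OF u vs] .
    then show ?thesis using p len by (simp add: hd_drop_conv_nth)
  qed
  then show ?thesis unfolding blk_def blocked_def prod.case by blast
qed

lemma adjust_represents:
  assumes wf: "\<forall>ts\<in>set cs. wf_con ts" and u: "represents cs u f"
  shows "represents cs (adjust (scale cs) (cand cs) cs u) (descend (val (scale cs) ` set (cand cs)) (constraints cs) f)"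
proof -
  obtain h where h: "u = map (\<lambda>t. (t, h t)) (names cs)" "\<forall>t\<in>set (names cs). f t = val (scale cs) (h t)"
    using u unfolding represents_def by blast
  define h' where "h' = (\<lambda>t. if list_ex (blk (scale cs) u t) cs then pred_in (cand cs) (h t) else h t)"
  have b: "list_ex (blk (scale cs) u t) cs \<longleftrightarrow> (\<exists>c\<in>constraints cs. blocked f t c)" for t
  proof -
    have "list_ex (blk (scale cs) u t) cs \<longleftrightarrow> (\<exists>ts\<in>set cs. \<exists>j<length A. hd ts = code j \<and>
        blocked f t (tl ts, fst (A ! j), snd (A ! j)))"
      unfolding list_ex_iff using blk_blocked[OF wf u] by blast
    then show ?thesis unfolding constraints_def by blast
  qed
  have "adjust (scale cs) (cand cs) cs u = map (\<lambda>t. (t, h' t)) (names cs)"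
    unfolding adjust_def h'_def by (subst (2) h(1)) simp
  moreover have "descend (val (scale cs) ` set (cand cs)) (constraints cs) f t = val (scale cs) (h' t)"
    if "t \<in> set (names cs)" for t
    using h(2) that unfolding descend_def h'_def b by (simp add: val_pred_in[OF scale_pos])
  ultimately show ?thesis unfolding represents_def by blast
qed

lemma iterate_represents:
  assumes wf: "\<forall>ts\<in>set cs. wf_con ts"
  shows "represents cs ((adjust (scale cs) (cand cs) cs ^^ n) (start_values cs))
    ((descend (val (scale cs) ` set (cand cs)) (constraints cs) ^^ n) (\<lambda>_. val (scale cs) (top_of (cand cs))))"
proof (induction n)
  case 0
  have "represents cs (start_values cs) (\<lambda>_. val (scale cs) (top_of (cand cs)))"
    unfolding represents_def start_values_def by (intro exI[of _ "\<lambda>_. top_of (cand cs)"]) simp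
  then show ?case by simp
next
  case (Suc n)
  then show ?case using adjust_represents[OF wf] by simp
qed

lemma holds_satisfies:
  assumes wf: "\<forall>ts\<in>set cs. wf_con ts" and u: "represents cs u f"
  shows "holds (scale cs) cs u \<longleftrightarrow> (\<forall>c\<in>constraints cs. satisfies f c)"
proof -
  have eq: "P j ((scale cs, 0) # map (lookup u) (tl ts)) \<longleftrightarrow> satisfies f (tl ts, fst (A ! j), snd (A ! j))"
    if "ts \<in> set cs" "j < length A" "hd ts = code j" for ts j
  proof -
    have "(tl ts, fst (A ! j), snd (A ! j)) \<in> constraints cs" using that unfolding constraints_def by blast
    from constraints_wf[OF wf this] have len: "length (tl ts) = fst (A ! j)"
      and vs: "set (tl ts) \<subseteq> set (names cs)" by auto
    have "P j ((scale cs, 0) # map (lookup u) (tl ts)) \<longleftrightarrow> map (val (scale cs)) (map (lookup u) (tl ts)) \<in> snd (A ! j)"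
      by (rule P(2)[OF that(2) scale_pos]) (use len in simp)
    then show ?thesis unfolding represents_lookup[OF u vs] satisfies_def prod.case .
  qed
  show ?thesis
  proof
    assume h: "holds (scale cs) cs u"
    show "\<forall>c\<in>constraints cs. satisfies f c"
    proof
      fix c assume "c \<in> constraints cs"
      then obtain ts j where c: "c = (tl ts, fst (A ! j), snd (A ! j))" "ts \<in> set cs" "j < length A" "hd ts = code j"
        unfolding constraints_def by blast
      obtain j' where j': "j' < length A" "hd ts = code j'" "P j' ((scale cs, 0) # map (lookup u) (tl ts))"
        using h c(2) unfolding holds_def list_all_iff by blast
      have "j' = j" using inj_onD[OF code, of j j'] j' c by simp
      then show "satisfies f c" using eq[OF c(2-4)] j'(3) c(1) by simp
    qed
  next
    assume s: "\<forall>c\<in>constraints cs. satisfies f c"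
    show "holds (scale cs) cs u" unfolding holds_def list_all_iff
    proof
      fix ts assume ts: "ts \<in> set cs"
      obtain j where j: "j < length A" "hd ts = code j" using wf ts unfolding wf_con_def by blast
      have "(tl ts, fst (A ! j), snd (A ! j)) \<in> constraints cs" using ts j unfolding constraints_def by blast
      then show "\<exists>j\<in>{..<length A}. hd ts = code j \<and> P j ((scale cs, 0) # map (lookup u) (tl ts))"
        using s eq[OF ts j] j by blast
    qed
  qed
qed

text \<open>The final test makes acceptance sound in any case. If a solution exists, there is one
  among the samples; it lies below the start values, and the rounds suffice to reach a fixpoint
  above it.\<close>

theorem decide_correct:
  assumes wf: "\<forall>ts\<in>set cs. wf_con ts"
  shows "decide cs \<longleftrightarrow> (\<exists>s. \<forall>c\<in>constraints cs. satisfies s c)"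
proof -
  let ?D = "val (scale cs) ` set (cand cs)"
  let ?f = "(descend ?D (constraints cs) ^^ length (rounds cs)) (\<lambda>_. val (scale cs) (top_of (cand cs)))"
  have d: "decide cs \<longleftrightarrow> (\<forall>c\<in>constraints cs. satisfies ?f c)"
    unfolding decide_def by (rule holds_satisfies[OF wf iterate_represents[OF wf]])
  interpret max_closed_instance ?D "constraints cs" "set (names cs)"
    by standard (use constraints_wf[OF wf] in auto)
  have "\<forall>c\<in>constraints cs. satisfies ?f c" if sol: "\<forall>c\<in>constraints cs. satisfies s c" for s
  proof -
    have "\<exists>s'. (\<forall>x\<in>set (names cs). s' x \<in> signed_samples C K (Suc (length (names cs)))) \<and> (\<forall>c\<in>constraints cs. satisfies s' c)"
    proof (rule solution_in_samples[OF C, of "set (names cs)"])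
      show "card (set (names cs)) < Suc (length (names cs))" using card_length[of "names cs"] by simp
      show "\<And>vs k R. (vs, k, R) \<in> constraints cs \<Longrightarrow> length vs = k \<and> set vs \<subseteq> set (names cs) \<and> determines C k R"
        using constraints_wf[OF wf] by blast
    qed (use sol in auto)
    moreover have "signed_samples C K (Suc (length (names cs))) \<subseteq> ?D"
      unfolding scale_def cand_def by (rule signed_samples_in_domain[OF gens(2) C(2) _ gens(1)]) simp_all
    ultimately obtain s' where s': "\<And>x. x \<in> set (names cs) \<Longrightarrow> s' x \<in> ?D" "\<And>c. c \<in> constraints cs \<Longrightarrow> satisfies s' c"
      by blast
    have top: "s' x \<le> val (scale cs) (top_of (cand cs))" if "x \<in> set (names cs)" for x
      using s'(1)[OF that] top_of(2)[OF scale_pos] by auto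
    have "card (set (names cs)) * card ?D \<le> length (names cs) * length (cand cs)"
      using card_length[of "names cs"] card_image_le[of "set (cand cs)" "val (scale cs)"] card_length[of "cand cs"]
      by (intro mult_le_mono) auto
    also have "\<dots> = length (rounds cs)" unfolding rounds_def by (simp add: length_concat comp_def sum_list_triv)
    finally show ?thesis using descend_complete[OF s'(2,1) top] by blast
  qed
  then show ?thesis unfolding d by blast
qed

lemma polytime_names [polytime_intros]: "polytime f \<Longrightarrow> polytime (\<lambda>x. names (f x))"
  unfolding names_def by (intro polytime_intros)

lemma polytime_scale [polytime_intros]: "polytime f \<Longrightarrow> polytime (\<lambda>x. scale (f x))"
  unfolding scale_def by (intro polytime_intros)

lemma polytime_cand [polytime_intros]: "polytime f \<Longrightarrow> polytime (\<lambda>x. cand (f x))"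
  unfolding cand_def by (intro polytime_intros)

lemma polytime_blk:
  assumes "polytime W" "polytime u" "polytime t" "polytime ts"
  shows "polytime (\<lambda>x. blk (W x) (u x) (t x) (ts x))"
proof -
  have l: "polytime (\<lambda>x. (W x, 0) # map (lookup (u x)) (tl (ts x)))"
    by (intro polytime_intros assms polytime_comp[OF _ assms(2)])
  show ?thesis unfolding blk_def
    by (intro polytime_finite_ex polytime_intros assms polytime_comp[OF l T(1)]) auto
qed

lemma polytime_holds:
  assumes "polytime W" "polytime u" "polytime cs"
  shows "polytime (\<lambda>x. holds (W x) (cs x) (u x))"
proof -
  have l: "polytime (\<lambda>p. (W (fst p), 0) # map (lookup (u (fst p))) (tl (snd p)))"
    by (intro polytime_intros polytime_comp[OF _ assms(1)] polytime_comp[OF _ assms(2)])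
  show ?thesis unfolding holds_def
    by (intro polytime_list_all polytime_finite_ex polytime_intros assms polytime_comp[OF l P(1)]) auto
qed

lemma polytime_adjust: "polytime (\<lambda>p. adjust (scale (fst p)) (cand (fst p)) (fst p) (snd p))"
  unfolding adjust_def by (intro polytime_intros polytime_blk)

lemma adjust_domain:
  assumes "fst ` set u \<subseteq> X \<and> snd ` set u \<subseteq> set D"
  shows "fst ` set (adjust W D cs u) \<subseteq> X \<and> snd ` set (adjust W D cs u) \<subseteq> set D"
proof -
  have "pred_in D (snd e) \<in> set D" if "e \<in> set u" for e using pred_in_mem[of D "snd e"] assms that by auto
  then show ?thesis using assms unfolding adjust_def by auto
qed

text \<open>Sizes cannot grow during the rounds: names are unchanged, and every value remains a
  member of the list \<open>cand cs\<close>, which is computed once from the instance.\<close>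

theorem polytime_decide: "polytime decide"
proof -
  have n: "polytime names" and d: "polytime cand"
    using polytime_names[OF polytime_id] polytime_cand[OF polytime_id] by simp_all
  obtain dn where dn: "\<And>cs. esize (names cs) \<le> (esize cs + 2) ^ dn" by (rule polytime_size[OF n]) blast
  obtain dd where dd: "\<And>cs. esize (cand cs) \<le> (esize cs + 2) ^ dd" by (rule polytime_size[OF d]) blast
  have "polytime (\<lambda>cs. (adjust (scale cs) (cand cs) cs ^^ length (rounds cs)) (start_values cs))"
  proof (rule polytime_funpow[OF _ _ polytime_adjust, where
      b = "\<lambda>n. (n + 2) ^ dn * Suc (Suc ((n + 2) ^ dn + (n + 2) ^ dd)) + 1"])
    show "polytime rounds" unfolding rounds_def
      by (intro polytime_intros polytime_comp[OF _ d])
    show "polytime start_values" unfolding start_values_def by (intro polytime_intros)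
    fix cs and i :: nat
    let ?u = "(adjust (scale cs) (cand cs) cs ^^ i) (start_values cs)"
    have "(0, 0) \<in> set (cand cs)" by (simp add: cand_def domain_def)
    then have "top_of (cand cs) \<in> set (cand cs)" using top_of(1)[of "cand cs"] by (simp add: insert_absorb)
    then have "fst ` set ?u \<subseteq> set (names cs) \<and> snd ` set ?u \<subseteq> set (cand cs)"
    proof (induction i)
      case 0
      then show ?case by (auto simp: start_values_def)
    next
      case (Suc i)
      show ?case unfolding funpow.simps o_apply by (rule adjust_domain) (rule Suc.IH[OF Suc.prems])
    qed
    then have "esize e \<le> Suc ((esize cs + 2) ^ dn + (esize cs + 2) ^ dd)" if "e \<in> set ?u" for e
    proof -
      have "fst e \<in> set (names cs)" "snd e \<in> set (cand cs)"
        using that \<open>fst ` set ?u \<subseteq> set (names cs) \<and> snd ` set ?u \<subseteq> set (cand cs)\<close> by blast+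
      then have "esize (fst e) \<le> (esize cs + 2) ^ dn" "esize (snd e) \<le> (esize cs + 2) ^ dd"
        using esize_member[of "fst e" "names cs"] esize_member[of "snd e" "cand cs"] dn[of cs] dd[of cs] by linarith+
      then show ?thesis using esize_pair[of "fst e" "snd e"] by simp
    qed
    then have "esize ?u \<le> length ?u * Suc (Suc ((esize cs + 2) ^ dn + (esize cs + 2) ^ dd)) + 1"
      by (rule esize_assoc)
    moreover have "length ?u = length (names cs)" by (induction i) (simp_all add: start_values_def adjust_def)
    moreover have "length (names cs) \<le> (esize cs + 2) ^ dn"
      using length_le_esize[of "names cs"] dn[of cs] by linarith
    then have "length (names cs) * Suc (Suc ((esize cs + 2) ^ dn + (esize cs + 2) ^ dd))
      \<le> (esize cs + 2) ^ dn * Suc (Suc ((esize cs + 2) ^ dn + (esize cs + 2) ^ dd))" by (rule mult_le_mono1)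
    ultimately show "esize ?u \<le> (esize cs + 2) ^ dn * Suc (Suc ((esize cs + 2) ^ dn + (esize cs + 2) ^ dd)) + 1"
      by (simp only: add_le_cancel_right order_trans)
  qed (intro poly_intros)
  then show ?thesis unfolding decide_def by (intro polytime_holds polytime_intros)
qed

end

section \<open>Instances as words\<close>

declare enc_nat.simps [simp del]

lemma set_enc_nat: "set (enc_nat n) \<subseteq> {1, 2}"
proof (induction n rule: enc_nat.induct)
  case (1 n)
  then show ?case by (cases "n = 0") (auto simp: enc_nat.simps[of n] enc_nat.simps[of 0])
qed

lemma enc_nat_symb: "x \<in> set (enc_nat n) \<Longrightarrow> x = 1 \<or> x = 2"
  using set_enc_nat[of n] by auto

definition dec_nat :: "nat list \<Rightarrow> nat" where
  "dec_nat w = foldr (\<lambda>b n. (b - 1) + 2 * n) w 0"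

lemma dec_enc_nat [simp]: "dec_nat (enc_nat n) = n"
proof (induction n rule: enc_nat.induct)
  case (1 n)
  then show ?case by (cases "n = 0") (simp_all add: enc_nat.simps[of n] enc_nat.simps[of 0] dec_nat_def)
qed

lemma enc_nat_inject: "enc_nat m = enc_nat n \<longleftrightarrow> m = n"
  by (metis dec_enc_nat)

text \<open>The separator acts as a terminator, since a piece is emitted only when \<open>c\<close>
  is met. Within an atom 3 merely separates, so \<open>parse\<close> appends one.\<close>

definition split_step :: "nat \<Rightarrow> nat list list \<times> nat list \<Rightarrow> nat \<Rightarrow> nat list list \<times> nat list" where
  "split_step c s x = (if x = c then (fst s @ [rev (snd s)], []) else (fst s, x # snd s))"

definition split_at :: "nat \<Rightarrow> nat list \<Rightarrow> nat list list" where
  "split_at c w = fst (foldl (split_step c) ([], []) w)"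

lemma split_piece: "c \<notin> set b \<Longrightarrow> foldl (split_step c) (acc, cur) b = (acc, rev b @ cur)"
  by (induction b arbitrary: cur) (auto simp: split_step_def)

lemma split_at_concat:
  assumes "\<And>b. b \<in> set bs \<Longrightarrow> c \<notin> set b" shows "split_at c (concat (map (\<lambda>b. b @ [c]) bs)) = bs"
proof -
  have "foldl (split_step c) (acc, []) (concat (map (\<lambda>b. b @ [c]) bs)) = (acc @ bs, [])" for acc
    using assms
  proof (induction bs arbitrary: acc)
    case (Cons b bs)
    have "foldl (split_step c) (acc, []) (b @ [c]) = (acc @ [b], [])"
      using split_piece[of c b acc "[]"] Cons.prems by (simp add: split_step_def)
    moreover have "foldl (split_step c) (acc @ [b], []) (concat (map (\<lambda>b. b @ [c]) bs)) = ((acc @ [b]) @ bs, [])"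
      by (rule Cons.IH) (simp add: Cons.prems)
    ultimately have "foldl (split_step c) (acc, []) ((b @ [c]) @ concat (map (\<lambda>b. b @ [c]) bs)) = ((acc @ [b]) @ bs, [])"
      by (simp only: foldl_append[of _ _ "b @ [c]"])
    then show ?case by simp
  qed simp
  then show ?thesis by (simp add: split_at_def)
qed

lemma polytime_split_at [polytime_intros]:
  assumes "polytime f" shows "polytime (\<lambda>x. split_at c (f x))"
proof -
  have "polytime (\<lambda>x. foldl (split_step c) ([], []) (f x))"
  proof (rule polytime_foldl_additive[where d = 1])
    show "polytime (\<lambda>p. split_step c (snd (fst p)) (snd p))"
      unfolding split_step_def by (intro polytime_intros)
    fix x :: 'a and s :: "nat list list \<times> nat list" and a :: nat
    obtain acc cur where s: "s = (acc, cur)" by fastforce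
    show "esize (split_step c s a) \<le> esize s + (esize x + esize a + 2) ^ 1"
      using esize_append[of acc "[rev cur]"] by (simp add: s split_step_def)
  qed (intro polytime_intros assms)+
  then show ?thesis unfolding split_at_def by (intro polytime_intros)
qed

text \<open>An equality constraint becomes a constraint for an additional binary relation with code [5].\<close>
definition normalize :: "nat list list \<Rightarrow> nat list list" where
  "normalize ts = (if hd ts \<noteq> [] \<and> hd (hd ts) = 5 then [5] # tl (hd ts) # tl ts else ts)"

definition parse :: "nat list \<Rightarrow> nat list list list" where
  "parse w = map (\<lambda>a. normalize (split_at 3 (a @ [3]))) (split_at 4 w)"

fun tokens :: "atom \<Rightarrow> nat list list" where
  "tokens (Rel i vs) = enc_nat i # map enc_nat vs"
| "tokens (EqA u v) = [[5], enc_nat u, enc_nat v]"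

lemma polytime_parse: "polytime parse"
  unfolding parse_def normalize_def by (intro polytime_intros)

fun atom_body :: "atom \<Rightarrow> nat list" where
  "atom_body (Rel i vs) = enc_nat i @ concat (map (\<lambda>v. 3 # enc_nat v) vs)"
| "atom_body (EqA u v) = 5 # enc_nat u @ 3 # enc_nat v"

lemma enc_atom_body: "enc_atom a = atom_body a @ [4]"
  by (cases a) simp_all

lemma set_atom_body: "set (atom_body a) \<subseteq> {1, 2, 3, 5}"
  by (cases a) (auto dest!: enc_nat_symb)

lemma normalize_atom_body: "normalize (split_at 3 (atom_body a @ [3])) = tokens a"
proof (cases a)
  case (Rel i vs)
  have "x @ concat (map (\<lambda>v. 3 # enc_nat v) vs) @ [3] = concat (map (\<lambda>b. b @ [3]) (x # map enc_nat vs))" for x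
    by (induction vs arbitrary: x) simp_all
  then have "split_at 3 (atom_body a @ [3]) = enc_nat i # map enc_nat vs"
    using split_at_concat[of "enc_nat i # map enc_nat vs" 3] Rel enc_nat_symb by fastforce
  moreover have "\<not> (enc_nat i \<noteq> [] \<and> hd (enc_nat i) = 5)" using enc_nat_symb[of "hd (enc_nat i)" i] by (cases "enc_nat i") auto
  ultimately show ?thesis using Rel by (simp add: normalize_def)
next
  case (EqA u v)
  have "split_at 3 (atom_body a @ [3]) = [5 # enc_nat u, enc_nat v]"
    using split_at_concat[of "[5 # enc_nat u, enc_nat v]" 3] EqA enc_nat_symb by fastforce
  then show ?thesis using EqA by (simp add: normalize_def)
qed

lemma parse_enc_inst: "parse (enc_inst \<phi>) = map tokens \<phi>"
proof -
  have "enc_atom = (\<lambda>a. atom_body a @ [4])" by (rule ext) (rule enc_atom_body)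
  then have "enc_inst \<phi> = concat (map (\<lambda>b. b @ [4]) (map atom_body \<phi>))"
    by (simp add: enc_inst_def comp_def)
  moreover have "4 \<notin> set b" if "b \<in> set (map atom_body \<phi>)" for b
    using that set_atom_body by fastforce
  ultimately have "split_at 4 (enc_inst \<phi>) = map atom_body \<phi>" using split_at_concat by metis
  then show ?thesis by (simp add: parse_def normalize_atom_body)
qed

lemma set_enc_inst: "set (enc_inst \<phi>) \<subseteq> {0<..<6}"
proof -
  have "set (enc_atom a) \<subseteq> {0<..<6}" for a
    using set_atom_body[of a] by (auto simp: enc_atom_body)
  then show ?thesis unfolding enc_inst_def by auto
qed

section \<open>Equality as an additional relation, and the assembly of the decision
  procedure\<close>

definition eq_rel :: "rat list set" where "eq_rel = {[a, a] | a. True}"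

definition with_eq :: "qstruct \<Rightarrow> qstruct" where "with_eq A = A @ [(2, eq_rel)]"

definition rel_code :: "qstruct \<Rightarrow> nat \<Rightarrow> nat list" where
  "rel_code A j = (if j < length A then enc_nat j else [5])"

lemma enc_nat_not_5: "enc_nat i \<noteq> [5]"
  using enc_nat_symb[of 5 i] by auto

lemma rel_code_inj: "inj_on (rel_code A) {..<length (with_eq A)}"
proof (rule inj_onI)
  fix i j assume "i \<in> {..<length (with_eq A)}" "j \<in> {..<length (with_eq A)}" "rel_code A i = rel_code A j"
  then show "i = j" using enc_nat_not_5[of i] enc_nat_not_5[of j]
    by (auto simp: rel_code_def with_eq_def enc_nat_inject less_Suc_eq split: if_splits)
qed

lemma with_eq_properties:
  assumes "PLH A" "preserved_by_max A" and j: "j < length (with_eq A)"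
  shows "(\<forall>xs\<in>snd (with_eq A ! j). length xs = fst (with_eq A ! j)) \<and> max_closed (snd (with_eq A ! j)) \<and>
    fin_det (fst (with_eq A ! j)) (\<lambda>\<rho>. point_list (fst (with_eq A ! j)) \<rho> \<in> snd (with_eq A ! j))"
proof (cases "j < length A")
  case True
  then have A: "with_eq A ! j = A ! j" "A ! j \<in> set A" by (simp_all add: with_eq_def nth_append)
  obtain k R where kR: "A ! j = (k, R)" by fastforce
  then have "(k, R) \<in> set A" using A(2) by simp
  then have "\<forall>xs\<in>R. length xs = k" "L_definable k R" "max_closed R"
    using assms(1,2) unfolding PLH_def wf_struct_def preserved_by_max_def max_closed_def by blast+
  then show ?thesis unfolding A kR using L_definable_fin_det by simp
next
  case False
  then have A: "with_eq A ! j = (2, eq_rel)" using j by (simp add: with_eq_def nth_append)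
  have "point_list 2 \<rho> = [\<rho> 0, \<rho> 1]" for \<rho> by (simp add: point_list_def upt_rec numeral_2_eq_2)
  then have "point_list 2 \<rho> \<in> eq_rel \<longleftrightarrow> 1 * pt \<rho> 1 = 1 * pt \<rho> 2" for \<rho>
    by (auto simp: eq_rel_def numeral_2_eq_2)
  then have "fin_det 2 (\<lambda>\<rho>. point_list 2 \<rho> \<in> eq_rel)" using fin_det_eq[of 1 2 2 1 1] by simp
  moreover have "max_closed eq_rel" unfolding max_closed_def eq_rel_def by auto
  ultimately show ?thesis unfolding A by (auto simp: eq_rel_def)
qed

lemma ex_gens:
  assumes "finite C" "\<And>c. c \<in> C \<Longrightarrow> small_fraction K c"
  shows "\<exists>gens. fractions gens = C \<and> (\<forall>g\<in>set gens. 0 < snd g)"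
proof -
  obtain p q where pq: "\<And>c. c \<in> C \<Longrightarrow> 0 < q c \<and> c = of_nat (p c) / of_nat (q c)"
    using assms(2) unfolding small_fraction_def by metis
  obtain xs where "set xs = C" using finite_list[OF assms(1)] by blast
  then have "fractions (map (\<lambda>c. (p c, q c)) xs) = C \<and> (\<forall>g\<in>set (map (\<lambda>c. (p c, q c)) xs). 0 < snd g)"
    using pq unfolding fractions_def by (auto simp: image_image)
  then show ?thesis by blast
qed

text \<open>As there are finitely many relations, one set \<open>C\<close> works for all of them.
  The tests for \<open>attained\<close> may rest on other constants: the samples have to preserve
  the relations, not the tests.\<close>

lemma ex_template:
  assumes "PLH A" "preserved_by_max A"
  shows "\<exists>C K gens P T. max_closed_template (with_eq A) (rel_code A) C K gens P T"
proof -
  let ?k = "\<lambda>j. fst (with_eq A ! j)" and ?R = "\<lambda>j. snd (with_eq A ! j)"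
  note props = with_eq_properties[OF assms]
  have "\<exists>C. finite C \<and> determines C (?k j) (?R j)" if "j < length (with_eq A)" for j
    using props[OF that] unfolding fin_det_determines by blast
  then obtain Cs where Cs: "\<And>j. j < length (with_eq A) \<Longrightarrow> finite (Cs j) \<and> determines (Cs j) (?k j) (?R j)" by metis
  define C where "C = (\<Union>j<length (with_eq A). Cs j)"
  have C: "finite C" unfolding C_def using Cs by auto
  have det: "determines C (?k j) (?R j)" if "j < length (with_eq A)" for j
    using determines_mono[of "Cs j" _ _ C] Cs[OF that] that unfolding C_def by blast
  obtain K where K: "1 \<le> K" "\<forall>c\<in>positive_part C. small_fraction K c"
    using ex_small_fraction_bound[OF positive_part(1)[OF C]] positive_part(2)[of _ C] by blast
  obtain gens where gens: "fractions gens = positive_part C" "\<forall>g\<in>set gens. 0 < snd g"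
    using ex_gens[OF positive_part(1)[OF C], of K] K(2) by blast
  have "\<exists>P. polytime P \<and> (\<forall>W ys. 0 < W \<longrightarrow> length ys = ?k j \<longrightarrow> (P ((W, 0) # ys) \<longleftrightarrow> map (val W) ys \<in> ?R j))"
    if "j < length (with_eq A)" for j
    using polytime_determined_membership[OF C det[OF that]] .
  then obtain P where P: "\<And>j. j < length (with_eq A) \<Longrightarrow> polytime (P j) \<and>
      (\<forall>W ys. 0 < W \<longrightarrow> length ys = ?k j \<longrightarrow> (P j ((W, 0) # ys) \<longleftrightarrow> map (val W) ys \<in> ?R j))" by metis
  have "\<exists>T. polytime T \<and> (\<forall>W ys. 0 < W \<longrightarrow> length ys = ?k j \<longrightarrow>
      (T ((W, 0) # ys) \<longleftrightarrow> map (val W) ys \<in> attained (?k j) (?R j) p))"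
    if "j < length (with_eq A)" "p < ?k j" for j p
  proof -
    have "fin_det (?k j) (\<lambda>\<rho>. point_list (?k j) \<rho> \<in> attained (?k j) (?R j) p)"
      using fin_det_attained props[OF that(1)] that(2) by blast
    then show ?thesis unfolding fin_det_determines using polytime_determined_membership by blast
  qed
  then obtain T where T: "\<And>j p. j < length (with_eq A) \<Longrightarrow> p < ?k j \<Longrightarrow> polytime (T j p) \<and>
      (\<forall>W ys. 0 < W \<longrightarrow> length ys = ?k j \<longrightarrow>
        (T j p ((W, 0) # ys) \<longleftrightarrow> map (val W) ys \<in> attained (?k j) (?R j) p))" by metis
  have "max_closed_template (with_eq A) (rel_code A) C K gens P T"
    by unfold_locales (use props det rel_code_inj C K gens P T in blast)+
  then show ?thesis by blast
qed

theorem theorem5: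
  fixes A :: qstruct
  assumes "PLH A"
    and "preserved_by_max A"
  shows "csp_in_P A"
proof -
  obtain C K gens P T where "max_closed_template (with_eq A) (rel_code A) C K gens P T"
    using ex_template[OF assms] by blast
  then interpret max_closed_template "with_eq A" "rel_code A" C K gens P T .
  have "polytime (\<lambda>w. decide (parse w))" by (rule polytime_comp[OF polytime_parse polytime_decide])
  then obtain M c d where M: "valid_tm M" "\<And>w. set w \<subseteq> {0<..<6} \<Longrightarrow>
      \<exists>t \<le> c * length w ^ d + c. fst (tm_run M t w) = (if decide (parse w) then 1 else 2)"
    using polytime_tm by blast
  have "decide (parse (enc_inst \<phi>)) \<longleftrightarrow> csp_sat A \<phi>" if wf: "\<forall>a\<in>set \<phi>. wf_atom A a" for \<phi>
  proof -
    have wfA: "\<forall>xs\<in>snd (A ! i). length xs = fst (A ! i)" "with_eq A ! i = A ! i" "rel_code A i = enc_nat i"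
      "i < length (with_eq A)" if "i < length A" for i
      using rels[of i] that by (simp_all add: with_eq_def nth_append rel_code_def)
    have eq: "with_eq A ! length A = (2, eq_rel)" "rel_code A (length A) = [5]" "length A < length (with_eq A)"
      by (simp_all add: with_eq_def rel_code_def)
    have con: "wf_con (tokens a) \<and> (\<forall>j. j < length (with_eq A) \<and> hd (tokens a) = rel_code A j \<longleftrightarrow>
        (case a of Rel i vs \<Rightarrow> j = i | EqA u v \<Rightarrow> j = length A))" if "a \<in> set \<phi>" for a
    proof (cases a)
      case (Rel i vs)
      have i: "i < length A" "length vs = fst (A ! i)" using wf that Rel by (auto simp: wf_atom_def)
      have "j < length (with_eq A) \<and> enc_nat i = rel_code A j \<longleftrightarrow> j = i" for j
        using inj_onD[OF rel_code_inj, of A i j] wfA(3,4)[OF i(1)] by auto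
      moreover have "wf_con (tokens a)"
        unfolding wf_con_def using wfA[OF i(1)] i Rel by (intro exI[of _ i]) simp
      ultimately show ?thesis using Rel by simp
    next
      case (EqA u v)
      have "j < length (with_eq A) \<and> [5] = rel_code A j \<longleftrightarrow> j = length A" for j
        using inj_onD[OF rel_code_inj, of A "length A" j] eq(2,3) by auto
      moreover have "wf_con (tokens a)"
        unfolding wf_con_def using eq EqA by (intro exI[of _ "length A"]) simp
      ultimately show ?thesis using EqA by simp
    qed
    have atom: "satisfies s (tl (tokens a), fst (with_eq A ! j), snd (with_eq A ! j)) \<longleftrightarrow> holds_atom A (\<lambda>v. s (enc_nat v)) a"
      if "a \<in> set \<phi>" "j < length (with_eq A)" "hd (tokens a) = rel_code A j" for s a j
    proof (cases a)
      case (Rel i vs)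
      then have "j = i" "i < length A" using con[OF that(1)] that wf by (auto simp: wf_atom_def)
      then show ?thesis using Rel wfA(2)[of i] by (simp add: satisfies_def holds_atom_def comp_def case_prod_beta)
    next
      case (EqA u v)
      then have "j = length A" using con[OF that(1)] that by auto
      then show ?thesis using EqA eq(1) by (auto simp: satisfies_def holds_atom_def eq_rel_def)
    qed
    have "decide (map tokens \<phi>) \<longleftrightarrow> (\<exists>s. \<forall>c\<in>constraints (map tokens \<phi>). satisfies s c)"
      by (rule decide_correct) (use con in auto)
    also have "\<dots> \<longleftrightarrow> (\<exists>s. \<forall>a\<in>set \<phi>. holds_atom A (\<lambda>v. s (enc_nat v)) a)"
    proof -
      have "(\<forall>c\<in>constraints (map tokens \<phi>). satisfies s c) \<longleftrightarrow> (\<forall>a\<in>set \<phi>. holds_atom A (\<lambda>v. s (enc_nat v)) a)" for s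
      proof
        assume s: "\<forall>c\<in>constraints (map tokens \<phi>). satisfies s c"
        show "\<forall>a\<in>set \<phi>. holds_atom A (\<lambda>v. s (enc_nat v)) a"
        proof
          fix a assume a: "a \<in> set \<phi>"
          obtain j where j: "j < length (with_eq A)" "hd (tokens a) = rel_code A j"
            using con[OF a] unfolding wf_con_def by blast
          then have "(tl (tokens a), fst (with_eq A ! j), snd (with_eq A ! j)) \<in> constraints (map tokens \<phi>)"
            using a unfolding constraints_def by auto
          then show "holds_atom A (\<lambda>v. s (enc_nat v)) a" using s atom[OF a j] by blast
        qed
      next
        assume h: "\<forall>a\<in>set \<phi>. holds_atom A (\<lambda>v. s (enc_nat v)) a"
        show "\<forall>c\<in>constraints (map tokens \<phi>). satisfies s c"
          unfolding constraints_def using h atom by fastforce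
      qed
      then show ?thesis by simp
    qed
    also have "\<dots> \<longleftrightarrow> csp_sat A \<phi>"
    proof
      assume "csp_sat A \<phi>"
      then obtain \<rho> where "\<forall>a\<in>set \<phi>. holds_atom A \<rho> a" unfolding csp_sat_def by blast
      \<comment> \<open>The procedure names variables by their codes; decoding, a left inverse of
        \<open>enc_nat\<close>, transports an assignment to these names.\<close>
      then show "\<exists>s. \<forall>a\<in>set \<phi>. holds_atom A (\<lambda>v. s (enc_nat v)) a"
        by (intro exI[of _ "\<lambda>t. \<rho> (dec_nat t)"]) simp
    qed (auto simp: csp_sat_def)
    finally show ?thesis by (simp add: parse_enc_inst)
  qed
  then have "\<exists>t\<le>c * length (enc_inst \<phi>) ^ d + c. fst (tm_run M t (enc_inst \<phi>)) \<in> {1, 2} \<and>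
      (fst (tm_run M t (enc_inst \<phi>)) = 1 \<longleftrightarrow> csp_sat A \<phi>)" if "\<forall>a\<in>set \<phi>. wf_atom A a" for \<phi>
    using M(2)[OF set_enc_inst[of \<phi>]] that by force
  then show ?thesis unfolding csp_in_P_def using M(1) by blast
qed

end
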